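(* Let $\mathbb{K}$ be any field, $n$ a positive integer, and $r=2s$ an even integer with $0<r<n$. Let $S$ be a linear subspace of $\mathrm{A}_n(\mathbb{K})$ such that $$\dim S>\max\bigl(a_{n,1,r-1},\,a_{n,s-1,3}\bigr)\quad\text{and}\quad \operatorname{urk} S\leq r.$$ Then $S$ is congruent to a subspace of $\mathrm{WA}_{n,0,r+1}(\mathbb{K})$ or to a subspace of $\mathrm{WA}_{n,s,1}(\mathbb{K})$.
   Context: $\mathrm{A}_n(\mathbb{K})$ is the space of $n\times n$ alternating matrices over $\mathbb{K}$ (skew-symmetric with zero diagonal). Two subsets $\mathcal{V},\mathcal{W}$ of $\mathrm{M}_n(\mathbb{K})$ are congruent if $\mathcal{V}=P\mathcal{W}P^T$ for some $P\in\mathrm{GL}_n(\mathbb{K})$. $\operatorname{urk}$ denotes the maximal rank of the matrices in a set. For non-negative integers $n,s,t$ with $2s+t\leq n$, $\mathrm{WA}_{n,s,t}(\mathbb{K})$ is the space of all $M=(m_{i,j})\in\mathrm{A}_n(\mathbb{K})$ with $m_{i,j}=0$ whenever $i>s$, $j>s$ and $\max(i,j)>s+t$; and $a_{n,s,t}:=\dim \mathrm{WA}_{n,s,t}(\mathbb{K})=\binom{s}{2}+\binom{t}{2}+s(n-s)$. *)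

theory Defs
  imports "Jordan_Normal_Form.DL_Rank"
begin

text \<open>Matrices are Jordan_Normal_Form matrices; indices are 0-based, so the paper's
  index i (1-based) corresponds to index i-1 here.\<close>

definition alt_mats :: "nat \<Rightarrow> 'a::field mat set" where
  "alt_mats n = {M \<in> carrier_mat n n.
      (\<forall>i<n. \<forall>j<n. M $$ (i,j) = - M $$ (j,i)) \<and> (\<forall>i<n. M $$ (i,i) = 0)}"

text \<open>WA_{n,s,t}(K): alternating matrices with m_{i,j} = 0 whenever i>s, j>s and
  max(i,j) > s+t (1-based), i.e. i>=s, j>=s, max i j >= s+t (0-based).\<close>
definition WA :: "nat \<Rightarrow> nat \<Rightarrow> nat \<Rightarrow> 'a::field mat set" where
  "WA n s t = {M \<in> alt_mats n.
      \<forall>i<n. \<forall>j<n. s \<le> i \<and> s \<le> j \<and> s + t \<le> max i j \<longrightarrow> M $$ (i,j) = 0}"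

definition a_nst :: "nat \<Rightarrow> nat \<Rightarrow> nat \<Rightarrow> nat" where
  "a_nst n s t = (s choose 2) + (t choose 2) + s * (n - s)"

abbreviation mat_space :: "'a::field itself \<Rightarrow> nat \<Rightarrow> ('a, 'a mat) module" where
  "mat_space ty n \<equiv> module_mat ty n n"

definition is_mat_subspace :: "nat \<Rightarrow> 'a::field mat set \<Rightarrow> bool" where
  "is_mat_subspace n S = subspace class_ring S (mat_space TYPE('a) n)"

definition mat_subspace_dim :: "nat \<Rightarrow> 'a::field mat set \<Rightarrow> nat" where
  "mat_subspace_dim n S = vectorspace.dim class_ring ((mat_space TYPE('a) n)\<lparr>carrier := S\<rparr>)"

definition urk_le :: "nat \<Rightarrow> 'a::field mat set \<Rightarrow> nat \<Rightarrow> bool" where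
  "urk_le n S r = (\<forall>M\<in>S. vec_space.rank n M \<le> r)"

definition congruent_sets :: "nat \<Rightarrow> 'a::field mat set \<Rightarrow> 'a mat set \<Rightarrow> bool" where
  "congruent_sets n V W = (\<exists>P \<in> carrier_mat n n. invertible_mat P \<and>
      V = (\<lambda>M. P * M * transpose_mat P) ` W)"

end

theory Submission
  imports Defs "HOL-Library.Function_Algebras"
begin

text \<open>
  The matrices are viewed as alternating bilinear forms, and one inducts on \<open>n\<close> for a fixed space \<open>S\<close> of
  forms restricted to varying subspaces \<open>E\<close> of dimension \<open>n\<close>. Let \<open>d\<close> be the minimum, over the hyperplanes
  \<open>H = ker u\<close> of \<open>E\<close>, of the dimension of the space of forms \<open>u \<and> f\<close> of \<open>S\<close> that vanish on \<open>H\<close>. A form of maximal rank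
  \<open>2m \<le> 2s\<close> shows \<open>d \<le> m\<close>. If \<open>d = s\<close>, all forms of \<open>S\<close> vanish on a common subspace of codimension \<open>s\<close>.
  If \<open>d < s\<close>, one applies the induction hypothesis either to a hyperplane \<open>H\<close> realizing the minimum, or to the
  radical \<open>G \<subseteq> H\<close> of a form of rank two that vanishes on \<open>H\<close>, on which the rank drops by two. The resulting
  isotropic or radical subspace is lifted back to \<open>E = H + \<langle>e\<rangle>\<close> by showing that the range-compatible map
  \<open>N \<mapsto> N (e, \<cdot>)\<close> is local, that is, equal to \<open>N \<mapsto> N (h, \<cdot>)\<close> for a single vector \<open>h\<close> of \<open>H\<close>.
\<close>

section \<open>Finite-dimensional subspaces of function spaces\<close>

text \<open>The field may have only two elements, so no choice of a generic scalar is available.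
  Ranks are raised by adding a single rank two form \<open>L\<close>: on a suitable pair of vectors
  \<open>N\<close> and \<open>N + L\<close> cannot both vanish (\<open>rank_two_update\<close>). The
  two outcomes of the induction are not treated alike. An isotropic subspace is always lifted. A
  radical subspace is lifted only if \<open>d = 0\<close>; for \<open>d >= 1\<close> it is
  impossible, because a common radical vector forces \<open>wd\<close> up to
  \<open>dim E - 1\<close>, or, in one borderline dimension, because it contradicts the first bound.
  The two terms of the bound have separate roles. With the first,
  \<open>a_nst n 1 (2 * s - 1)\<close>, affine subspaces of \<open>S\<close> are large enough to
  contain nondegenerate forms on a space of dimension \<open>2 * s\<close>. The second,
  \<open>a_nst n (s - 1) 3\<close>, leaves \<open>S\<close> large on the block
  \<open>C \<times> F1\<close> between an isotropic subspace and its complement. Vectors and forms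
  are both plain functions, so one interpretation \<open>fs\<close> of linear algebra serves for
  both, and restricting forms to a smaller space is a matter of counting dimensions rather than of
  changing types.\<close>

definition smul :: "'a::field \<Rightarrow> ('i \<Rightarrow> 'a) \<Rightarrow> 'i \<Rightarrow> 'a" (infixr "\<odot>" 75) where
  "c \<odot> x = (\<lambda>i. c * x i)"

lemma smul_apply: "(c \<odot> x) i = c * x i"
  by (simp add: smul_def)

interpretation fs: vector_space smul
  by unfold_locales (auto simp: fun_eq_iff smul_apply algebra_simps)

interpretation fs_pair: vector_space_pair smul smul
  by unfold_locales

text \<open>Functionals are total on the function space even where only their values on a subspace
  matter; \<open>lin_extend\<close> and \<open>lin_separate\<close> supply such total functionals
  from partial data.\<close>

definition lin :: "(('i \<Rightarrow> 'a::field) \<Rightarrow> 'a) \<Rightarrow> bool" where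
  "lin u \<longleftrightarrow> (\<forall>x y. u (x + y) = u x + u y) \<and> (\<forall>c x. u (c \<odot> x) = c * u x)"

lemma lin_add: "lin u \<Longrightarrow> u (x + y) = u x + u y"
  and lin_smul: "lin u \<Longrightarrow> u (c \<odot> x) = c * u x"
  by (auto simp: lin_def)

lemma lin_zero: "lin u \<Longrightarrow> u 0 = 0"
  using lin_smul[of u 0 0] by simp

lemma lin_uminus: "lin u \<Longrightarrow> u (- x) = - u x"
  using lin_smul[of u "- 1" x] by (simp add: fs.scale_minus_left)

lemma lin_diff: "lin u \<Longrightarrow> u (x - y) = u x - u y"
  using lin_add[of u x "- y"] lin_uminus[of u y] by simp

lemma lin_sum: "lin u \<Longrightarrow> u (\<Sum>i\<in>I. f i) = (\<Sum>i\<in>I. u (f i))"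
  by (induction I rule: infinite_finite_induct) (auto simp: lin_zero lin_add)

lemmas lin_simps = lin_add lin_smul lin_zero lin_uminus lin_diff

lemma lin_eval: "lin (\<lambda>N. N p)"
  by (simp add: lin_def smul_apply)

lemma lin_times: "lin u \<Longrightarrow> lin (\<lambda>x. a * u x)"
  by (simp add: lin_def algebra_simps)

lemma lin_plus: "lin u \<Longrightarrow> lin v \<Longrightarrow> lin (\<lambda>x. u x + v x)"
  by (simp add: lin_def algebra_simps)

lemma lin_minus: "lin u \<Longrightarrow> lin v \<Longrightarrow> lin (\<lambda>x. u x - v x)"
  by (simp add: lin_def algebra_simps)

lemma lin_subspace: "lin u \<Longrightarrow> fs.subspace {x. u x = 0}"
  by (auto simp: fs.subspace_def lin_simps)

lemma lin_zero_on_span: "lin u \<Longrightarrow> (\<And>b. b \<in> B \<Longrightarrow> u b = 0) \<Longrightarrow> x \<in> fs.span B \<Longrightarrow> u x = 0"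
  using fs.span_minimal[of B "{x. u x = 0}"] lin_subspace[of u] by blast

text \<open>The ambient function spaces may be infinite dimensional, where \<open>fs.dim\<close>
  carries no information; a finite spanning set, possibly outside \<open>V\<close>, excludes
  this.\<close>

definition fds :: "('i \<Rightarrow> 'a::field) set \<Rightarrow> bool" where
  "fds V \<longleftrightarrow> fs.subspace V \<and> (\<exists>B. finite B \<and> V \<subseteq> fs.span B)"

lemma fds_subspace: "fds V \<Longrightarrow> fs.subspace V"
  by (simp add: fds_def)

lemma fds_0: "fds V \<Longrightarrow> 0 \<in> V"
  and fds_add: "fds V \<Longrightarrow> x \<in> V \<Longrightarrow> y \<in> V \<Longrightarrow> x + y \<in> V"
  and fds_smul: "fds V \<Longrightarrow> x \<in> V \<Longrightarrow> c \<odot> x \<in> V"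
  and fds_diff: "fds V \<Longrightarrow> x \<in> V \<Longrightarrow> y \<in> V \<Longrightarrow> x - y \<in> V"
  and fds_uminus: "fds V \<Longrightarrow> x \<in> V \<Longrightarrow> - x \<in> V"
  by (auto simp: fds_def fs.subspace_0 fs.subspace_add fs.subspace_scale fs.subspace_diff fs.subspace_neg)

lemmas fds_closed = fds_0 fds_add fds_smul fds_diff fds_uminus

lemma fds_sum: "fds V \<Longrightarrow> (\<And>i. i \<in> I \<Longrightarrow> f i \<in> V) \<Longrightarrow> (\<Sum>i\<in>I. f i) \<in> V"
  by (simp add: fds_def fs.subspace_sum)

lemma fds_span: "finite B \<Longrightarrow> fds (fs.span B)"
  by (auto simp: fds_def)

lemma fds_independent:
  assumes "fds V" "B \<subseteq> V" "\<not> fs.dependent B"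
  shows "finite B" "card B \<le> fs.dim V"
proof -
  obtain A where A: "A \<subseteq> V" "\<not> fs.dependent A" "V \<subseteq> fs.span A" "card A = fs.dim V"
    by (rule fs.basis_exists)
  obtain W where W: "finite W" "V \<subseteq> fs.span W" using assms(1) by (auto simp: fds_def)
  have "finite A" using fs.independent_span_bound[of W A] W A by auto
  then show "finite B" "card B \<le> fs.dim V"
    using fs.independent_span_bound[of A B] A assms by auto
qed

lemma fds_basis:
  assumes "fds V"
  obtains B where "finite B" "\<not> fs.dependent B" "fs.span B = V" "card B = fs.dim V" "B \<subseteq> V"
proof -
  obtain A where A: "A \<subseteq> V" "\<not> fs.dependent A" "V \<subseteq> fs.span A" "card A = fs.dim V"
    by (rule fs.basis_exists)
  moreover have "finite A" using fds_independent(1)[OF assms] A by auto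
  moreover have "fs.span A = V" using A fs.span_minimal[OF A(1) fds_subspace[OF assms]] by auto
  ultimately show thesis using that by blast
qed

lemma fds_subset:
  assumes "fds V" "fs.subspace W" "W \<subseteq> V"
  shows "fds W" "fs.dim W \<le> fs.dim V"
proof -
  show W: "fds W" using assms by (auto simp: fds_def)
  obtain A where "finite A" "\<not> fs.dependent A" "fs.span A = W" "card A = fs.dim W" "A \<subseteq> W"
    using fds_basis[OF W] by metis
  then show "fs.dim W \<le> fs.dim V" using fds_independent(2)[OF assms(1), of A] assms(3) by auto
qed

lemma fds_dim_mono: "fds V \<Longrightarrow> fds W \<Longrightarrow> W \<subseteq> V \<Longrightarrow> fs.dim W \<le> fs.dim V"
  using fds_subset fds_subspace by blast

lemma fds_Int: "fds V \<Longrightarrow> fs.subspace W \<Longrightarrow> fds (V \<inter> W)"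
  using fds_subset(1)[of V "V \<inter> W"] fs.subspace_inter[of V W] fds_subspace[of V] by blast

lemma fds_complement:
  assumes "fds V" "fs.subspace W" "W \<subseteq> V"
  obtains C where "fds C" "C \<subseteq> V" "fs.dim W + fs.dim C = fs.dim V" "W \<inter> C = {0}"
    "\<forall>v\<in>V. \<exists>w\<in>W. \<exists>c\<in>C. v = w + c"
proof -
  have fW: "fds W" using fds_subset assms by blast
  obtain A where A: "finite A" "\<not> fs.dependent A" "fs.span A = W" "card A = fs.dim W" "A \<subseteq> W"
    using fds_basis[OF fW] by metis
  obtain B where B: "A \<subseteq> B" "B \<subseteq> V" "\<not> fs.dependent B" "V \<subseteq> fs.span B"
    using fs.maximal_independent_subset_extend[of A V] A assms(3) by auto
  have fB: "finite B" using fds_independent[OF assms(1) B(2,3)] by auto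
  have cB: "card B = fs.dim V" using B fs.basis_card_eq_dim by blast
  let ?C = "fs.span (B - A)"
  have iC: "\<not> fs.dependent (B - A)" using B(3) fs.dependent_mono[of "B - A" B] by auto
  show thesis
  proof (rule that[of ?C])
    show "fds ?C" using fB by (simp add: fds_span)
    show "?C \<subseteq> V" using fs.span_minimal[of "B - A" V] B(2) fds_subspace[OF assms(1)] by auto
    show "fs.dim W + fs.dim ?C = fs.dim V"
      using fs.dim_span_eq_card_independent[OF iC] A(4) cB card_Diff_subset[OF A(1) B(1)]
        card_mono[OF fB B(1)] by simp
    show "W \<inter> ?C = {0}"
    proof (rule ccontr)
      assume "W \<inter> ?C \<noteq> {0}"
      moreover have "0 \<in> W \<inter> ?C" using A(3) fs.span_zero by auto
      ultimately obtain x where x: "x \<in> fs.span A" "x \<in> ?C" "x \<noteq> 0" using A(3) by blast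
      \<comment> \<open>The coordinates of \<open>x\<close> in \<open>B\<close> are supported both
        in \<open>A\<close> and in \<open>B - A\<close>, hence they all vanish.\<close>
      have "fs.representation B x = fs.representation A x"
        using fs.representation_extend[OF B(3) x(1) B(1)] .
      moreover have "fs.representation B x = fs.representation (B - A) x"
        using fs.representation_extend[OF B(3) x(2)] by auto
      ultimately have "fs.representation A x b = 0" for b
        using fs.representation_ne_zero[of A x b] fs.representation_ne_zero[of "B - A" x b] by auto
      then have "x = 0" using fs.sum_nonzero_representation_eq[OF A(2) x(1)] by auto
      then show False using x(3) by simp
    qed
    have "v \<in> fs.span (A \<union> (B - A))" if "v \<in> V" for v using B that by (auto simp: Un_absorb1)
    then show "\<forall>v\<in>V. \<exists>w\<in>W. \<exists>c\<in>?C. v = w + c" unfolding fs.span_Un A(3) by blast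
  qed
qed

lemma fds_dim_0: "fds V \<Longrightarrow> fs.dim V = 0 \<longleftrightarrow> V = {0}"
proof
  assume V: "fds V" "fs.dim V = 0"
  obtain B where "finite B" "fs.span B = V" "card B = fs.dim V" using fds_basis[OF V(1)] by metis
  then show "V = {0}" using V(2) by auto
next
  assume "V = {0}"
  then show "fs.dim V = 0" using fs.dim_le_card[of V "{}"] by auto
qed

lemma fds_eq:
  assumes "fds V" "fs.subspace W" "W \<subseteq> V" "fs.dim V \<le> fs.dim W"
  shows "W = V"
proof -
  obtain C where C: "fds C" "fs.dim W + fs.dim C = fs.dim V" "\<forall>v\<in>V. \<exists>w\<in>W. \<exists>c\<in>C. v = w + c"
    using fds_complement[OF assms(1-3)] by metis
  then have "C = {0}" using assms(4) fds_dim_0 by force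
  then show ?thesis using C(3) assms(3) by auto
qed

lemma fds_insert:
  assumes "fds V" "x \<notin> V"
  shows "fds (fs.span (insert x V))" "fs.dim (fs.span (insert x V)) = fs.dim V + 1"
proof -
  obtain B where B: "finite B" "\<not> fs.dependent B" "fs.span B = V" "card B = fs.dim V" "B \<subseteq> V"
    using fds_basis[OF assms(1)] by metis
  have eq: "fs.span (insert x V) = fs.span (insert x B)"
    unfolding fs.span_insert B(3) by (simp only: fs.span_eq_iff[THEN iffD2, OF fds_subspace[OF assms(1)]])
  then show "fds (fs.span (insert x V))" using B(1) by (simp add: fds_span)
  have "\<not> fs.dependent (insert x B)" using fs.independent_insertI[of x B] B assms(2) by auto
  then show "fs.dim (fs.span (insert x V)) = fs.dim V + 1"
    using fs.dim_span_eq_card_independent[of "insert x B"] B assms(2) unfolding eq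
    by (metis card_insert_disjoint Suc_eq_plus1 subsetD)
qed

lemma in_span_insert_iff: "fs.subspace V \<Longrightarrow> y \<in> fs.span (insert x V) \<longleftrightarrow> (\<exists>c. \<exists>v\<in>V. y = c \<odot> x + v)"
proof -
  assume V: "fs.subspace V"
  have "y \<in> fs.span (insert x V) \<longleftrightarrow> (\<exists>k. y - k \<odot> x \<in> V)"
    by (simp add: fs.span_insert fs.span_eq_iff[THEN iffD2, OF V])
  also have "\<dots> \<longleftrightarrow> (\<exists>c. \<exists>v\<in>V. y = c \<odot> x + v)" by (metis add_diff_cancel_left' diff_add_cancel add.commute)
  finally show ?thesis .
qed

lemma fds_kernel:
  assumes "fds V" "lin u"
  shows "fds (V \<inter> {x. u x = 0})" "fs.dim V \<le> fs.dim (V \<inter> {x. u x = 0}) + 1"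
    "v \<in> V \<Longrightarrow> u v \<noteq> 0 \<Longrightarrow> fs.dim V = fs.dim (V \<inter> {x. u x = 0}) + 1"
proof -
  let ?K = "V \<inter> {x. u x = 0}"
  show K: "fds ?K" using fds_Int assms lin_subspace by blast
  show main: "fs.dim V = fs.dim ?K + 1" if v: "v \<in> V" "u v \<noteq> 0" for v
  proof -
    have "fs.span (insert v ?K) = V"
    proof
      show "fs.span (insert v ?K) \<subseteq> V" using fs.span_minimal[of "insert v ?K" V] v fds_subspace[OF assms(1)] by auto
      show "V \<subseteq> fs.span (insert v ?K)"
      proof
        fix x assume x: "x \<in> V"
        let ?c = "u x / u v"
        have "x - ?c \<odot> v \<in> ?K" using x v assms by (auto simp: fds_closed lin_simps)
        then have "\<exists>c. \<exists>w\<in>?K. x = c \<odot> v + w" by (metis add.commute diff_add_cancel)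
        then show "x \<in> fs.span (insert v ?K)" using in_span_insert_iff[OF fds_subspace[OF K]] by blast
      qed
    qed
    then show ?thesis using fds_insert(2)[OF K, of v] v by auto
  qed
  show "fs.dim V \<le> fs.dim ?K + 1"
  proof (cases "\<exists>v\<in>V. u v \<noteq> 0")
    case True then show ?thesis using main by auto
  next
    case False then have "?K = V" by auto
    then show ?thesis by simp
  qed
qed

lemma fds_kernels:
  assumes "fds V" "finite I" "\<And>i. i \<in> I \<Longrightarrow> lin (g i)"
  shows "fds (V \<inter> {x. \<forall>i\<in>I. g i x = 0})" "fs.dim V \<le> fs.dim (V \<inter> {x. \<forall>i\<in>I. g i x = 0}) + card I"
proof -
  have "fds (V \<inter> {x. \<forall>i\<in>I. g i x = 0}) \<and> fs.dim V \<le> fs.dim (V \<inter> {x. \<forall>i\<in>I. g i x = 0}) + card I"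
    using assms(2,3)
  proof (induction I rule: finite_induct)
    case empty then show ?case using assms by simp
  next
    case (insert i I)
    let ?W = "V \<inter> {x. \<forall>i\<in>I. g i x = 0}"
    have W: "fds ?W" "fs.dim V \<le> fs.dim ?W + card I" using insert by auto
    have eq: "V \<inter> {x. \<forall>i\<in>insert i I. g i x = 0} = ?W \<inter> {x. g i x = 0}" by auto
    show ?case unfolding eq using fds_kernel(1,2)[OF W(1), of "g i"] W insert by auto
  qed
  then show "fds (V \<inter> {x. \<forall>i\<in>I. g i x = 0})" "fs.dim V \<le> fs.dim (V \<inter> {x. \<forall>i\<in>I. g i x = 0}) + card I" by auto
qed

lemma fds_common_zero:
  assumes "fds V" "finite I" "\<And>i. i \<in> I \<Longrightarrow> lin (g i)" "card I < fs.dim V"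
  obtains x where "x \<in> V" "x \<noteq> 0" "\<And>i. i \<in> I \<Longrightarrow> g i x = 0"
proof -
  let ?W = "V \<inter> {x. \<forall>i\<in>I. g i x = 0}"
  have "fds ?W" "fs.dim ?W \<noteq> 0" using fds_kernels[of V I g] assms by auto
  then have "?W \<noteq> {0}" "0 \<in> ?W" using fds_dim_0[of ?W] fds_0[of ?W] by auto
  then obtain x where "x \<in> ?W" "x \<noteq> 0" by blast
  then show thesis using that by auto
qed

lemma fds_subspace_of_dim:
  assumes "fds V" "k \<le> fs.dim V"
  obtains W where "fds W" "W \<subseteq> V" "fs.dim W = k"
proof -
  obtain B where B: "finite B" "\<not> fs.dependent B" "fs.span B = V" "card B = fs.dim V" "B \<subseteq> V"
    using fds_basis[OF assms(1)] by metis
  obtain A where A: "A \<subseteq> B" "card A = k" using obtain_subset_with_card_n[of k B] assms B by auto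
  have "\<not> fs.dependent A" using A B fs.dependent_mono by blast
  then show thesis using that[of "fs.span A"] A B fs.dim_span_eq_card_independent fs.span_mono fds_span
    by (metis finite_subset)
qed

lemma lin_extend:
  fixes g :: "('i \<Rightarrow> 'a::field) \<Rightarrow> 'a"
  assumes "\<not> fs.dependent B"
  obtains u where "lin u" "\<And>b. b \<in> B \<Longrightarrow> u b = g b"
proof -
  obtain L :: "('i \<Rightarrow> 'a) \<Rightarrow> unit \<Rightarrow> 'a" where L: "Vector_Spaces.linear smul smul L" "\<forall>b\<in>B. L b = (\<lambda>_. g b)"
    using fs_pair.linear_independent_extend[OF assms, of "\<lambda>b _. g b"] by auto
  interpret L: Vector_Spaces.linear smul smul L by (rule L(1))
  show thesis using that[of "\<lambda>x. L x ()"] L(2) by (auto simp: lin_def L.add L.scale smul_apply)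
qed

lemma lin_separate:
  assumes "fs.subspace V" "x \<notin> V"
  obtains u where "lin u" "u x = 1" "\<And>v. v \<in> V \<Longrightarrow> u v = 0"
proof -
  obtain B where B: "B \<subseteq> V" "\<not> fs.dependent B" "V \<subseteq> fs.span B" by (rule fs.basis_exists)
  have "x \<notin> fs.span B" using assms B fs.span_minimal[of B V] by auto
  then have "\<not> fs.dependent (insert x B)" using fs.independent_insertI B by blast
  then obtain u where u: "lin u" "\<And>b. b \<in> insert x B \<Longrightarrow> u b = (if b = x then 1 else 0)"
    using lin_extend[of "insert x B" "\<lambda>b. if b = x then 1 else 0"] by blast
  have "u v = 0" if "v \<in> V" for v
  proof (rule lin_zero_on_span[OF u(1)])
    show "u b = 0" if "b \<in> B" for b using u(2)[of b] that B(1) assms(2) by auto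
    show "v \<in> fs.span B" using that B by auto
  qed
  then show thesis using that u by auto
qed

text \<open>Induction on \<open>I\<close>: on the kernel of \<open>g i\<close> the remaining
  functionals suffice, and one vector \<open>y\<close> outside this kernel determines the missing
  coefficient. It is applied to functionals on vectors and also to evaluations of forms, where
  \<open>V\<close> is a space of forms.\<close>

lemma lin_kernel_combination:
  assumes "finite I" "\<And>i. i \<in> I \<Longrightarrow> lin (g i)" "lin f" "fs.subspace V"
    "\<And>x. x \<in> V \<Longrightarrow> (\<And>i. i \<in> I \<Longrightarrow> g i x = 0) \<Longrightarrow> f x = 0"
  shows "\<exists>a. \<forall>x\<in>V. f x = (\<Sum>i\<in>I. a i * g i x)"
  using assms
proof (induction I arbitrary: V rule: finite_induct)
  case empty then show ?case by auto
next
  case (insert i I)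
  let ?W = "V \<inter> {x. g i x = 0}"
  have sW: "fs.subspace ?W" using fs.subspace_inter[of V] insert.prems lin_subspace[of "g i"] by blast
  have "\<exists>a. \<forall>x\<in>?W. f x = (\<Sum>i\<in>I. a i * g i x)"
    by (rule insert.IH) (use insert.prems sW in auto)
  then obtain a where a: "\<And>x. x \<in> ?W \<Longrightarrow> f x = (\<Sum>i\<in>I. a i * g i x)" by blast
  let ?h = "\<lambda>x. f x - (\<Sum>i\<in>I. a i * g i x)"
  have lh: "?h (x - c \<odot> y) = ?h x - c * ?h y" for x y c
    using insert.prems(1,2) by (simp add: lin_simps algebra_simps sum_subtractf sum_distrib_left)
  have upd: "(\<Sum>j\<in>insert i I. (a(i := b)) j * g j x) = b * g i x + (\<Sum>i\<in>I. a i * g i x)" for b x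
    using insert.hyps by (auto intro!: sum.cong)
  show ?case
  proof (cases "\<exists>y\<in>V. g i y \<noteq> 0")
    case False
    then have "\<forall>x\<in>V. f x = (\<Sum>j\<in>insert i I. (a(i := 0)) j * g j x)" using a upd by auto
    then show ?thesis by blast
  next
    case True
    then obtain y where y: "y \<in> V" "g i y \<noteq> 0" by blast
    have "f x = (\<Sum>j\<in>insert i I. (a(i := ?h y / g i y)) j * g j x)" if x: "x \<in> V" for x
    proof -
      let ?c = "g i x / g i y"
      have "x - ?c \<odot> y \<in> ?W" using x y insert.prems(1)[of i] fs.subspace_diff[OF insert.prems(3)]
          fs.subspace_scale[OF insert.prems(3)] by (auto simp: lin_simps)
      then have "?h (x - ?c \<odot> y) = 0" using a by simp
      then have "?h x = ?c * ?h y" using lh by simp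
      then have "f x = ?c * ?h y + (\<Sum>i\<in>I. a i * g i x)" by (simp add: algebra_simps)
      then show ?thesis unfolding upd by simp
    qed
    then show ?thesis by blast
  qed
qed

lemma fds_rank_nullity:
  fixes T :: "('i \<Rightarrow> 'a::field) \<Rightarrow> ('j \<Rightarrow> 'a)"
  assumes "fds V" "\<And>x y. T (x + y) = T x + T y" "\<And>c x. T (c \<odot> x) = c \<odot> T x"
  shows "fds (T ` V)" "fs.dim V = fs.dim (V \<inter> {x. T x = 0}) + fs.dim (T ` V)"
proof -
  interpret T: Vector_Spaces.linear smul smul T using assms(2,3) by unfold_locales auto
  let ?K = "V \<inter> {x. T x = 0}"
  have sK: "fs.subspace ?K" using fs.subspace_inter[OF fds_subspace[OF assms(1)] T.subspace_kernel] by simp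
  obtain C where C: "fds C" "C \<subseteq> V" "fs.dim ?K + fs.dim C = fs.dim V" "?K \<inter> C = {0}"
    "\<forall>v\<in>V. \<exists>w\<in>?K. \<exists>c\<in>C. v = w + c" by (rule fds_complement[OF assms(1) sK Int_lower1])
  have eq: "T ` V = T ` C"
  proof
    show "T ` V \<subseteq> T ` C" using C(5) by (force simp: T.add)
  qed (use C in auto)
  have inj: "inj_on T C"
  proof (rule inj_onI)
    fix x y assume xy: "x \<in> C" "y \<in> C" "T x = T y"
    then have "x - y \<in> ?K \<inter> C" using C(1,2) assms(1) by (auto simp: T.diff fds_closed)
    then show "x = y" using C(4) by auto
  qed
  obtain B where B: "finite B" "\<not> fs.dependent B" "fs.span B = C" "card B = fs.dim C"
    using fds_basis[OF C(1)] by metis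
  have sp: "fs.span (T ` B) = T ` C" using T.span_image[of B] B by simp
  have ind: "\<not> fs.dependent (T ` B)" using T.independent_injective_image[OF B(2)] inj unfolding B(3) by blast
  show "fds (T ` V)" unfolding eq sp[symmetric] using B by (simp add: fds_span)
  have "inj_on T B" using inj inj_on_subset B(3) fs.span_superset by metis
  then show "fs.dim V = fs.dim ?K + fs.dim (T ` V)"
    unfolding eq sp[symmetric] using C(3) fs.dim_span_eq_card_independent[OF ind] B(4) card_image by metis
qed

definition ssum :: "('i \<Rightarrow> 'a::field) set \<Rightarrow> ('i \<Rightarrow> 'a) set \<Rightarrow> ('i \<Rightarrow> 'a) set" where
  "ssum A B = {a + b |a b. a \<in> A \<and> b \<in> B}"

lemma ssumI: "a \<in> A \<Longrightarrow> b \<in> B \<Longrightarrow> a + b \<in> ssum A B"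
  by (auto simp: ssum_def)

lemma ssumE: "x \<in> ssum A B \<Longrightarrow> (\<And>a b. a \<in> A \<Longrightarrow> b \<in> B \<Longrightarrow> x = a + b \<Longrightarrow> P) \<Longrightarrow> P"
  by (auto simp: ssum_def)

lemma ssum_superset: "fds A \<Longrightarrow> fds B \<Longrightarrow> A \<subseteq> ssum A B" "fds A \<Longrightarrow> fds B \<Longrightarrow> B \<subseteq> ssum A B"
  using ssumI[of _ A 0 B] ssumI[of 0 A _ B] by (auto simp: fds_0)

lemma ssum_subset: "fds V \<Longrightarrow> A \<subseteq> V \<Longrightarrow> B \<subseteq> V \<Longrightarrow> ssum A B \<subseteq> V"
  by (auto simp: ssum_def intro!: fds_add)

lemma fds_ssum:
  assumes "fds A" "fds B"
  shows "fds (ssum A B)" "fs.dim (ssum A B) \<le> fs.dim A + fs.dim B"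
    "A \<inter> B = {0} \<Longrightarrow> fs.dim (ssum A B) = fs.dim A + fs.dim B"
proof -
  obtain X where X: "finite X" "\<not> fs.dependent X" "fs.span X = A" "card X = fs.dim A"
    using fds_basis[OF assms(1)] by metis
  obtain Y where Y: "finite Y" "\<not> fs.dependent Y" "fs.span Y = B" "card Y = fs.dim B"
    using fds_basis[OF assms(2)] by metis
  have eq: "ssum A B = fs.span (X \<union> Y)" unfolding fs.span_Un X(3) Y(3) ssum_def by blast
  show S: "fds (ssum A B)" unfolding eq using X Y by (simp add: fds_span)
  show "fs.dim (ssum A B) \<le> fs.dim A + fs.dim B"
    using fs.dim_le_card[of "ssum A B" "X \<union> Y"] X Y card_Un_le[of X Y] eq by auto
  assume d: "A \<inter> B = {0}"
  have XY: "X \<inter> Y = {}"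
  proof (rule ccontr)
    assume "X \<inter> Y \<noteq> {}"
    then obtain z where "z \<in> X" "z \<in> Y" by blast
    then have "z \<in> A \<inter> B" using X Y fs.span_base by auto
    then have "z = 0" using d by auto
    then show False using \<open>z \<in> X\<close> X(2) fs.dependent_zero by blast
  qed
  have "\<not> fs.dependent (X \<union> Y)"
  proof (rule ccontr)
    assume "\<not> \<not> fs.dependent (X \<union> Y)"
    then obtain f where f: "\<exists>v\<in>X \<union> Y. f v \<noteq> 0" "(\<Sum>v\<in>X \<union> Y. f v \<odot> v) = 0"
      using fs.dependent_finite[of "X \<union> Y"] X Y by auto
    then have s: "(\<Sum>v\<in>X. f v \<odot> v) + (\<Sum>v\<in>Y. f v \<odot> v) = 0"
      using f(2) X(1) Y(1) XY sum.union_disjoint[of X Y "\<lambda>v. f v \<odot> v"] by auto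
    have a: "(\<Sum>v\<in>X. f v \<odot> v) \<in> A" unfolding X(3)[symmetric] by (intro fs.span_sum fs.span_scale fs.span_base)
    have b: "(\<Sum>v\<in>Y. f v \<odot> v) \<in> B" unfolding Y(3)[symmetric] by (intro fs.span_sum fs.span_scale fs.span_base)
    have e: "(\<Sum>v\<in>X. f v \<odot> v) = - (\<Sum>v\<in>Y. f v \<odot> v)" using s by (simp add: eq_neg_iff_add_eq_0)
    then have "(\<Sum>v\<in>X. f v \<odot> v) \<in> A \<inter> B" using a b fds_uminus[OF assms(2)] by auto
    then have z: "(\<Sum>v\<in>X. f v \<odot> v) = 0" using d by auto
    then have z': "(\<Sum>v\<in>Y. f v \<odot> v) = 0" using e by simp
    show False using z z' f(1) X(1,2) Y(1,2) fs.dependent_finite by blast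
  qed
  then have "fs.dim (ssum A B) = card (X \<union> Y)" using eq fs.dim_span_eq_card_independent by auto
  then show "fs.dim (ssum A B) = fs.dim A + fs.dim B" using card_Un_disjoint[OF X(1) Y(1) XY] X(4) Y(4) by metis
qed

section \<open>Alternating forms\<close>

text \<open>The arguments are paired, not curried, so that a form is a function into the field and
  spaces of forms are subspaces in the sense of \<open>fs\<close>. Vanishing on the diagonal is
  required outright because in characteristic two it does not follow from skew symmetry.\<close>

definition alt :: "(('i \<Rightarrow> 'a::field) \<times> ('i \<Rightarrow> 'a) \<Rightarrow> 'a) \<Rightarrow> bool" where
  "alt N \<longleftrightarrow> (\<forall>y. lin (\<lambda>x. N (x, y))) \<and> (\<forall>x. lin (\<lambda>y. N (x, y))) \<and> (\<forall>x. N (x, x) = 0)"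

lemma alt_lin1: "alt N \<Longrightarrow> lin (\<lambda>x. N (x, y))"
  and alt_lin2: "alt N \<Longrightarrow> lin (\<lambda>y. N (x, y))"
  and alt_self: "alt N \<Longrightarrow> N (x, x) = 0"
  by (simp_all add: alt_def)

lemmas alt_simps = lin_simps[OF alt_lin1] lin_simps[OF alt_lin2] alt_self

lemma alt_swap: assumes "alt N" shows "N (x, y) = - N (y, x)"
proof -
  have "N (x + y, x + y) = N (x, y) + N (y, x)" using assms by (simp add: alt_simps)
  then show ?thesis using alt_self[OF assms] by (simp add: eq_neg_iff_add_eq_0)
qed

lemma alt_zero_swap: "alt N \<Longrightarrow> N (x, y) = 0 \<longleftrightarrow> N (y, x) = 0"
  using alt_swap[of N x y] by simp

lemma alt_sum1: "alt N \<Longrightarrow> N (\<Sum>i\<in>I. f i, y) = (\<Sum>i\<in>I. N (f i, y))"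
  using lin_sum[OF alt_lin1] by blast

lemma alt_sum2: "alt N \<Longrightarrow> N (x, \<Sum>i\<in>I. f i) = (\<Sum>i\<in>I. N (x, f i))"
  using lin_sum[OF alt_lin2] by blast

lemma alt_plus: "alt N \<Longrightarrow> alt L \<Longrightarrow> alt (N + L)"
  unfolding alt_def by (simp add: lin_plus)

lemma alt_zero_span2:
  "alt N \<Longrightarrow> (\<And>b. b \<in> B \<Longrightarrow> N (x, b) = 0) \<Longrightarrow> y \<in> fs.span B \<Longrightarrow> N (x, y) = 0"
  using lin_zero_on_span[OF alt_lin2] by blast

lemma alt_zero_span1:
  "alt N \<Longrightarrow> (\<And>b. b \<in> B \<Longrightarrow> N (b, y) = 0) \<Longrightarrow> x \<in> fs.span B \<Longrightarrow> N (x, y) = 0"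
  using lin_zero_on_span[OF alt_lin1] by blast

lemma fds_perp:
  assumes "alt N" "fds E"
  shows "fds {x \<in> E. \<forall>a\<in>A. N (a, x) = 0}" "fds {x \<in> E. \<forall>a\<in>A. N (x, a) = 0}"
proof -
  have "fs.subspace {x \<in> E. \<forall>a\<in>A. N (a, x) = 0}"
    using assms by (auto simp: fs.subspace_def alt_simps fds_closed)
  then show *: "fds {x \<in> E. \<forall>a\<in>A. N (a, x) = 0}" using fds_subset[OF assms(2)] by blast
  have "{x \<in> E. \<forall>a\<in>A. N (x, a) = 0} = {x \<in> E. \<forall>a\<in>A. N (a, x) = 0}"
    using alt_zero_swap[OF assms(1)] by blast
  then show "fds {x \<in> E. \<forall>a\<in>A. N (x, a) = 0}" using * by simp
qed

text \<open>Since no nonzero element of \<open>A\<close> is orthogonal to \<open>E\<close>, a basis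
  of \<open>A\<close> yields functionals that are independent on \<open>E\<close>, and each of them
  cuts the dimension by exactly one.\<close>

lemma perp_dim:
  assumes "alt N" "fds E" "fds A" "\<And>a. a \<in> A \<Longrightarrow> (\<And>x. x \<in> E \<Longrightarrow> N (a, x) = 0) \<Longrightarrow> a = 0"
  shows "fs.dim {x \<in> E. \<forall>a\<in>A. N (a, x) = 0} + fs.dim A = fs.dim E"
proof -
  obtain B where B: "finite B" "\<not> fs.dependent B" "fs.span B = A" "card B = fs.dim A"
    using fds_basis[OF assms(3)] by metis
  have "fs.dim {x \<in> E. \<forall>a\<in>P. N (a, x) = 0} + card P = fs.dim E" if "P \<subseteq> B" for P
    using finite_subset[OF that B(1)] that
  proof (induction P rule: finite_induct)
    case empty then show ?case by simp
  next
    case (insert b P)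
    let ?W = "{x \<in> E. \<forall>a\<in>P. N (a, x) = 0}"
    have W: "fds ?W" using fds_perp(1)[OF assms(1,2)] .
    have "\<exists>w\<in>?W. N (b, w) \<noteq> 0"
    proof (rule ccontr)
      assume neg: "\<not> (\<exists>w\<in>?W. N (b, w) \<noteq> 0)"
      have "\<exists>c. \<forall>x\<in>E. N (b, x) = (\<Sum>i\<in>P. c i * N (i, x))"
        by (rule lin_kernel_combination) (use insert neg alt_lin2[OF assms(1)] fds_subspace[OF assms(2)] in auto)
      then obtain c where c: "\<And>x. x \<in> E \<Longrightarrow> N (b, x) = (\<Sum>i\<in>P. c i * N (i, x))" by blast
      let ?s = "\<Sum>i\<in>P. c i \<odot> i"
      have sP: "?s \<in> fs.span P" by (intro fs.span_sum fs.span_scale fs.span_base)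
      have "b - ?s = 0"
      proof (rule assms(4))
        have "b \<in> A" "?s \<in> A" using insert.prems sP fs.span_mono[of P B] fs.span_base[of b B] B(3) by auto
        then show "b - ?s \<in> A" using assms(3) by (simp add: fds_diff)
        fix x assume "x \<in> E"
        then show "N (b - ?s, x) = 0" using c assms(1) by (simp add: alt_simps alt_sum1)
      qed
      then have "b \<in> fs.span P" using sP by simp
      moreover have "P \<subseteq> B - {b}" using insert by auto
      ultimately show False using B(2) insert.prems fs.span_mono[of P "B - {b}"] unfolding fs.dependent_def by blast
    qed
    then obtain w where w: "w \<in> ?W" "N (b, w) \<noteq> 0" by blast
    have eq: "{x \<in> E. \<forall>a\<in>insert b P. N (a, x) = 0} = ?W \<inter> {x. N (b, x) = 0}" by auto
    have "fs.dim ?W = fs.dim (?W \<inter> {x. N (b, x) = 0}) + 1"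
      by (rule fds_kernel(3)[OF W alt_lin2[OF assms(1)] w])
    then show ?case unfolding eq using insert by simp
  qed
  from this[of B] have "fs.dim {x \<in> E. \<forall>a\<in>B. N (a, x) = 0} + card B = fs.dim E" by simp
  moreover have "{x \<in> E. \<forall>a\<in>B. N (a, x) = 0} = {x \<in> E. \<forall>a\<in>A. N (a, x) = 0}"
    using alt_zero_span1[OF assms(1), of B] fs.span_base[of _ B] unfolding B(3) by blast
  ultimately show ?thesis using B(4) by simp
qed

definition nondeg :: "(('i \<Rightarrow> 'a::field) \<times> ('i \<Rightarrow> 'a) \<Rightarrow> 'a) \<Rightarrow> ('i \<Rightarrow> 'a) set \<Rightarrow> bool" where
  "nondeg N F \<longleftrightarrow> (\<forall>x\<in>F. (\<forall>y\<in>F. N (x, y) = 0) \<longrightarrow> x = 0)"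

lemma nondegD: "nondeg N F \<Longrightarrow> x \<in> F \<Longrightarrow> (\<And>y. y \<in> F \<Longrightarrow> N (x, y) = 0) \<Longrightarrow> x = 0"
  by (auto simp: nondeg_def)

lemma nondeg_cong: "nondeg N F \<Longrightarrow> (\<And>x y. x \<in> F \<Longrightarrow> y \<in> F \<Longrightarrow> N (x, y) = L (x, y)) \<Longrightarrow> nondeg L F"
  by (auto simp: nondeg_def)

text \<open>By nondegeneracy the functionals \<open>N (b, \<cdot>)\<close>, for \<open>b\<close> in
  a basis of \<open>F\<close>, have no common zero in \<open>F\<close> except 0, so every functional
  is a combination of them on \<open>F\<close>.\<close>

lemma nondeg_represent:
  assumes "alt N" "fds F" "nondeg N F" "lin f"
  obtains a where "a \<in> F" "\<And>x. x \<in> F \<Longrightarrow> N (a, x) = f x"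
proof -
  obtain B where B: "finite B" "\<not> fs.dependent B" "fs.span B = F" "card B = fs.dim F"
    using fds_basis[OF assms(2)] by metis
  have "\<exists>c. \<forall>x\<in>F. f x = (\<Sum>i\<in>B. c i * N (i, x))"
  proof (rule lin_kernel_combination)
    fix x assume x: "x \<in> F" "\<And>i. i \<in> B \<Longrightarrow> N (i, x) = 0"
    have "x = 0"
    proof (rule nondegD[OF assms(3) x(1)])
      fix y assume "y \<in> F"
      then have "N (y, x) = 0" using alt_zero_span1[OF assms(1), of B x y] x(2) B(3) by blast
      then show "N (x, y) = 0" using alt_swap[OF assms(1), of x y] by simp
    qed
    then show "f x = 0" using lin_zero assms by auto
  qed (use B assms alt_lin2 fds_subspace in auto)
  then obtain c where c: "\<And>x. x \<in> F \<Longrightarrow> f x = (\<Sum>i\<in>B. c i * N (i, x))" by blast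
  have "(\<Sum>i\<in>B. c i \<odot> i) \<in> F" unfolding B(3)[symmetric] by (intro fs.span_sum fs.span_scale fs.span_base)
  moreover have "N (\<Sum>i\<in>B. c i \<odot> i, x) = f x" if "x \<in> F" for x
    using c[OF that] assms(1) by (simp add: alt_sum1 alt_simps)
  ultimately show thesis using that by blast
qed

lemma nondeg_project:
  assumes "alt N" "fds F" "nondeg N F"
  obtains a where "a \<in> F" "\<And>x. x \<in> F \<Longrightarrow> N (p - a, x) = 0"
proof -
  obtain a where "a \<in> F" "\<And>x. x \<in> F \<Longrightarrow> N (a, x) = N (p, x)"
    using nondeg_represent[OF assms alt_lin2[OF assms(1)]] by metis
  then show thesis using that[of a] assms(1) by (simp add: alt_simps)
qed

text \<open>A hyperbolic plane orthogonal to \<open>F\<close> is added to it. Every use of the rank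
  bound goes through this: a pair \<open>p\<close>, \<open>q\<close> orthogonal to a nondegenerate
  space of maximal dimension must satisfy \<open>N (p, q) = 0\<close>.\<close>

lemma nondeg_extend:
  assumes "alt N" "fds F" "nondeg N F" "fds E" "F \<subseteq> E" "p \<in> E" "q \<in> E"
    "\<And>x. x \<in> F \<Longrightarrow> N (p, x) = 0" "\<And>x. x \<in> F \<Longrightarrow> N (q, x) = 0" "N (p, q) \<noteq> 0"
  obtains G where "fds G" "G \<subseteq> E" "fs.dim G = fs.dim F + 2" "nondeg N G"
proof -
  let ?Q = "fs.span (insert q F)" let ?G = "fs.span (insert p ?Q)"
  have q: "q \<notin> F" using assms(8)[of q] assms(10) by auto
  have Q: "fds ?Q" "fs.dim ?Q = fs.dim F + 1" using fds_insert[OF assms(2) q] by auto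
  have Qmem: "\<exists>b. \<exists>f\<in>F. x = b \<odot> q + f" if "x \<in> ?Q" for x
    using that in_span_insert_iff[OF fds_subspace[OF assms(2)]] by auto
  have xq: "N (x, q) = 0" if "x \<in> F" for x using assms(9)[OF that] alt_swap[OF assms(1), of x q] by simp
  have xp: "N (x, p) = 0" if "x \<in> F" for x using assms(8)[OF that] alt_swap[OF assms(1), of x p] by simp
  have qp: "N (q, p) = - N (p, q)" by (rule alt_swap[OF assms(1)])
  have p: "p \<notin> ?Q"
  proof
    assume "p \<in> ?Q"
    then obtain b f where bf: "p = b \<odot> q + f" "f \<in> F" using Qmem by blast
    have "N (p, q) = b * N (q, q) + N (f, q)" unfolding bf(1) using assms(1) by (simp only: alt_simps)
    then show False using xq[OF bf(2)] assms(1,10) by (simp add: alt_self)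
  qed
  have sub: "?Q \<subseteq> E" "?G \<subseteq> E"
  proof -
    show Q: "?Q \<subseteq> E" using fs.span_minimal[of "insert q F" E] assms(5,7) fds_subspace[OF assms(4)] by auto
    show "?G \<subseteq> E" using fs.span_minimal[of "insert p ?Q" E] Q assms(6) fds_subspace[OF assms(4)] by auto
  qed
  have mem: "q \<in> ?G" "p \<in> ?G" "F \<subseteq> ?G" using fs.span_superset[of "insert q F"] fs.span_superset[of "insert p ?Q"] by auto
  have "nondeg N ?G" unfolding nondeg_def
  proof (intro ballI impI)
    fix x assume x: "x \<in> ?G" "\<forall>y\<in>?G. N (x, y) = 0"
    then obtain a y where "x = a \<odot> p + y" "y \<in> ?Q" using in_span_insert_iff[OF fds_subspace[OF Q(1)]] by auto
    then obtain b f where eq: "x = a \<odot> p + (b \<odot> q + f)" "f \<in> F" using Qmem by blast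
    have "N (x, q) = 0" "N (x, p) = 0" using x(2) mem by auto
    then have "a = 0" "b = 0" using assms(1,10) xq[OF eq(2)] xp[OF eq(2)] qp unfolding eq(1)
      by (auto simp: alt_simps)
    then have "x = f" using eq by simp
    then show "x = 0" using nondegD[OF assms(3)] x(2) mem(3) eq(2) by auto
  qed
  then show thesis using that[of ?G] fds_insert[OF Q(1) p] Q(2) sub by auto
qed

text \<open>Projecting \<open>p\<close> and \<open>q\<close> to the orthogonal of \<open>F\<close>
  does not change \<open>L (p, q)\<close>, as \<open>F\<close> lies in the radical of
  \<open>L\<close>. If \<open>N\<close> vanishes on the projected pair, then \<open>N + L\<close>
  does not. No scalar has to be chosen, so this holds over every field.\<close>

lemma rank_two_update:
  assumes "alt N" "alt L" "fds F" "nondeg N F" "fds E" "F \<subseteq> E" "p \<in> E" "q \<in> E"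
    "\<And>x y. x \<in> F \<Longrightarrow> y \<in> E \<Longrightarrow> L (x, y) = 0" "L (p, q) \<noteq> 0"
  obtains G where "fds G" "G \<subseteq> E" "fs.dim G = fs.dim F + 2" "nondeg N G \<or> nondeg (N + L) G"
proof -
  obtain a where a: "a \<in> F" "\<And>x. x \<in> F \<Longrightarrow> N (p - a, x) = 0" using nondeg_project assms by metis
  obtain b where b: "b \<in> F" "\<And>x. x \<in> F \<Longrightarrow> N (q - b, x) = 0" using nondeg_project assms by metis
  have E: "p - a \<in> E" "q - b \<in> E" using a b assms by (auto simp: fds_closed)
  have L2: "L (y, x) = 0" if "x \<in> F" "y \<in> E" for x y
    using assms(9)[OF that] alt_swap[OF assms(2), of x y] by simp
  have Lpq: "L (p - a, q - b) = L (p, q)"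
    using L2[OF b(1) assms(7)] L2[OF b(1), of a] a(1) assms(6) assms(9)[OF a(1) assms(8)] assms(2)
    by (auto simp: alt_simps)
  show thesis
  proof (cases "N (p - a, q - b) = 0")
    case False
    then show thesis
      using nondeg_extend[OF assms(1,3,4,5,6) E a(2) b(2)] that by metis
  next
    case True
    have nd: "nondeg (N + L) F" by (rule nondeg_cong[OF assms(4)]) (use assms(6,9) in auto)
    have "(N + L) (p - a, x) = 0" "(N + L) (q - b, x) = 0" if "x \<in> F" for x
      using a(2)[OF that] b(2)[OF that] L2[OF that] E by auto
    moreover have "(N + L) (p - a, q - b) \<noteq> 0" using True Lpq assms(10) by simp
    ultimately show thesis
      using nondeg_extend[OF alt_plus[OF assms(1,2)] assms(3) nd assms(5,6) E] that by metis
  qed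
qed

section \<open>Dimensions of spaces of restricted forms\<close>

definition van :: "'x set \<Rightarrow> ('x \<Rightarrow> 'a::field) set" where
  "van X = {N. \<forall>p\<in>X. N p = 0}"

text \<open>The dimension of the space of restrictions to \<open>X\<close> of the elements of \<open>S\<close>.\<close>

definition delta :: "('x \<Rightarrow> 'a::field) set \<Rightarrow> 'x set \<Rightarrow> nat" where
  "delta S X = fs.dim S - fs.dim (S \<inter> van X)"

lemma in_van: "N \<in> van X \<longleftrightarrow> (\<forall>p\<in>X. N p = 0)"
  by (simp add: van_def)

lemma van_antimono: "X \<subseteq> Y \<Longrightarrow> van Y \<subseteq> van X"
  by (auto simp: van_def)

lemma subspace_van: "fs.subspace (van X)"
  by (auto simp: van_def fs.subspace_def smul_apply)

lemma fds_van: "fds S \<Longrightarrow> fds (S \<inter> van X)" "fds S \<Longrightarrow> fs.dim (S \<inter> van X) \<le> fs.dim S"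
  using fds_Int[OF _ subspace_van] fds_dim_mono[of S "S \<inter> van X"] by blast+

lemma delta_dim: "fds S \<Longrightarrow> delta S X + fs.dim (S \<inter> van X) = fs.dim S"
  using fds_van(2)[of S X] by (simp add: delta_def)

lemma dim_van_finite:
  assumes "fds S" "finite P"
  shows "fs.dim S \<le> fs.dim (S \<inter> van P) + card P"
  using fds_kernels(2)[OF assms, of "\<lambda>p N. N p"] by (simp add: lin_eval van_def)

text \<open>Each point of \<open>P\<close> is one linear condition on \<open>S\<close> and costs at
  most one dimension. The sets of points chosen in later proofs are therefore the actual counting
  arguments.\<close>

lemma delta_le:
  assumes "fds S" "finite P" "\<And>N. N \<in> S \<Longrightarrow> N \<in> van P \<Longrightarrow> N \<in> van Y \<Longrightarrow> N \<in> van X"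
  shows "delta S X \<le> delta S Y + card P"
proof -
  have "fs.dim (S \<inter> van Y) \<le> fs.dim (S \<inter> van Y \<inter> van P) + card P"
    using dim_van_finite[OF fds_van(1)[OF assms(1)] assms(2)] .
  also have "fs.dim (S \<inter> van Y \<inter> van P) \<le> fs.dim (S \<inter> van X)"
    by (rule fds_dim_mono) (use assms fds_van in blast)+
  finally show ?thesis using delta_dim[OF assms(1), of X] delta_dim[OF assms(1), of Y] by simp
qed

lemma delta_mono: "fds S \<Longrightarrow> (\<And>N. N \<in> S \<Longrightarrow> N \<in> van Y \<Longrightarrow> N \<in> van X) \<Longrightarrow> delta S X \<le> delta S Y"
  using delta_le[of S "{}" Y X] by simp

lemma delta_le_card:
  assumes "fds S" "finite P" "\<And>N. N \<in> S \<Longrightarrow> N \<in> van P \<Longrightarrow> N \<in> van X"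
  shows "delta S X \<le> card P"
proof -
  have "fs.dim S \<le> fs.dim (S \<inter> van P) + card P" by (rule dim_van_finite[OF assms(1,2)])
  also have "fs.dim (S \<inter> van P) \<le> fs.dim (S \<inter> van X)"
    by (rule fds_dim_mono) (use assms fds_van in blast)+
  finally show ?thesis using delta_dim[OF assms(1), of X] by simp
qed

text \<open>Used with \<open>D\<close> the forms of \<open>S\<close> that vanish at the points of
  \<open>P\<close>: prescribed values of a form are protected while it is perturbed by
  \<open>D\<close>, and the price is \<open>card P\<close>.\<close>

lemma delta_restrict:
  assumes "fds S" "finite P" "\<And>N. N \<in> S \<Longrightarrow> N \<in> van P \<Longrightarrow> N \<in> D" "D \<subseteq> S" "fds D"
  shows "delta S X \<le> delta D X + card P"
proof -
  have "fs.dim S \<le> fs.dim (S \<inter> van P) + card P" by (rule dim_van_finite[OF assms(1,2)])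
  also have "fs.dim (S \<inter> van P) \<le> fs.dim D"
    by (rule fds_dim_mono) (use assms fds_van in blast)+
  finally have "fs.dim S \<le> fs.dim D + card P" by simp
  moreover have "fs.dim (D \<inter> van X) \<le> fs.dim (S \<inter> van X)"
    by (rule fds_dim_mono) (use assms fds_van in blast)+
  ultimately show ?thesis using delta_dim[OF assms(1), of X] delta_dim[OF assms(5), of X] by simp
qed

lemma delta_split:
  assumes "fds S" "Y \<subseteq> X"
  shows "delta S X = delta S Y + delta (S \<inter> van Y) X"
proof -
  have "S \<inter> van Y \<inter> van X = S \<inter> van X" using van_antimono[OF assms(2)] by auto
  then show ?thesis
    using delta_dim[OF assms(1), of X] delta_dim[OF assms(1), of Y] delta_dim[OF fds_van(1)[OF assms(1), of Y], of X]
    by simp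
qed

lemma delta_pos:
  assumes "fds S" "0 < delta S X"
  obtains N where "N \<in> S" "N \<notin> van X"
proof -
  have "S \<inter> van X \<noteq> S" using assms delta_dim[OF assms(1), of X] by auto
  then show thesis using that by blast
qed

section \<open>Hyperplanes, rank two forms and forms of maximal rank\<close>

lemma dual_pair_exists:
  fixes K :: "('i \<Rightarrow> 'a::field) set"
  assumes "fds K" "2 \<le> fs.dim K"
  obtains u v k1 k2 where "lin u" "lin v" "k1 \<in> K" "k2 \<in> K" "u k1 = 1" "u k2 = 0" "v k1 = 0" "v k2 = 1"
proof -
  obtain B where B: "finite B" "\<not> fs.dependent B" "fs.span B = K" "card B = fs.dim K"
    using fds_basis[OF assms(1)] by metis
  obtain A where "A \<subseteq> B" "card A = 2" using obtain_subset_with_card_n[of 2 B] B assms by auto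
  then obtain k1 k2 where k: "k1 \<in> B" "k2 \<in> B" "k1 \<noteq> k2" by (auto simp: card_2_iff)
  obtain u :: "('i \<Rightarrow> 'a) \<Rightarrow> 'a" where u: "lin u" "\<And>b. b \<in> B \<Longrightarrow> u b = (if b = k1 then 1 else 0)"
    using lin_extend[OF B(2), of "\<lambda>b. if b = k1 then 1 else 0"] by metis
  obtain v :: "('i \<Rightarrow> 'a) \<Rightarrow> 'a" where v: "lin v" "\<And>b. b \<in> B \<Longrightarrow> v b = (if b = k2 then 1 else 0)"
    using lin_extend[OF B(2), of "\<lambda>b. if b = k2 then 1 else 0"] by metis
  have "k1 \<in> K" "k2 \<in> K" using k B(3) fs.span_base by auto
  then show thesis using that[OF u(1) v(1)] u(2)[OF k(1)] u(2)[OF k(2)] v(2)[OF k(1)] v(2)[OF k(2)] k(3) by simp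
qed

text \<open>A hyperplane of \<open>E\<close> only if \<open>u\<close> is nonzero on
  \<open>E\<close>, which is why a vector \<open>e\<close> of \<open>E\<close> with
  \<open>u e = 1\<close> usually accompanies it.\<close>

definition hyp :: "('i \<Rightarrow> 'a::field) set \<Rightarrow> (('i \<Rightarrow> 'a) \<Rightarrow> 'a) \<Rightarrow> ('i \<Rightarrow> 'a) set" where
  "hyp E u = E \<inter> {x. u x = 0}"

lemma hyp_subset: "hyp E u \<subseteq> E"
  by (auto simp: hyp_def)

lemma fds_hyp: "fds E \<Longrightarrow> lin u \<Longrightarrow> fds (hyp E u)"
  by (simp add: hyp_def fds_kernel(1))

lemma dim_hyp: "fds E \<Longrightarrow> lin u \<Longrightarrow> x \<in> E \<Longrightarrow> u x \<noteq> 0 \<Longrightarrow> fs.dim E = fs.dim (hyp E u) + 1"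
  by (simp add: hyp_def fds_kernel(3))

lemma hyp_decompose:
  assumes "fds E" "lin u" "e \<in> E" "u e = 1" "x \<in> E"
  shows "x - u x \<odot> e \<in> hyp E u"
  using assms by (simp add: hyp_def fds_closed lin_simps)

text \<open>The dimension of the space of rank two forms \<open>u \<and> f\<close> among the restrictions to \<open>E\<close> of the elements of \<open>S\<close>.\<close>

definition wd :: "(('i \<Rightarrow> 'a::field) \<times> ('i \<Rightarrow> 'a) \<Rightarrow> 'a) set \<Rightarrow> ('i \<Rightarrow> 'a) set \<Rightarrow> (('i \<Rightarrow> 'a) \<Rightarrow> 'a) \<Rightarrow> nat" where
  "wd S E u = delta (S \<inter> van (hyp E u \<times> hyp E u)) (E \<times> E)"

lemma wd_delta: "fds S \<Longrightarrow> delta S (E \<times> E) = delta S (hyp E u \<times> hyp E u) + wd S E u"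
  unfolding wd_def by (rule delta_split) (use hyp_subset in blast)+

lemma wd_dim:
  assumes "fds S"
  shows "wd S E u + fs.dim (S \<inter> van (E \<times> E)) = fs.dim (S \<inter> van (hyp E u \<times> hyp E u))"
proof -
  have "S \<inter> van (hyp E u \<times> hyp E u) \<inter> van (E \<times> E) = S \<inter> van (E \<times> E)"
    using van_antimono[of "hyp E u \<times> hyp E u" "E \<times> E"] hyp_subset by blast
  then show ?thesis unfolding wd_def using delta_dim[OF fds_van(1)[OF assms]] by metis
qed

text \<open>Decompose both arguments along \<open>hyp E u\<close> and \<open>e\<close>. On
  \<open>E\<close> the form is \<open>u \<and> L (e, \<cdot>)\<close>, so a single functional
  determines it.\<close>

lemma van_hyp_eq:
  assumes "alt L" "lin u" "fds E" "e \<in> E" "u e = 1" "L \<in> van (hyp E u \<times> hyp E u)" "x \<in> E" "y \<in> E"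
  shows "L (x, y) = u x * L (e, y) - u y * L (e, x)"
proof -
  let ?p = "x - u x \<odot> e" let ?q = "y - u y \<odot> e"
  have "L (?p, ?q) = 0" using hyp_decompose[OF assms(3,2,4,5)] assms(6-8) by (auto simp: in_van)
  then show ?thesis using assms(1) alt_swap[OF assms(1), of x e] by (simp add: alt_simps algebra_simps)
qed

text \<open>\<open>M\<close> has maximal rank \<open>r\<close> on \<open>E\<close> among the elements of the affine space \<open>M + D\<close>.\<close>

locale max_form =
  fixes D :: "(('i \<Rightarrow> 'a::field) \<times> ('i \<Rightarrow> 'a) \<Rightarrow> 'a) set" and M E r
  assumes fD: "fds D" and aD: "\<And>N. N \<in> D \<Longrightarrow> alt N" and aM: "alt M" and fE: "fds E"
    and ex: "\<exists>F. fds F \<and> F \<subseteq> E \<and> fs.dim F = r \<and> nondeg M F"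
    and mx: "\<And>L F. L \<in> D \<Longrightarrow> fds F \<Longrightarrow> F \<subseteq> E \<Longrightarrow> fs.dim F = r + 2 \<Longrightarrow> \<not> nondeg (M + L) F"
begin

definition K where "K = {x \<in> E. \<forall>y\<in>E. M (y, x) = 0}"

lemma fK: "fds K" and KE: "K \<subseteq> E"
  unfolding K_def using fds_perp(1)[OF aM fE] by auto

lemma K0: "x \<in> K \<Longrightarrow> y \<in> E \<Longrightarrow> M (y, x) = 0" "x \<in> K \<Longrightarrow> y \<in> E \<Longrightarrow> M (x, y) = 0"
  using alt_zero_swap[OF aM] by (auto simp: K_def)

text \<open>Maximality for the zero element of \<open>D\<close> forbids a hyperbolic pair in the
  orthogonal of \<open>F\<close>, so this orthogonal is the radical \<open>K\<close> of
  \<open>M\<close> on \<open>E\<close>.\<close>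

lemma complement:
  assumes F: "fds F" "F \<subseteq> E" "fs.dim F = r" "nondeg M F" and x: "x \<in> E"
  obtains a where "a \<in> F" "x - a \<in> K"
proof -
  obtain a where a: "a \<in> F" "\<And>y. y \<in> F \<Longrightarrow> M (x - a, y) = 0" using nondeg_project[OF aM F(1,4)] by metis
  have xa: "x - a \<in> E" using a(1) F(2) x fds_diff[OF fE] by auto
  have "M (x - a, y) = 0" if y: "y \<in> E" for y
  proof (rule ccontr)
    assume n: "M (x - a, y) \<noteq> 0"
    obtain b where b: "b \<in> F" "\<And>z. z \<in> F \<Longrightarrow> M (y - b, z) = 0" using nondeg_project[OF aM F(1,4)] by metis
    have yb: "y - b \<in> E" using b(1) F(2) y fds_diff[OF fE] by auto
    have "M (x - a, y - b) = M (x - a, y) - M (x - a, b)" by (rule lin_diff[OF alt_lin2[OF aM]])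
    then have "M (x - a, y - b) \<noteq> 0" using n a(2)[OF b(1)] by simp
    then obtain G where "fds G" "G \<subseteq> E" "fs.dim G = r + 2" "nondeg M G"
      using nondeg_extend[OF aM F(1,4) fE F(2) xa yb a(2) b(2)] F(3) by metis
    then show False using mx[of 0 G] fds_0[OF fD] by simp
  qed
  then have "x - a \<in> K" using xa alt_zero_swap[OF aM] by (auto simp: K_def)
  then show thesis using that a by blast
qed

lemma F_Int_K: "fds F \<Longrightarrow> F \<subseteq> E \<Longrightarrow> nondeg M F \<Longrightarrow> F \<inter> K = {0}"
  using nondegD[of M F] K0(2) fds_0[OF fK] fds_0[of F] by blast

lemma dim_K: "fs.dim K + r = fs.dim E"
proof -
  obtain F where F: "fds F" "F \<subseteq> E" "fs.dim F = r" "nondeg M F" using ex by blast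
  have "ssum F K = E"
  proof
    show "ssum F K \<subseteq> E" by (rule ssum_subset[OF fE F(2) KE])
    show "E \<subseteq> ssum F K"
    proof
      fix x assume "x \<in> E"
      then obtain a where "a \<in> F" "x - a \<in> K" by (rule complement[OF F])
      then show "x \<in> ssum F K" using ssumI[of a F "x - a" K] by simp
    qed
  qed
  then show ?thesis using fds_ssum(3)[OF F(1) fK F_Int_K[OF F(1,2,4)]] F(3) by simp
qed

text \<open>The vectors \<open>a\<close> for which the rank two form
  \<open>u \<and> M (a, \<cdot>)\<close> is the restriction of an element of \<open>D\<close>. It
  measures the forms counted by \<open>wd D E u\<close> inside \<open>E\<close>, where they can be
  compared through \<open>M\<close>; the radical \<open>K\<close> is contained in it for trivial
  reasons.\<close>

definition A where
  "A u = {a \<in> E. \<exists>L\<in>D. \<forall>x\<in>E. \<forall>y\<in>E. L (x, y) = u x * M (a, y) - u y * M (a, x)}"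

lemma A_closed: "a \<in> A u \<Longrightarrow> b \<in> A u \<Longrightarrow> a + b \<in> A u" "a \<in> A u \<Longrightarrow> c \<odot> a \<in> A u" "0 \<in> A u"
proof -
  assume "a \<in> A u" "b \<in> A u"
  then obtain L L' where L: "L \<in> D" "\<forall>x\<in>E. \<forall>y\<in>E. L (x, y) = u x * M (a, y) - u y * M (a, x)"
    "L' \<in> D" "\<forall>x\<in>E. \<forall>y\<in>E. L' (x, y) = u x * M (b, y) - u y * M (b, x)" "a \<in> E" "b \<in> E" by (auto simp: A_def)
  have "(L + L') (x, y) = u x * M (a + b, y) - u y * M (a + b, x)" if "x \<in> E" "y \<in> E" for x y
    using that L(2,4) aM by (simp add: alt_simps) (simp add: algebra_simps)
  moreover have "L + L' \<in> D" "a + b \<in> E" using L fds_add[OF fD] fds_add[OF fE] by auto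
  ultimately show "a + b \<in> A u" unfolding A_def by blast
next
  assume "a \<in> A u"
  then obtain L where L: "L \<in> D" "\<forall>x\<in>E. \<forall>y\<in>E. L (x, y) = u x * M (a, y) - u y * M (a, x)" "a \<in> E"
    by (auto simp: A_def)
  have "(c \<odot> L) (x, y) = u x * M (c \<odot> a, y) - u y * M (c \<odot> a, x)" if "x \<in> E" "y \<in> E" for x y
    using that L(2) aM by (simp add: alt_simps smul_apply) (simp add: algebra_simps)
  moreover have "c \<odot> L \<in> D" "c \<odot> a \<in> E" using L fds_smul[OF fD] fds_smul[OF fE] by auto
  ultimately show "c \<odot> a \<in> A u" unfolding A_def by blast
next
  have "\<forall>x\<in>E. \<forall>y\<in>E. (0 :: _ \<Rightarrow> 'a) (x, y) = u x * M (0, y) - u y * M (0, x)" using aM by (simp add: alt_simps)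
  then show "0 \<in> A u" using fds_0[OF fD] fds_0[OF fE] unfolding A_def by blast
qed

lemma A_E: "A u \<subseteq> E"
  by (auto simp: A_def)

lemma fA: "fds (A u)"
  by (rule fds_subset(1)[OF fE _ A_E]) (auto simp: fs.subspace_def A_closed)

lemma K_A: "K \<subseteq> A u"
proof
  fix k assume k: "k \<in> K"
  then have "\<forall>x\<in>E. \<forall>y\<in>E. (0 :: _ \<Rightarrow> 'a) (x, y) = u x * M (k, y) - u y * M (k, x)" using K0(2) by simp
  then show "k \<in> A u" using fds_0[OF fD] k KE unfolding A_def by blast
qed

lemma A_combination:
  assumes "a \<in> A u" "a \<in> A v" shows "a \<in> A (\<lambda>x. u x - v x)"
proof -
  obtain L L' where L: "L \<in> D" "\<forall>x\<in>E. \<forall>y\<in>E. L (x, y) = u x * M (a, y) - u y * M (a, x)"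
    "L' \<in> D" "\<forall>x\<in>E. \<forall>y\<in>E. L' (x, y) = v x * M (a, y) - v y * M (a, x)" "a \<in> E" using assms by (auto simp: A_def)
  have "(L - L') (x, y) = (u x - v x) * M (a, y) - (u y - v y) * M (a, x)" if "x \<in> E" "y \<in> E" for x y
    using that L(2,4) by simp (simp add: algebra_simps)
  moreover have "L - L' \<in> D" using L fds_diff[OF fD] by auto
  ultimately show ?thesis using L(5) unfolding A_def by blast
qed

text \<open>\<open>K\<close> is the kernel of \<open>a \<mapsto> M (a, \<cdot>)\<close>, so only a
  complement of \<open>K\<close> in \<open>A u\<close> imposes conditions.\<close>

lemma A_perp_dim:
  "fds {x \<in> E. \<forall>a\<in>A u. M (a, x) = 0}"
  "fs.dim {x \<in> E. \<forall>a\<in>A u. M (a, x) = 0} + fs.dim (A u) = fs.dim E + fs.dim K"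
proof -
  show "fds {x \<in> E. \<forall>a\<in>A u. M (a, x) = 0}" by (rule fds_perp(1)[OF aM fE])
  obtain C where C: "fds C" "C \<subseteq> A u" "fs.dim K + fs.dim C = fs.dim (A u)" "K \<inter> C = {0}"
    "\<forall>v\<in>A u. \<exists>w\<in>K. \<exists>c\<in>C. v = w + c" by (rule fds_complement[OF fA fds_subspace[OF fK] K_A])
  have CE: "C \<subseteq> E" using C(2) A_E by blast
  have "fs.dim {x \<in> E. \<forall>a\<in>C. M (a, x) = 0} + fs.dim C = fs.dim E"
  proof (rule perp_dim[OF aM fE C(1)])
    fix a assume a: "a \<in> C" "\<And>x. x \<in> E \<Longrightarrow> M (a, x) = 0"
    then have "a \<in> K" using CE alt_zero_swap[OF aM] by (auto simp: K_def)
    then show "a = 0" using a(1) C(4) by blast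
  qed
  moreover have "{x \<in> E. \<forall>a\<in>C. M (a, x) = 0} = {x \<in> E. \<forall>a\<in>A u. M (a, x) = 0}"
  proof -
    have "M (a, x) = 0" if x: "x \<in> E" "\<forall>a\<in>C. M (a, x) = 0" and a: "a \<in> A u" for a x
    proof -
      obtain w c where "w \<in> K" "c \<in> C" "a = w + c" using C(5) a by blast
      then show ?thesis using K0(2)[of w x] x aM by (simp add: alt_simps)
    qed
    then show ?thesis using C(2) by blast
  qed
  ultimately show "fs.dim {x \<in> E. \<forall>a\<in>A u. M (a, x) = 0} + fs.dim (A u) = fs.dim E + fs.dim K" using C(3) by simp
qed

definition dual_pair where
  "dual_pair u v k1 k2 \<longleftrightarrow> lin u \<and> lin v \<and> k1 \<in> K \<and> k2 \<in> K \<and> u k1 = 1 \<and> u k2 = 0 \<and> v k1 = 0 \<and> v k2 = 1"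

text \<open>The map \<open>T\<close> moves vectors along the radical until \<open>u\<close> and
  \<open>v\<close> vanish. As \<open>K\<close> is orthogonal to everything, \<open>M\<close> does
  not notice the change, so the image of \<open>F\<close> is still nondegenerate.\<close>

lemma adapted_complement:
  assumes "dual_pair u v k1 k2"
  obtains G where "fds G" "G \<subseteq> E" "fs.dim G = r" "nondeg M G" "\<forall>x\<in>G. u x = 0 \<and> v x = 0"
proof -
  have d: "lin u" "lin v" "k1 \<in> K" "k2 \<in> K" "u k1 = 1" "u k2 = 0" "v k1 = 0" "v k2 = 1"
    using assms by (auto simp: dual_pair_def)
  obtain F where F: "fds F" "F \<subseteq> E" "fs.dim F = r" "nondeg M F" using ex by blast
  define T where "T x = x - (u x \<odot> k1 + v x \<odot> k2)" for x
  have kE: "u x \<odot> k1 + v x \<odot> k2 \<in> K" for x using d fK by (simp add: fds_closed)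
  have T: "T (x + y) = T x + T y" "T (c \<odot> x) = c \<odot> T x" for x y c
    using d(1,2) by (auto simp: T_def lin_simps fun_eq_iff smul_apply algebra_simps)
  have ker: "F \<inter> {x. T x = 0} = {0}"
  proof -
    have "x = 0" if "x \<in> F" "T x = 0" for x
      using that kE[of x] F_Int_K[OF F(1,2,4)] by (auto simp: T_def)
    then show ?thesis using fds_0[OF F(1)] d(1,2) by (auto simp: T_def lin_simps)
  qed
  have MT: "M (T x, T y) = M (x, y)" if "x \<in> E" "y \<in> E" for x y
  proof -
    have "T y \<in> E" using that kE KE fE by (auto simp: T_def intro!: fds_diff)
    then have "M (T x, T y) = M (x, T y)"
      using K0(2)[OF kE] aM unfolding T_def[of x] by (simp add: lin_diff[OF alt_lin1])
    also have "\<dots> = M (x, y)"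
      using K0(1)[OF kE] that aM unfolding T_def[of y] by (simp add: lin_diff[OF alt_lin2])
    finally show ?thesis .
  qed
  show thesis
  proof (rule that[of "T ` F"])
    show "fds (T ` F)" using fds_rank_nullity(1)[OF F(1)] T by blast
    show "T ` F \<subseteq> E" using F(2) kE KE fE by (auto simp: T_def intro!: fds_diff)
    show "fs.dim (T ` F) = r" using fds_rank_nullity(2)[OF F(1), of T] T ker F(3)
      fds_dim_0[of "{0}"] fds_kernel(1) fds_Int[OF F(1)] fds_span[of "{}"] by simp
    show "nondeg M (T ` F)" unfolding nondeg_def
    proof (intro ballI impI)
      fix z assume z: "z \<in> T ` F" "\<forall>y\<in>T ` F. M (z, y) = 0"
      then obtain x where x: "x \<in> F" "z = T x" by blast
      have "x = 0"
      proof (rule nondegD[OF F(4) x(1)])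
        fix y assume y: "y \<in> F"
        then have "M (T x, T y) = 0" using z(2) x(2) by blast
        then show "M (x, y) = 0" using MT[of x y] x(1) y F(2) by auto
      qed
      then show "z = 0" using x d(1,2) by (simp add: T_def lin_simps)
    qed
    show "\<forall>x\<in>T ` F. u x = 0 \<and> v x = 0" using d by (auto simp: T_def lin_simps)
  qed
qed

text \<open>Add both \<open>u \<and> M (a, \<cdot>)\<close> and
  \<open>v \<and> M (b, \<cdot>)\<close> to \<open>M\<close>. On \<open>G\<close> nothing changes,
  while the radical vectors \<open>k1\<close>, \<open>k2\<close>, corrected by the
  \<open>G\<close>-components of \<open>a\<close>, \<open>b\<close>, become a pair orthogonal to
  \<open>G\<close> with value \<open>- M (a, b)\<close>. A nonzero value would raise the rank to
  \<open>r + 2\<close>.\<close>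

lemma A_orthogonal:
  assumes dp: "dual_pair u v k1 k2" and "a \<in> A u" "b \<in> A v"
  shows "M (a, b) = 0"
proof (rule ccontr)
  assume n: "M (a, b) \<noteq> 0"
  have d: "lin u" "lin v" "k1 \<in> K" "k2 \<in> K" "u k1 = 1" "u k2 = 0" "v k1 = 0" "v k2 = 1"
    using dp by (auto simp: dual_pair_def)
  obtain G where G: "fds G" "G \<subseteq> E" "fs.dim G = r" "nondeg M G" "\<forall>x\<in>G. u x = 0 \<and> v x = 0"
    by (rule adapted_complement[OF dp])
  obtain L L' where L: "L \<in> D" "\<forall>x\<in>E. \<forall>y\<in>E. L (x, y) = u x * M (a, y) - u y * M (a, x)"
    "L' \<in> D" "\<forall>x\<in>E. \<forall>y\<in>E. L' (x, y) = v x * M (b, y) - v y * M (b, x)" "a \<in> E" "b \<in> E"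
    using assms by (auto simp: A_def)
  obtain a' where a': "a' \<in> G" "a - a' \<in> K" by (rule complement[OF G(1-4) L(5)])
  obtain b' where b': "b' \<in> G" "b - b' \<in> K" by (rule complement[OF G(1-4) L(6)])
  have aa: "M (a, x) = M (a', x)" "M (b, x) = M (b', x)" if "x \<in> E" for x
    using K0(2)[OF a'(2) that] K0(2)[OF b'(2) that] aM by (simp_all add: alt_simps)
  have abE: "a' \<in> E" "b' \<in> E" "k1 \<in> E" "k2 \<in> E" using a' b' G(2) d KE by auto
  have ab: "M (a', b') = M (a, b)"
    using K0(1)[OF b'(2) L(5)] aa(1)[OF abE(2)] aM by (simp add: alt_simps)
  let ?N = "M + (L + L')" let ?p = "k1 - a'" let ?q = "k2 - b'"
  have pq: "?p \<in> E" "?q \<in> E" using abE fE by (auto intro: fds_diff)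
  have N: "?N (x, y) = M (x, y) + (u x * M (a', y) - u y * M (a', x)) + (v x * M (b', y) - v y * M (b', x))"
    if "x \<in> E" "y \<in> E" for x y using L(2,4) aa that by simp
  have uv: "u ?p = 1" "v ?p = 0" "u ?q = 0" "v ?q = 1" using d G(5) a' b' by (auto simp: lin_simps)
  have aN: "alt ?N" using aM aD L fds_add[OF fD] by (simp add: alt_plus)
  have nd: "nondeg ?N G"
  proof (rule nondeg_cong[OF G(4)])
    fix x y assume "x \<in> G" "y \<in> G"
    then show "M (x, y) = ?N (x, y)" using N[of x y] G(2,5) by auto
  qed
  have Np: "?N (?p, x) = 0" if "x \<in> G" for x
  proof -
    have "x \<in> E" "u x = 0" "v x = 0" using that G by auto
    then show ?thesis using N[OF pq(1), of x] uv K0(2)[OF d(3), of x] aM by (simp add: alt_simps)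
  qed
  have Nq: "?N (?q, x) = 0" if "x \<in> G" for x
  proof -
    have "x \<in> E" "u x = 0" "v x = 0" using that G by auto
    then show ?thesis using N[OF pq(2), of x] uv K0(2)[OF d(4), of x] aM by (simp add: alt_simps)
  qed
  have "?N (?p, ?q) = - M (a', b')"
    using N[OF pq] uv K0[OF d(3)] K0[OF d(4)] abE aM alt_swap[OF aM, of b' a'] by (simp add: alt_simps)
  then have "?N (?p, ?q) \<noteq> 0" using n ab by simp
  then obtain G' where "fds G'" "G' \<subseteq> E" "fs.dim G' = r + 2" "nondeg ?N G'"
    using nondeg_extend[OF aN G(1) nd fE G(2) pq Np Nq] G(3) by metis
  then show False using mx[of "L + L'" G'] fds_add[OF fD] L by simp
qed

text \<open>Every form of \<open>D\<close> of type \<open>u \<and> f\<close> has \<open>f\<close>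
  equal to some \<open>M (a, \<cdot>)\<close> modulo \<open>u\<close>, by maximality. Evaluation at
  \<open>k1\<close> thus sends the forms counted by \<open>wd\<close> injectively into the
  functionals \<open>M (a, \<cdot>)\<close> with \<open>a\<close> in \<open>A u\<close>, where
  \<open>K\<close> contributes nothing.\<close>

lemma wd_le_dim_A:
  assumes dp: "dual_pair u v k1 k2"
  shows "wd D E u + fs.dim K \<le> fs.dim (A u)"
proof -
  have d: "lin u" "lin v" "k1 \<in> K" "k2 \<in> K" "u k1 = 1" "u k2 = 0" "v k1 = 0" "v k2 = 1"
    using dp by (auto simp: dual_pair_def)
  have k1E: "k1 \<in> E" using d KE by auto
  obtain G where G: "fds G" "G \<subseteq> E" "fs.dim G = r" "nondeg M G" "\<forall>x\<in>G. u x = 0 \<and> v x = 0"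
    by (rule adapted_complement[OF dp])
  let ?H = "hyp E u"
  let ?DH = "D \<inter> van (?H \<times> ?H)"
  have fDH: "fds ?DH" by (rule fds_van(1)[OF fD])
  have rep: "\<exists>a\<in>A u. \<forall>x\<in>E. L (k1, x) = M (a, x)" if L: "L \<in> ?DH" for L
  proof -
    have LD: "L \<in> D" "alt L" "L \<in> van (?H \<times> ?H)" using L aD by auto
    have form: "L (x, y) = u x * L (k1, y) - u y * L (k1, x)" if "x \<in> E" "y \<in> E" for x y
      by (rule van_hyp_eq[OF LD(2) d(1) fE k1E d(5) LD(3) that])
    obtain a where a: "a \<in> G" "\<And>x. x \<in> G \<Longrightarrow> M (a, x) = L (k1, x)"
      using nondeg_represent[OF aM G(1,4) alt_lin2[OF LD(2)]] by metis
    have aE: "a \<in> E" using a G by auto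
    have GH: "G \<subseteq> ?H" using G by (auto simp: hyp_def)
    have LG: "L (x, y) = 0" if "x \<in> ?H" "y \<in> ?H" for x y using that LD(3) by (auto simp: in_van)
    \<comment> \<open>Otherwise \<open>k1 - a\<close> and \<open>k\<close> would be a hyperbolic
      pair for \<open>M + L\<close> in the orthogonal of \<open>G\<close>.\<close>
    have zero: "L (k1, k) = 0" if k: "k \<in> K" "u k = 0" for k
    proof (rule ccontr)
      assume n: "L (k1, k) \<noteq> 0"
      have kH: "k \<in> ?H" "k \<in> E" using k KE by (auto simp: hyp_def)
      let ?p = "k1 - a"
      have pE: "?p \<in> E" using k1E aE fE by (auto intro: fds_diff)
      have aN: "alt (M + L)" using aM LD by (simp add: alt_plus)
      have nd: "nondeg (M + L) G" by (rule nondeg_cong[OF G(4)]) (use LG GH in auto)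
      have Np: "(M + L) (?p, x) = 0" if "x \<in> G" for x
      proof -
        have x: "x \<in> E" "x \<in> ?H" "a \<in> ?H" using that a(1) GH G(2) by auto
        show ?thesis
          using a(2)[OF that] K0(2)[OF d(3) x(1)] LG[OF x(3,2)] aM LD(2) by (simp add: lin_diff[OF alt_lin1])
      qed
      have Nk: "(M + L) (k, x) = 0" if "x \<in> G" for x
      proof -
        have "x \<in> E" "x \<in> ?H" using that GH G(2) by auto
        then show ?thesis using K0(2)[OF k(1)] LG[OF kH(1)] by simp
      qed
      have "(M + L) (?p, k) = L (k1, k)"
        using K0(1)[OF k(1) pE] LG[of a k] kH a(1) GH LD(2) by (auto simp: lin_diff[OF alt_lin1])
      then obtain G' where "fds G'" "G' \<subseteq> E" "fs.dim G' = r + 2" "nondeg (M + L) G'"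
        using nondeg_extend[OF aN G(1) nd fE G(2) pE kH(2) Np Nk] G(3) n by metis
      then show False using mx[of L G'] LD by simp
    qed
    have rep: "L (k1, y) = M (a, y)" if y: "y \<in> E" for y
    proof -
      obtain b where b: "b \<in> G" "y - b \<in> K" by (rule complement[OF G(1-4) y])
      let ?k = "y - b - u y \<odot> k1"
      have "?k \<in> K" using b d fK by (auto simp: fds_closed)
      moreover have "u ?k = 0" using d(1,5) b(1) G(5) by (simp add: lin_simps)
      ultimately have "L (k1, ?k) = 0" using zero by blast
      then have "L (k1, y) = L (k1, b)" using LD(2) by (simp add: alt_simps)
      also have "\<dots> = M (a, b)" using a(2)[OF b(1)] by simp
      also have "\<dots> = M (a, y)" using K0(1)[OF b(2) aE] aM by (simp add: alt_simps)
      finally show ?thesis .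
    qed
    have "a \<in> A u" unfolding A_def using LD(1) aE form rep by auto
    then show ?thesis using rep by blast
  qed
  \<comment> \<open>Values outside \<open>E\<close> are set to 0, so that functionals agreeing on
    \<open>E\<close> become equal functions and the two images can be compared.\<close>
  define T :: "(('i \<Rightarrow> 'a) \<times> ('i \<Rightarrow> 'a) \<Rightarrow> 'a) \<Rightarrow> ('i \<Rightarrow> 'a) \<Rightarrow> 'a" where "T L = (\<lambda>x. if x \<in> E then L (k1, x) else 0)" for L
  define T' :: "('i \<Rightarrow> 'a) \<Rightarrow> ('i \<Rightarrow> 'a) \<Rightarrow> 'a" where "T' a = (\<lambda>x. if x \<in> E then M (a, x) else 0)" for a
  have T: "T (x + y) = T x + T y" "T (c \<odot> x) = c \<odot> T x" for x y c
    by (auto simp: T_def fun_eq_iff smul_apply)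
  have T': "T' (x + y) = T' x + T' y" "T' (c \<odot> x) = c \<odot> T' x" for x y c
    using aM by (auto simp: T'_def fun_eq_iff smul_apply alt_simps)
  have rT: "fds (T ` ?DH)" "fs.dim ?DH = fs.dim (?DH \<inter> {x. T x = 0}) + fs.dim (T ` ?DH)"
    using fds_rank_nullity[OF fDH, of T] T by auto
  have rT': "fds (T' ` A u)" "fs.dim (A u) = fs.dim (A u \<inter> {x. T' x = 0}) + fs.dim (T' ` A u)"
    using fds_rank_nullity[OF fA, of T'] T' by auto
  have sub: "T ` ?DH \<subseteq> T' ` A u"
  proof
    fix z assume "z \<in> T ` ?DH"
    then obtain L where L: "L \<in> ?DH" "z = T L" by blast
    obtain a where "a \<in> A u" "\<forall>x\<in>E. L (k1, x) = M (a, x)" using rep[OF L(1)] by blast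
    then show "z \<in> T' ` A u" unfolding L(2) by (intro image_eqI[of _ _ a]) (auto simp: T_def T'_def)
  qed
  have e1: "fs.dim (T ` ?DH) \<le> fs.dim (T' ` A u)" by (rule fds_dim_mono[OF rT'(1) rT(1) sub])
  have "fs.subspace (?DH \<inter> {x. T x = 0})"
    using fds_closed(1-3)[OF fDH] T by (auto simp: fs.subspace_def) (auto simp: T_def fun_eq_iff)
  then have f1: "fds (?DH \<inter> {x. T x = 0})" using fds_subset(1)[OF fDH] by blast
  have e2: "fs.dim (?DH \<inter> {x. T x = 0}) \<le> fs.dim (D \<inter> van (E \<times> E))"
  proof (rule fds_dim_mono[OF fds_van(1)[OF fD] f1])
    show "?DH \<inter> {x. T x = 0} \<subseteq> D \<inter> van (E \<times> E)"
    proof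
      fix L assume L: "L \<in> ?DH \<inter> {x. T x = 0}"
      have z: "L (k1, x) = 0" if "x \<in> E" for x using L that unfolding T_def fun_eq_iff by (auto split: if_splits)
      have "L (x, y) = 0" if "x \<in> E" "y \<in> E" for x y
        using van_hyp_eq[OF aD d(1) fE k1E d(5) _ that, of L] L z that by simp
      then show "L \<in> D \<inter> van (E \<times> E)" using L by (auto simp: in_van)
    qed
  qed
  have "fs.subspace (A u \<inter> {x. T' x = 0})"
    using fds_closed(1-3)[OF fA] T' aM by (auto simp: fs.subspace_def) (auto simp: T'_def fun_eq_iff alt_simps)
  then have f2: "fds (A u \<inter> {x. T' x = 0})" using fds_subset(1)[OF fA] by blast
  have e3: "fs.dim K \<le> fs.dim (A u \<inter> {x. T' x = 0})"
  proof (rule fds_dim_mono[OF f2 fK])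
    show "K \<subseteq> A u \<inter> {x. T' x = 0}"
      using K_A K0(2) by (auto simp: T'_def fun_eq_iff)
  qed
  show ?thesis using e1 e2 e3 rT rT' wd_dim[OF fD, of E u] by simp
qed

text \<open>\<open>A v\<close> lies in the orthogonal of \<open>A u\<close>, so their dimensions add
  up to at most \<open>dim E + dim K\<close>. Removing \<open>dim K\<close> from each leaves
  \<open>dim E - dim K = r\<close>.\<close>

lemma wd_add_le:
  assumes "dual_pair u v k1 k2"
  shows "wd D E u + wd D E v \<le> r"
proof -
  have dp': "dual_pair v u k2 k1" using assms by (auto simp: dual_pair_def)
  have "A v \<subseteq> {x \<in> E. \<forall>a\<in>A u. M (a, x) = 0}" using A_orthogonal[OF assms] A_E by auto
  then have "fs.dim (A v) \<le> fs.dim {x \<in> E. \<forall>a\<in>A u. M (a, x) = 0}" by (rule fds_dim_mono[OF A_perp_dim(1) fA])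
  then show ?thesis using A_perp_dim(2)[of u] wd_le_dim_A[OF assms] wd_le_dim_A[OF dp'] dim_K by linarith
qed

lemma small_functional:
  assumes "r + 2 \<le> fs.dim E"
  obtains u x where "lin u" "x \<in> E" "u x = 1" "2 * wd D E u \<le> r"
proof -
  have "2 \<le> fs.dim K" using assms dim_K by simp
  then obtain u v k1 k2 where "dual_pair u v k1 k2"
    using dual_pair_exists[OF fK] unfolding dual_pair_def by metis
  moreover from this have "wd D E u + wd D E v \<le> r" by (rule wd_add_le)
  moreover have "k1 \<in> E" "k2 \<in> E" using calculation(1) KE by (auto simp: dual_pair_def)
  ultimately show thesis using that[of u k1] that[of v k2] by (cases "2 * wd D E u \<le> r") (auto simp: dual_pair_def)
qed

end

section \<open>Upper bounds for restrictions, and nondegenerate forms in affine spaces\<close>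

lemma delta_prod:
  assumes "fds S" "\<And>N. N \<in> S \<Longrightarrow> alt N" "fds A" "fds B"
  shows "delta S (A \<times> B) \<le> fs.dim A * fs.dim B"
proof -
  obtain X where X: "finite X" "\<not> fs.dependent X" "fs.span X = A" "card X = fs.dim A"
    using fds_basis[OF assms(3)] by metis
  obtain Y where Y: "finite Y" "\<not> fs.dependent Y" "fs.span Y = B" "card Y = fs.dim B"
    using fds_basis[OF assms(4)] by metis
  have "delta S (A \<times> B) \<le> card (X \<times> Y)"
  proof (rule delta_le_card[OF assms(1)])
    fix N assume N: "N \<in> S" "N \<in> van (X \<times> Y)"
    have "N (x, y) = 0" if "x \<in> A" "y \<in> B" for x y
    proof (rule alt_zero_span1[OF assms(2)[OF N(1)], of X])
      show "N (b, y) = 0" if "b \<in> X" for b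
        by (rule alt_zero_span2[OF assms(2)[OF N(1)], of Y]) (use N(2) that \<open>y \<in> B\<close> Y in \<open>auto simp: in_van\<close>)
    qed (use X that in auto)
    then show "N \<in> van (A \<times> B)" by (auto simp: in_van)
  qed (use X Y in auto)
  then show ?thesis using X Y by (simp add: card_cartesian_product)
qed

lemma delta_square:
  assumes "fds S" "\<And>N. N \<in> S \<Longrightarrow> alt N" "fds H"
  shows "delta S (H \<times> H) \<le> fs.dim H choose 2"
proof -
  obtain B where B: "finite B" "\<not> fs.dependent B" "fs.span B = H" "card B = fs.dim H"
    using fds_basis[OF assms(3)] by metis
  let ?Q = "{X. X \<subseteq> B \<and> card X = 2}"
  \<comment> \<open>An ordering of each two-element subset; one of the two orders is enough for an
    alternating form.\<close>
  define g where "g X = (SOME p. X = {fst p, snd p})" for X :: "('a \<Rightarrow> 'b) set"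
  have g: "X = {fst (g X), snd (g X)}" if X: "X \<in> ?Q" for X
  proof -
    obtain a b where "X = {a, b}" using X by (auto simp: card_2_iff)
    then have "X = {fst (a, b), snd (a, b)}" by simp
    then show ?thesis unfolding g_def by (rule someI)
  qed
  have fQ: "finite ?Q" using B(1) by simp
  have "delta S (H \<times> H) \<le> card (g ` ?Q)"
  proof (rule delta_le_card[OF assms(1)])
    show "finite (g ` ?Q)" using fQ by simp
    fix N assume N: "N \<in> S" "N \<in> van (g ` ?Q)"
    have aN: "alt N" by (rule assms(2)[OF N(1)])
    have BB: "N (a, b) = 0" if "a \<in> B" "b \<in> B" for a b
    proof (cases "a = b")
      case False
      then have Q: "{a, b} \<in> ?Q" using that by auto
      then have "N (g {a, b}) = 0" using N(2) by (auto simp: in_van)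
      moreover have "{a, b} = {fst (g {a, b}), snd (g {a, b})}" using g[OF Q] .
      then have "g {a, b} = (a, b) \<or> g {a, b} = (b, a)" by (auto simp: doubleton_eq_iff prod_eq_iff)
      ultimately show ?thesis using alt_zero_swap[OF aN, of a b] by metis
    qed (use aN alt_self in auto)
    have "N (x, y) = 0" if "x \<in> H" "y \<in> H" for x y
    proof (rule alt_zero_span1[OF aN, of B])
      show "N (b, y) = 0" if "b \<in> B" for b
        by (rule alt_zero_span2[OF aN, of B]) (use BB that \<open>y \<in> H\<close> B in auto)
    qed (use B that in auto)
    then show "N \<in> van (H \<times> H)" by (auto simp: in_van)
  qed
  also have "\<dots> \<le> card ?Q" by (rule card_image_le[OF fQ])
  also have "\<dots> = fs.dim H choose 2" using n_subsets[OF B(1), of 2] B(4) by simp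
  finally show ?thesis .
qed

lemma hyperplane_insert:
  assumes "fds G" "G \<subseteq> H" "fds H" "fs.dim H = fs.dim G + 1"
  obtains x where "x \<in> H" "x \<notin> G" "H = fs.span (insert x G)"
proof -
  have "G \<noteq> H" using assms(4) by auto
  then obtain x where x: "x \<in> H" "x \<notin> G" using assms(2) by auto
  have "fs.span (insert x G) \<subseteq> H" using fs.span_minimal[of "insert x G" H] x assms(2) fds_subspace[OF assms(3)] by auto
  then have "fs.span (insert x G) = H"
    using fds_eq[OF assms(3)] fds_insert[OF assms(1) x(2)] fds_subspace assms(4) by simp
  then show thesis using that x by auto
qed

text \<open>One added vector \<open>x\<close> costs only the values \<open>N (x, \<cdot>)\<close> on
  a basis of \<open>G\<close>, because \<open>N (x, x) = 0\<close>.\<close>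

lemma delta_hyperplane:
  assumes "fds S" "\<And>N. N \<in> S \<Longrightarrow> alt N" "fds G" "G \<subseteq> H" "fds H" "fs.dim H = fs.dim G + 1"
  shows "delta S (H \<times> H) \<le> delta S (G \<times> G) + fs.dim G"
proof -
  obtain x where x: "x \<in> H" "x \<notin> G" "H = fs.span (insert x G)" using hyperplane_insert[OF assms(3-6)] .
  obtain B where B: "finite B" "\<not> fs.dependent B" "fs.span B = G" "card B = fs.dim G"
    using fds_basis[OF assms(3)] by metis
  have "delta S (H \<times> H) \<le> delta S (G \<times> G) + card (Pair x ` B)"
  proof (rule delta_le[OF assms(1)])
    show "finite (Pair x ` B)" using B by simp
    fix N assume N: "N \<in> S" "N \<in> van (Pair x ` B)" "N \<in> van (G \<times> G)"
    have aN: "alt N" by (rule assms(2)[OF N(1)])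
    have xG: "N (x, y) = 0" if "y \<in> G" for y
      by (rule alt_zero_span2[OF aN, of B]) (use N(2) that B in \<open>auto simp: in_van\<close>)
    have "N (a, b) = 0" if ab: "a \<in> H" "b \<in> H" for a b
    proof -
      obtain c v where c: "a = c \<odot> x + v" "v \<in> G"
        using ab(1) unfolding x(3) in_span_insert_iff[OF fds_subspace[OF assms(3)]] by blast
      obtain c' v' where c': "b = c' \<odot> x + v'" "v' \<in> G"
        using ab(2) unfolding x(3) in_span_insert_iff[OF fds_subspace[OF assms(3)]] by blast
      have "N (v, v') = 0" "N (x, v') = 0" "N (v, x) = 0"
        using N(3) xG c(2) c'(2) alt_zero_swap[OF aN, of v x] by (auto simp: in_van)
      then show ?thesis unfolding c(1) c'(1) using aN by (simp add: alt_simps)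
    qed
    then show "N \<in> van (H \<times> H)" by (auto simp: in_van)
  qed
  moreover have "card (Pair x ` B) \<le> fs.dim G" using card_image_le[OF B(1)] B(4) by metis
  ultimately show ?thesis by simp
qed

text \<open>Since \<open>L\<close> is \<open>u \<and> L (e, \<cdot>)\<close>, its radical in
  \<open>E\<close> is the common kernel of \<open>u\<close> and
  \<open>L (e, \<cdot>)\<close>.\<close>

lemma rank_two_radical:
  assumes "alt L" "fds E" "lin u" "e \<in> E" "u e = 1" "L \<in> van (hyp E u \<times> hyp E u)" "L \<notin> van (E \<times> E)"
  obtains G p q where "fds G" "G \<subseteq> hyp E u" "fs.dim (hyp E u) = fs.dim G + 1"
    "\<And>x y. x \<in> G \<Longrightarrow> y \<in> E \<Longrightarrow> L (x, y) = 0" "p \<in> E" "q \<in> E" "L (p, q) \<noteq> 0"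
proof -
  let ?H = "hyp E u"
  let ?f = "\<lambda>y. L (e, y)"
  have H: "fds ?H" by (rule fds_hyp[OF assms(2,3)])
  have form: "L (x, y) = u x * L (e, y) - u y * L (e, x)" if "x \<in> E" "y \<in> E" for x y
    by (rule van_hyp_eq[OF assms(1,3,2,4,5,6) that])
  have lf: "lin ?f" by (rule alt_lin2[OF assms(1)])
  have "\<exists>h\<in>?H. ?f h \<noteq> 0"
  proof (rule ccontr)
    assume n: "\<not> ?thesis"
    have "L (e, x) = 0" if "x \<in> E" for x
    proof -
      have "?f (x - u x \<odot> e) = 0" using n hyp_decompose[OF assms(2,3,4,5) that] by blast
      then show ?thesis using assms(1) by (simp add: alt_simps)
    qed
    then have "L \<in> van (E \<times> E)" using form by (auto simp: in_van)
    then show False using assms(7) by simp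
  qed
  then obtain h where h: "h \<in> ?H" "?f h \<noteq> 0" by blast
  let ?G = "hyp ?H ?f"
  show thesis
  proof (rule that[of ?G e h])
    show "fds ?G" by (rule fds_hyp[OF H lf])
    show "?G \<subseteq> ?H" by (rule hyp_subset)
    show "fs.dim ?H = fs.dim ?G + 1" by (rule dim_hyp[OF H lf h])
    show "L (x, y) = 0" if "x \<in> ?G" "y \<in> E" for x y
      using form[of x y] that by (auto simp: hyp_def)
    show "h \<in> E" using h hyp_subset by blast
  qed (use assms h in auto)
qed

text \<open>The search runs over even dimensions, starting with the zero space and bounded by
  \<open>dim E\<close>. This matches the locale, where maximality excludes dimension
  \<open>r + 2\<close>.\<close>

lemma max_form_exists:
  assumes "fds D" "\<And>N. N \<in> D \<Longrightarrow> alt N" "alt N0" "fds E"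
  obtains L m where "L \<in> D" "2 * m \<le> fs.dim E" "max_form D (N0 + L) E (2 * m)"
proof -
  let ?P = "\<lambda>m. \<exists>L\<in>D. \<exists>F. fds F \<and> F \<subseteq> E \<and> fs.dim F = 2 * m \<and> nondeg (N0 + L) F"
  have "fs.dim {0 :: 'a \<Rightarrow> 'b} = 0" using fds_dim_0[of "{0}"] fds_span[of "{}"] by simp
  then have P0: "?P 0" using fds_0[OF assms(1)] fds_0[OF assms(4)] fds_span[of "{}"]
    by (intro bexI[of _ 0] exI[of _ "{0}"]) (auto simp: nondeg_def)
  have bound: "2 * m \<le> fs.dim E" if Pm: "?P m" for m
  proof -
    obtain F where "fds F" "F \<subseteq> E" "fs.dim F = 2 * m" using Pm by blast
    then show ?thesis using fds_dim_mono[OF assms(4), of F] by simp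
  qed
  obtain m where m: "?P m" "\<And>k. ?P k \<Longrightarrow> k \<le> m"
  proof -
    have "\<forall>k. ?P k \<longrightarrow> k \<le> fs.dim E" using bound by force
    then have "\<exists>m. ?P m \<and> (\<forall>k. ?P k \<longrightarrow> k \<le> m)"
      using Nat.ex_has_greatest_nat[of ?P 0 "fs.dim E"] P0 by blast
    then show thesis using that by blast
  qed
  then obtain L F where L: "L \<in> D" "fds F" "F \<subseteq> E" "fs.dim F = 2 * m" "nondeg (N0 + L) F" by blast
  have "max_form D (N0 + L) E (2 * m)"
  proof
    show "alt (N0 + L)" using assms L by (simp add: alt_plus)
    show "\<exists>F. fds F \<and> F \<subseteq> E \<and> fs.dim F = 2 * m \<and> nondeg (N0 + L) F" using L by blast
    fix L' G assume L': "L' \<in> D" "fds G" "G \<subseteq> E" "fs.dim G = 2 * m + 2"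
    show "\<not> nondeg (N0 + L + L') G"
    proof
      assume "nondeg (N0 + L + L') G"
      then have "?P (m + 1)" using L' L(1) fds_add[OF assms(1)] by (intro bexI[of _ "L + L'"] exI[of _ G]) (auto simp: add.assoc)
      then show False using m(2) by fastforce
    qed
  qed (use assms in auto)
  then show thesis using that L(1) bound[OF m(1)] by blast
qed

lemma choose_two_Suc: "Suc n choose 2 = (n choose 2) + n"
  by (simp add: numeral_2_eq_2)

text \<open>An affine space of alternating forms on a space of even dimension \<open>2k\<close> contains a nondegenerate
  form as soon as its codimension is at most \<open>2k - 2\<close>: a form of maximal rank yields a hyperplane
  whose rank two forms are few, and one passes to the radical of one of them.\<close>

lemma affine_nondeg:
  assumes "fds D" "\<And>N. N \<in> D \<Longrightarrow> alt N" "alt N0" "fds E" "fs.dim E = 2 * k"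
    "1 \<le> k \<Longrightarrow> (2 * k choose 2) \<le> delta D (E \<times> E) + 2 * k - 2"
  shows "\<exists>L\<in>D. nondeg (N0 + L) E"
  using assms(4-6)
proof (induction k arbitrary: E)
  case 0
  then have "E = {0}" using fds_dim_0 by auto
  then show ?case using fds_0[OF assms(1)] by (intro bexI[of _ 0]) (auto simp: nondeg_def)
next
  case (Suc k)
  obtain L m where L: "L \<in> D" "2 * m \<le> fs.dim E" "max_form D (N0 + L) E (2 * m)"
    by (rule max_form_exists[OF assms(1-3) Suc.prems(1)])
  interpret max_form D "N0 + L" E "2 * m" by (rule L(3))
  show ?case
  proof (cases "m = Suc k")
    case True
    obtain F where F: "fds F" "F \<subseteq> E" "fs.dim F = 2 * m" "nondeg (N0 + L) F" using ex by blast
    then have "F = E" using fds_eq[OF fE fds_subspace[OF F(1)] F(2)] True Suc.prems(2) by simp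
    then show ?thesis using F L(1) by blast
  next
    case False
    then have mk: "m \<le> k" using L(2) Suc.prems(2) by simp
    then have "2 * m + 2 \<le> fs.dim E" using Suc.prems(2) by simp
    then obtain u e where u: "lin u" "e \<in> E" "u e = 1" "2 * wd D E u \<le> 2 * m" by (rule small_functional)
    let ?H = "hyp E u"
    have H: "fds ?H" by (rule fds_hyp[OF fE u(1)])
    have dH: "fs.dim ?H = 2 * k + 1" using dim_hyp[OF fE u(1,2)] u(3) Suc.prems(2) by simp
    have dE: "delta D (E \<times> E) = delta D (?H \<times> ?H) + wd D E u" by (rule wd_delta[OF fD])
    have c1: "(2 * Suc k choose 2) = (2 * k + 1 choose 2) + (2 * k + 1)" using choose_two_Suc[of "2 * k + 1"] by simp
    have c2: "(2 * k + 1 choose 2) = (2 * k choose 2) + 2 * k" using choose_two_Suc[of "2 * k"] by simp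
    have big: "(2 * k + 1 choose 2) + 1 \<le> delta D (E \<times> E)" using Suc.prems(3) c1 by simp
    have "delta D (?H \<times> ?H) \<le> (2 * k + 1 choose 2)" using delta_square[OF fD aD H] dH by simp
    \<comment> \<open>The restrictions to \<open>H\<close> cannot account for all of
      \<open>delta D (E \<times> E)\<close>, so some form of \<open>D\<close> vanishes on
      \<open>H\<close> but not on \<open>E\<close>.\<close>
    then have "0 < delta (D \<inter> van (?H \<times> ?H)) (E \<times> E)" using dE big unfolding wd_def by simp
    then obtain N where N: "N \<in> D \<inter> van (?H \<times> ?H)" "N \<notin> van (E \<times> E)" using delta_pos[OF fds_van(1)[OF fD]] by blast
    have aN: "alt N" using N aD by simp
    obtain G p q where G: "fds G" "G \<subseteq> ?H" "fs.dim ?H = fs.dim G + 1"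
      "\<And>x y. x \<in> G \<Longrightarrow> y \<in> E \<Longrightarrow> N (x, y) = 0" "p \<in> E" "q \<in> E" "N (p, q) \<noteq> 0"
      using rank_two_radical[OF aN fE u(1,2,3) _ N(2)] N(1) by blast
    have GE: "G \<subseteq> E" using G(2) hyp_subset by blast
    have dG: "fs.dim G = 2 * k" using G(3) dH by simp
    have dHG: "delta D (?H \<times> ?H) \<le> delta D (G \<times> G) + 2 * k"
      using delta_hyperplane[OF fD aD G(1,2) H G(3)] dG by simp
    have "\<exists>L\<in>D. nondeg (N0 + L) G"
    proof (rule Suc.IH[OF G(1) dG])
      \<comment> \<open>From \<open>E\<close> to \<open>G\<close> at most \<open>2 * k + wd\<close>
        dimensions are lost, with \<open>wd <= m <= k\<close>, while the binomial coefficient drops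
        by \<open>4 * k + 1\<close> and the permitted codimension by 2. This balances for
        \<open>k >= 1\<close>.\<close>
      assume "1 \<le> k"
      then show "(2 * k choose 2) \<le> delta D (G \<times> G) + 2 * k - 2"
        using dHG dE u(4) mk Suc.prems(3) c1 c2 by simp
    qed
    then obtain L' where L': "L' \<in> D" "nondeg (N0 + L') G" by blast
    have "alt (N0 + L')" using L' aD assms(3) by (simp add: alt_plus)
    then obtain F where F: "fds F" "F \<subseteq> E" "fs.dim F = fs.dim G + 2" "nondeg (N0 + L') F \<or> nondeg (N0 + L' + N) F"
      using rank_two_update[OF _ aN G(1) L'(2) fE GE G(5,6,4,7)] by metis
    have "F = E" using fds_eq[OF fE fds_subspace[OF F(1)] F(2)] F(3) dG Suc.prems(2) by simp
    moreover have "L' + N \<in> D" using L' N fds_add[OF fD] by blast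
    ultimately show ?thesis using F(4) L'(1) unfolding add.assoc by blast
  qed
qed

section \<open>The case where no functional is small\<close>

context max_form
begin

text \<open>If no functional is small, then all the spaces \<open>A u\<close> coincide with one self-orthogonal subspace.
  All forms of \<open>D\<close> vanish on it: the rank drops by two each time one passes to the kernel of one of
  the functionals \<open>M (a, \<cdot>)\<close>.\<close>

lemma all_functionals_large:
  assumes r: "r = 2 * s" and dE: "r + 2 \<le> fs.dim E"
    and large: "\<And>u e. lin u \<Longrightarrow> e \<in> E \<Longrightarrow> u e = 1 \<Longrightarrow> s \<le> wd D E u"
    and rank: "\<And>N F. N \<in> D \<Longrightarrow> fds F \<Longrightarrow> F \<subseteq> E \<Longrightarrow> fs.dim F = r + 2 \<Longrightarrow> \<not> nondeg N F"
  obtains F where "fds F" "F \<subseteq> E" "fs.dim F + s = fs.dim E" "\<And>N x y. N \<in> D \<Longrightarrow> x \<in> F \<Longrightarrow> y \<in> F \<Longrightarrow> N (x, y) = 0"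
proof -
  have dimA: "s + fs.dim K \<le> fs.dim (A u)" if "dual_pair u v k1 k2" for u v k1 k2
    using wd_le_dim_A[OF that] large[of u k1] that KE by (fastforce simp: dual_pair_def)
  \<comment> \<open>With both \<open>wd\<close> at least \<open>s\<close>, the count behind
    \<open>wd_add_le\<close> has no slack, so orthogonality becomes equality.\<close>
  have perp: "A v = {x \<in> E. \<forall>a\<in>A u. M (a, x) = 0}" if dp: "dual_pair u v k1 k2" for u v k1 k2
  proof (rule fds_eq[OF A_perp_dim(1) fds_subspace[OF fA]])
    show "A v \<subseteq> {x \<in> E. \<forall>a\<in>A u. M (a, x) = 0}" using A_orthogonal[OF dp] A_E by auto
    have dp': "dual_pair v u k2 k1" using dp by (auto simp: dual_pair_def)
    show "fs.dim {x \<in> E. \<forall>a\<in>A u. M (a, x) = 0} \<le> fs.dim (A v)"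
      using A_perp_dim(2)[of u] dimA[OF dp] dimA[OF dp'] dim_K r by linarith
  qed
  \<comment> \<open>\<open>u + v\<close> forms a dual pair with \<open>u\<close> and with
    \<open>v\<close>, so \<open>A u\<close> and \<open>A v\<close> are both the orthogonal of
    \<open>A (u + v)\<close>.\<close>
  have same: "A u = A v" if dp: "dual_pair u v k1 k2" for u v k1 k2
  proof -
    have "dual_pair (\<lambda>x. u x + v x) v k1 (k2 - k1)" "dual_pair (\<lambda>x. u x + v x) u k2 (k1 - k2)"
      using dp fK by (auto simp: dual_pair_def lin_plus lin_simps fds_closed)
    then show ?thesis using perp by blast
  qed
  have "2 \<le> fs.dim K" using dE dim_K by simp
  then obtain u v k1 k2 where dp: "dual_pair u v k1 k2"
    using dual_pair_exists[OF fK] unfolding dual_pair_def by metis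
  have d: "lin u" "lin v" "k1 \<in> K" "k2 \<in> K" "u k1 = 1" "u k2 = 0" "v k1 = 0" "v k2 = 1"
    using dp by (auto simp: dual_pair_def)
  let ?A = "A u"
  have self: "?A = {x \<in> E. \<forall>a\<in>?A. M (a, x) = 0}" using perp[OF dp] same[OF dp] by simp
  have dimAu: "fs.dim ?A + s = fs.dim E"
    using A_perp_dim(2)[of u] dimA[OF dp] dim_K r self by simp
  have pair: "A w = A z" if w: "lin w" "lin z" "k \<in> K" "w k = 0" "z k \<noteq> 0" "l \<in> K" "w l \<noteq> 0" for w z k l
  proof -
    let ?k = "(1 / z k) \<odot> k" let ?l = "(1 / w l) \<odot> (l - z l \<odot> ?k)"
    have "dual_pair w z ?l ?k" using w fK by (auto simp: dual_pair_def lin_simps fds_closed)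
    then show ?thesis by (rule same)
  qed
  \<comment> \<open>A functional that is nonzero on \<open>K\<close> is independent, on
    \<open>K\<close>, of \<open>u\<close> or of \<open>v\<close>; \<open>pair\<close> then links it
    to one of them.\<close>
  have onK: "A w = ?A" if w: "lin w" "l \<in> K" "w l \<noteq> 0" for w l
  proof (cases "\<exists>k\<in>K. w k = 0 \<and> u k \<noteq> 0")
    case True
    then obtain k where "k \<in> K" "w k = 0" "u k \<noteq> 0" by blast
    then show ?thesis using pair[OF w(1) d(1) _ _ _ w(2,3)] by blast
  next
    case False
    show ?thesis
    proof (cases "\<exists>k\<in>K. w k = 0 \<and> v k \<noteq> 0")
      case True
      then obtain k where "k \<in> K" "w k = 0" "v k \<noteq> 0" by blast
      then show ?thesis using pair[OF w(1) d(2) _ _ _ w(2,3)] same[OF dp] by blast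
    next
      case n: False
      let ?k = "w k2 \<odot> k1 - w k1 \<odot> k2"
      have "?k \<in> K" "w ?k = 0" "u ?k = w k2" "v ?k = - w k1" using d w fK by (auto simp: fds_closed lin_simps)
      then have "w k1 = 0" using n by fastforce
      then show ?thesis using False d by auto
    qed
  qed
  \<comment> \<open>If \<open>w\<close> vanishes on \<open>K\<close>, then \<open>w + u\<close> does
    not, and \<open>A_combination\<close> subtracts \<open>u\<close> again.\<close>
  have all: "a \<in> A w" if a: "a \<in> ?A" and w: "lin w" for a w
  proof (cases "\<exists>l\<in>K. w l \<noteq> 0")
    case True then show ?thesis using onK[OF w] a by blast
  next
    case False
    then have "A (\<lambda>x. w x + u x) = ?A" using onK[of "\<lambda>x. w x + u x" k1] d lin_plus[OF w d(1)] by auto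
    then have "a \<in> A (\<lambda>x. w x + u x - u x)" using A_combination[of a "\<lambda>x. w x + u x" u] a by blast
    then show ?thesis by simp
  qed
  obtain C where C: "fds C" "C \<subseteq> ?A" "fs.dim K + fs.dim C = fs.dim ?A" "K \<inter> C = {0}"
    "\<forall>v\<in>?A. \<exists>w\<in>K. \<exists>c\<in>C. v = w + c" by (rule fds_complement[OF fA fds_subspace[OF fK] K_A])
  have dC: "fs.dim C = s" using C(3) dimAu dim_K r by simp
  obtain B where B: "finite B" "\<not> fs.dependent B" "fs.span B = C" "card B = fs.dim C"
    using fds_basis[OF C(1)] by metis
  let ?E = "\<lambda>P. {x \<in> E. \<forall>a\<in>P. M (a, x) = 0}"
  have fEP: "fds (?E P)" for P by (rule fds_perp(1)[OF aM fE])
  have BA: "B \<subseteq> ?A" "B \<subseteq> C" using B(3) C(2) fs.span_superset by auto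
  have dEP: "fs.dim (?E P) + card P = fs.dim E" if P: "P \<subseteq> B" for P
  proof -
    have iP: "\<not> fs.dependent P" using B(2) P fs.dependent_mono by blast
    have PC: "fs.span P \<subseteq> C" using fs.span_mono[OF P] B(3) by simp
    have "fs.dim {x \<in> E. \<forall>a\<in>fs.span P. M (a, x) = 0} + fs.dim (fs.span P) = fs.dim E"
    proof (rule perp_dim[OF aM fE fds_span])
      show "finite P" using P B(1) finite_subset by blast
      fix a assume a: "a \<in> fs.span P" "\<And>x. x \<in> E \<Longrightarrow> M (a, x) = 0"
      then have "a \<in> E" using PC C(2) A_E by blast
      then have "a \<in> K" using a(2) alt_zero_swap[OF aM, of _ a] by (auto simp: K_def)
      then show "a = 0" using a(1) PC C(4) by blast
    qed
    moreover have "{x \<in> E. \<forall>a\<in>fs.span P. M (a, x) = 0} = ?E P"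
      using alt_zero_span1[OF aM, of P] fs.span_base[of _ P] by blast
    ultimately show ?thesis using fs.dim_span_eq_card_independent[OF iP] by simp
  qed
  have drop: "\<not> nondeg N F" if "P \<subseteq> B" "N \<in> D" "fds F" "F \<subseteq> ?E P" "fs.dim F + 2 * card P = r + 2" for P N F
    using finite_subset[OF that(1) B(1)] that
  proof (induction P arbitrary: N F rule: finite_induct)
    case empty then show ?case using rank by auto
  next
    case (insert f P)
    show ?case
    proof
      assume nd: "nondeg N F"
      have PB: "P \<subseteq> B" "f \<in> B" "insert f P \<subseteq> B" using insert.prems by auto
      have sub: "?E (insert f P) \<subseteq> ?E P" by auto
      have dd: "fs.dim (?E P) = fs.dim (?E (insert f P)) + 1"
        using dEP[OF PB(1)] dEP[OF PB(3)] insert.hyps by simp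
      then have "?E (insert f P) \<noteq> ?E P" by auto
      then obtain p where p: "p \<in> ?E P" "M (f, p) \<noteq> 0" using sub by auto
      have dF: "fs.dim F < fs.dim (?E (insert f P))"
        using insert.prems(5) dEP[OF PB(3)] dE insert.hyps by simp
      then have "\<not> ?E (insert f P) \<subseteq> F" using fds_dim_mono[OF insert.prems(3) fEP, of "insert f P"] by linarith
      then obtain q where q: "q \<in> ?E (insert f P)" "q \<notin> F" by blast
      \<comment> \<open>Since \<open>f\<close> lies in \<open>A w\<close>, the form
        \<open>w \<and> M (f, \<cdot>)\<close> is in \<open>D\<close>. Inside \<open>?E P\<close> it
        has \<open>F\<close> in its radical and is nonzero on \<open>(q, p)\<close>, so
        \<open>rank_two_update\<close> gains two dimensions there when the condition
        \<open>f\<close> is dropped.\<close>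
      obtain w where w: "lin w" "w q = 1" "\<And>x. x \<in> F \<Longrightarrow> w x = 0"
        using lin_separate[OF fds_subspace[OF insert.prems(3)] q(2)] by metis
      have "f \<in> A w" using all[OF _ w(1)] PB(2) BA(1) by blast
      then obtain L where L: "L \<in> D" "\<forall>x\<in>E. \<forall>y\<in>E. L (x, y) = w x * M (f, y) - w y * M (f, x)" by (auto simp: A_def)
      have FP: "F \<subseteq> ?E P" using insert.prems(4) by auto
      have LF: "L (x, y) = 0" if "x \<in> F" "y \<in> ?E P" for x y
      proof -
        have "x \<in> E" "y \<in> E" "M (f, x) = 0" using that insert.prems(4) by auto
        then show ?thesis using L(2) w(3)[OF that(1)] by simp
      qed
      have qP: "q \<in> ?E P" using q by auto
      have Lqp: "L (q, p) \<noteq> 0" using L(2) w(2) p q by auto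
      obtain G where G: "fds G" "G \<subseteq> ?E P" "fs.dim G = fs.dim F + 2" "nondeg N G \<or> nondeg (N + L) G"
        by (rule rank_two_update[OF aD[OF insert.prems(2)] aD[OF L(1)] insert.prems(3) nd fEP FP qP p(1) LF Lqp])
      have "fs.dim G + 2 * card P = r + 2" using G(3) insert.prems(5) insert.hyps by simp
      then show False using insert.IH[OF PB(1) _ G(1,2)] G(4) insert.prems(2) L(1) fds_add[OF fD] by blast
    qed
  qed
  \<comment> \<open>A nonzero value would give a nondegenerate plane in \<open>?E B\<close>, and
    \<open>2 + 2 * card B = r + 2\<close> contradicts \<open>drop\<close>.\<close>
  have vanish: "N (x, y) = 0" if N: "N \<in> D" and xy: "x \<in> ?A" "y \<in> ?A" for N x y
  proof (rule ccontr)
    assume n: "N (x, y) \<noteq> 0"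
    have AE: "?A \<subseteq> ?E B" using self BA by auto
    have z: "fds {0 :: 'i \<Rightarrow> 'a}" "fs.dim {0 :: 'i \<Rightarrow> 'a} = 0" using fds_span[of "{}"] fds_dim_0[of "{0}"] by auto
    have "nondeg N {0}" by (auto simp: nondeg_def)
    then obtain G where "fds G" "G \<subseteq> ?A" "fs.dim G = 2" "nondeg N G"
    proof (rule nondeg_extend[OF aD[OF N] z(1) _ fA _ xy _ _ n])
      show "{0} \<subseteq> ?A" using fds_0[OF fA] by simp
      show "N (x, z) = 0" "N (y, z) = 0" if "z \<in> {0}" for z using that aD[OF N] by (simp_all add: alt_simps)
    qed (use z(2) in auto)
    then show False using drop[of B N G] N AE dC B(4) r by auto
  qed
  show thesis by (rule that[of ?A]) (use fA A_E dimAu vanish in auto)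
qed

end

section \<open>Rectangular blocks and the lifting of isotropic subspaces\<close>

lemma lin_zero_off_subspace:
  assumes "lin f" "fs.subspace T" "fds V" "z \<in> V" "z \<notin> T" "\<And>x. x \<in> V \<Longrightarrow> x \<notin> T \<Longrightarrow> f x = 0" "x \<in> V"
  shows "f x = 0"
proof (cases "x \<in> T")
  case True
  then have "x + z \<notin> T" using fs.subspace_diff[OF assms(2), of "x + z" x] assms(5) by auto
  then have "f (x + z) = 0" using assms by (simp add: fds_add)
  moreover have "f z = 0" using assms by simp
  ultimately show ?thesis using lin_add[OF assms(1)] by simp
qed (use assms in auto)

text \<open>The block of \<open>N\<close> on \<open>C \<times> F\<close> has full row rank:
  \<open>C\<close> embeds into the dual of \<open>F\<close>.\<close>

definition left_nondeg :: "(('i \<Rightarrow> 'a::field) \<times> ('i \<Rightarrow> 'a) \<Rightarrow> 'a) \<Rightarrow> ('i \<Rightarrow> 'a) set \<Rightarrow> ('i \<Rightarrow> 'a) set \<Rightarrow> bool" where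
  "left_nondeg N C F \<longleftrightarrow> (\<forall>c\<in>C. (\<forall>f\<in>F. N (c, f) = 0) \<longrightarrow> c = 0)"

lemma left_nondegD: "left_nondeg N C F \<Longrightarrow> c \<in> C \<Longrightarrow> (\<And>f. f \<in> F \<Longrightarrow> N (c, f) = 0) \<Longrightarrow> c = 0"
  by (auto simp: left_nondeg_def)

lemma left_nondeg_insert:
  assumes "alt N" "fs.subspace C" "left_nondeg N C F" "f \<in> F" "N (c1, f) \<noteq> 0" "\<And>c. c \<in> C \<Longrightarrow> N (c, f) = 0"
  shows "left_nondeg N (fs.span (insert c1 C)) F"
  unfolding left_nondeg_def
proof (intro ballI impI)
  fix x assume x: "x \<in> fs.span (insert c1 C)" "\<forall>f\<in>F. N (x, f) = 0"
  obtain a c where ac: "x = a \<odot> c1 + c" "c \<in> C" using x(1) in_span_insert_iff[OF assms(2)] by blast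
  have "N (x, f) = 0" using x(2) assms(4) by simp
  then have "a = 0" unfolding ac(1) using assms(1,5) assms(6)[OF ac(2)] by (simp add: alt_simps)
  then have "x = c" using ac by simp
  then show "x = 0" using left_nondegD[OF assms(3), of x] ac x by auto
qed

text \<open>The rectangular companion of \<open>affine_nondeg\<close>: an affine space of blocks
  whose codimension is at most \<open>dim F - 1\<close> contains one of full row rank. The induction
  removes one row \<open>c1\<close> and works with \<open>?V\<close>, the forms that vanish on all
  other rows.\<close>

lemma affine_left_nondeg:
  assumes "fds D" "\<And>N. N \<in> D \<Longrightarrow> alt N" "alt N0" "fds C" "fds F" "fs.dim C = s" "s \<le> fs.dim F"
    "1 \<le> s \<Longrightarrow> s * fs.dim F \<le> delta D (C \<times> F) + fs.dim F - 1"
  shows "\<exists>L\<in>D. left_nondeg (N0 + L) C F"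
  using assms(4-8)
proof (induction s arbitrary: C F)
  case 0
  then have "C = {0}" using fds_dim_0 by auto
  then show ?case using fds_0[OF assms(1)] by (intro bexI[of _ 0]) (auto simp: left_nondeg_def)
next
  case (Suc s)
  let ?k = "fs.dim F"
  have fC: "fds C" and fF: "fds F" and dC: "fs.dim C = Suc s" and sk: "Suc s \<le> ?k"
    and big: "Suc s * ?k \<le> delta D (C \<times> F) + ?k - 1" using Suc.prems by auto
  obtain C2 where C2: "fds C2" "C2 \<subseteq> C" "fs.dim C2 = s"
    using fds_subspace_of_dim[OF fC, of s] dC by auto
  obtain c1 where c1: "c1 \<in> C" "c1 \<notin> C2" "C = fs.span (insert c1 C2)"
    using hyperplane_insert[OF C2(1,2) fC] C2(3) dC by auto
  let ?V = "D \<inter> van (C2 \<times> F)"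
  have fV: "fds ?V" by (rule fds_van(1)[OF assms(1)])
  have aV: "alt N" if "N \<in> ?V" for N using that assms(2) by auto
  have split: "delta D (C \<times> F) = delta D (C2 \<times> F) + delta ?V (C \<times> F)"
    by (rule delta_split[OF assms(1)]) (use C2(2) in blast)
  have dC2: "delta D (C2 \<times> F) \<le> s * ?k" using delta_prod[OF assms(1,2) C2(1) fF] C2(3) by simp
  have Vzero: "N \<in> van (C \<times> F)" if N: "N \<in> ?V" and z: "\<And>f. f \<in> F \<Longrightarrow> N (c1, f) = 0" for N
  proof -
    have "N (x, f) = 0" if "x \<in> C" "f \<in> F" for x f
      by (rule alt_zero_span1[OF aV[OF N], of "insert c1 C2"]) (use N z that c1(3) in \<open>auto simp: in_van\<close>)
    then show ?thesis by (auto simp: in_van)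
  qed
  show ?case
  \<comment> \<open>If \<open>?V\<close> fills the whole row \<open>c1\<close>, only this row is
    removed. Otherwise the row has room to spare, and a column is removed with it.\<close>
  proof (cases "?k \<le> delta ?V (C \<times> F)")
    case True
    obtain B where B: "finite B" "\<not> fs.dependent B" "fs.span B = F" "card B = ?k"
      using fds_basis[OF fF] by metis
    have "delta ?V (C \<times> F) \<le> card (Pair c1 ` B)"
    proof (rule delta_le_card[OF fV])
      fix N assume N: "N \<in> ?V" "N \<in> van (Pair c1 ` B)"
      show "N \<in> van (C \<times> F)"
        by (rule Vzero[OF N(1)], rule alt_zero_span2[OF aV[OF N(1)], of B]) (use N(2) B in \<open>auto simp: in_van\<close>)
    qed (use B in auto)
    then have dV: "delta ?V (C \<times> F) \<le> ?k" using card_image_le[OF B(1), of "Pair c1"] B(4) by simp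
    have "\<exists>L\<in>D. left_nondeg (N0 + L) C2 F"
      by (rule Suc.IH[OF C2(1) fF C2(3)]) (use sk big split dV in simp_all)
    then obtain L' where L': "L' \<in> D" "left_nondeg (N0 + L') C2 F" by blast
    have aN: "alt (N0 + L')" using assms(2,3) L' by (simp add: alt_plus)
    obtain X where X: "finite X" "\<not> fs.dependent X" "fs.span X = C2" "card X = s"
      using fds_basis[OF C2(1)] C2(3) by metis
    obtain f0 where f0: "f0 \<in> F" "f0 \<noteq> 0" "\<And>x. x \<in> X \<Longrightarrow> (N0 + L') (x, f0) = 0"
      by (rule fds_common_zero[OF fF X(1), of "\<lambda>x f. (N0 + L') (x, f)"])
        (use alt_lin2[OF aN] X(4) sk in auto)
    have z: "(N0 + L') (c, f0) = 0" if "c \<in> C2" for c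
      by (rule alt_zero_span1[OF aN f0(3)]) (use that X in auto)
    \<comment> \<open>If \<open>?V\<close> vanished at \<open>(c1, f0)\<close>, the row would be
      determined on a complement of \<open>f0\<close>, which has dimension \<open>?k - 1\<close>
      only.\<close>
    have "\<exists>N\<in>?V. N (c1, f0) \<noteq> 0"
    proof (rule ccontr)
      assume n: "\<not> ?thesis"
      have sub: "fs.span {f0} \<subseteq> F" using fs.span_minimal[of "{f0}" F] f0 fds_subspace[OF fF] by auto
      obtain F' where F': "fds F'" "F' \<subseteq> F" "fs.dim (fs.span {f0}) + fs.dim F' = ?k" "fs.span {f0} \<inter> F' = {0}"
        "\<forall>v\<in>F. \<exists>w\<in>fs.span {f0}. \<exists>c\<in>F'. v = w + c"
        by (rule fds_complement[OF fF fs.subspace_span sub])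
      obtain Y where Y: "finite Y" "\<not> fs.dependent Y" "fs.span Y = F'" "card Y = fs.dim F'"
        using fds_basis[OF F'(1)] by metis
      have d1: "fs.dim (fs.span {f0}) = 1" using fs.dim_span_eq_card_independent[of "{f0}"] f0(2) by simp
      have "delta ?V (C \<times> F) \<le> card (Pair c1 ` Y)"
      proof (rule delta_le_card[OF fV])
        fix N assume N: "N \<in> ?V" "N \<in> van (Pair c1 ` Y)"
        have a: "alt N" by (rule aV[OF N(1)])
        show "N \<in> van (C \<times> F)"
        proof (rule Vzero[OF N(1)])
          fix f assume "f \<in> F"
          then obtain w y where wy: "w \<in> fs.span {f0}" "y \<in> F'" "f = w + y" using F'(5) by blast
          have "N (c1, w) = 0" by (rule alt_zero_span2[OF a, of "{f0}"]) (use n N(1) wy in auto)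
          moreover have "N (c1, y) = 0"
            by (rule alt_zero_span2[OF a, of Y]) (use N(2) wy Y in \<open>auto simp: in_van\<close>)
          ultimately show "N (c1, f) = 0" using a wy(3) by (simp add: alt_simps)
        qed
      qed (use Y in auto)
      then have "delta ?V (C \<times> F) \<le> fs.dim F'" using card_image_le[OF Y(1), of "Pair c1"] Y(4) by simp
      then show False using True d1 F'(3) by simp
    qed
    then obtain N where N: "N \<in> ?V" "N (c1, f0) \<noteq> 0" by blast
    show ?thesis
    proof (cases "(N0 + L') (c1, f0) = 0")
      case False
      have "left_nondeg (N0 + L') C F" unfolding c1(3)
        by (rule left_nondeg_insert[OF aN fds_subspace[OF C2(1)] L'(2) f0(1) False z])
      then show ?thesis using L'(1) by blast
    next
      case t: True
      have NV: "N (c, f) = 0" if "c \<in> C2" "f \<in> F" for c f using N(1) that by (auto simp: in_van)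
      have aN': "alt (N0 + L' + N)" using aN aV[OF N(1)] by (simp add: alt_plus)
      have "left_nondeg (N0 + L' + N) C2 F" using L'(2) NV by (auto simp: left_nondeg_def)
      then have "left_nondeg (N0 + L' + N) C F" unfolding c1(3)
        by (rule left_nondeg_insert[OF aN' fds_subspace[OF C2(1)] _ f0(1)]) (use t N(2) z NV f0(1) in auto)
      moreover have "L' + N \<in> D" using L' N(1) fds_add[OF assms(1)] by blast
      ultimately show ?thesis unfolding add.assoc by blast
    qed
  next
    case False
    have pos: "0 < delta ?V (C \<times> F)" using big split dC2 sk by simp
    obtain N where N: "N \<in> ?V" "N \<notin> van (C \<times> F)" using delta_pos[OF fV pos] .
    then obtain f0 where f0: "f0 \<in> F" "N (c1, f0) \<noteq> 0" using Vzero by blast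
    have aNN: "alt N" by (rule aV[OF N(1)])
    have NV: "N (c, f) = 0" if "c \<in> C2" "f \<in> F" for c f using N(1) that by (auto simp: in_van)
    let ?F = "hyp F (\<lambda>f. N (c1, f))"
    have F: "fds ?F" "fs.dim F = fs.dim ?F + 1" "?F \<subseteq> F"
      using fds_hyp[OF fF alt_lin2[OF aNN]] dim_hyp[OF fF alt_lin2[OF aNN] f0] hyp_subset by auto
    have fF': "F = fs.span (insert f0 ?F)"
    proof -
      have "f0 \<notin> ?F" using f0 by (simp add: hyp_def)
      then show ?thesis
        using fds_eq[OF fF fs.subspace_span, of "insert f0 ?F"] fs.span_minimal[of "insert f0 ?F" F]
          f0(1) F fds_subspace[OF fF] fds_insert(2)[OF F(1)] by auto
    qed
    obtain X where X: "finite X" "\<not> fs.dependent X" "fs.span X = C2" "card X = s"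
      using fds_basis[OF C2(1)] C2(3) by metis
    have "delta D (C2 \<times> F) \<le> delta D (C2 \<times> ?F) + card ((\<lambda>x. (x, f0)) ` X)"
    proof (rule delta_le[OF assms(1)])
      fix N assume N: "N \<in> D" "N \<in> van ((\<lambda>x. (x, f0)) ` X)" "N \<in> van (C2 \<times> ?F)"
      have a: "alt N" using assms(2) N by simp
      have x: "N (c, f0) = 0" if "c \<in> C2" for c
        by (rule alt_zero_span1[OF a, of X]) (use N(2) that X in \<open>auto simp: in_van\<close>)
      have "N (c, f) = 0" if "c \<in> C2" "f \<in> F" for c f
        by (rule alt_zero_span2[OF a, of "insert f0 ?F"]) (use N(3) x that fF' in \<open>auto simp: in_van\<close>)
      then show "N \<in> van (C2 \<times> F)" by (auto simp: in_van)
    qed (use X in auto)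
    then have "delta D (C2 \<times> F) \<le> delta D (C2 \<times> ?F) + s" using card_image_le[OF X(1), of "\<lambda>x. (x, f0)"] X(4) by simp
    then have sF: "s * fs.dim ?F \<le> delta D (C2 \<times> ?F) + fs.dim ?F - 1"
      using big split False F(2) sk by simp
    have "\<exists>L\<in>D. left_nondeg (N0 + L) C2 ?F"
      by (rule Suc.IH[OF C2(1) F(1) C2(3)]) (use sk F(2) sF in simp_all)
    then obtain L' where L': "L' \<in> D" "left_nondeg (N0 + L') C2 ?F" by blast
    let ?N = "N0 + L'"
    have aN: "alt ?N" using assms(2,3) L' by (simp add: alt_plus)
    \<comment> \<open>If both fail, take left kernel vectors \<open>x\<close>, \<open>y\<close>.
      Neither lies in \<open>C2\<close>, and the combination that cancels \<open>c1\<close>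
      annihilates \<open>?F\<close>, so it is 0 and \<open>x\<close>, \<open>y\<close> are
      proportional. Then \<open>?N\<close> and \<open>?N + N\<close> both vanish at
      \<open>(y, f0)\<close>, against \<open>N (c1, f0) \<noteq> 0\<close>.\<close>
    have "left_nondeg ?N C F \<or> left_nondeg (?N + N) C F"
    proof (rule ccontr)
      assume n: "\<not> ?thesis"
      then obtain x y where x: "x \<in> C" "\<forall>f\<in>F. ?N (x, f) = 0" "x \<noteq> 0"
        and y: "y \<in> C" "\<forall>f\<in>F. (?N + N) (y, f) = 0" "y \<noteq> 0" unfolding left_nondeg_def by blast
      obtain a c where ac: "x = a \<odot> c1 + c" "c \<in> C2"
        using x(1) unfolding c1(3) in_span_insert_iff[OF fds_subspace[OF C2(1)]] by blast
      obtain b d where bd: "y = b \<odot> c1 + d" "d \<in> C2"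
        using y(1) unfolding c1(3) in_span_insert_iff[OF fds_subspace[OF C2(1)]] by blast
      have Ny: "N (y, f) = b * N (c1, f)" if "f \<in> F" for f
        unfolding bd(1) using aNN NV[OF bd(2) that] by (simp add: alt_simps)
      have yF: "?N (y, f) = 0" if "f \<in> ?F" for f
        using y(2) Ny[of f] that by (auto simp: hyp_def)
      have a: "a \<noteq> 0"
      proof
        assume "a = 0"
        then have "x \<in> C2" using ac by simp
        then show False using left_nondegD[OF L'(2), of x] x F(3) by auto
      qed
      have b: "b \<noteq> 0"
      proof
        assume "b = 0"
        then have "y \<in> C2" using bd by simp
        then show False using left_nondegD[OF L'(2), of y] yF y(3) by auto
      qed
      let ?z = "b \<odot> c - a \<odot> d"
      have eq: "b \<odot> x - a \<odot> y = ?z" unfolding ac(1) bd(1) by (auto simp: fun_eq_iff smul_apply algebra_simps)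
      have zC: "?z \<in> C2" using ac bd C2(1) by (simp add: fds_closed)
      have "?z = 0"
      proof (rule left_nondegD[OF L'(2) zC])
        fix f assume f: "f \<in> ?F"
        then have "?N (x, f) = 0" "?N (y, f) = 0" using x(2) yF F(3) by auto
        then show "?N (?z, f) = 0" unfolding eq[symmetric] using lin_diff[OF alt_lin1[OF aN]] lin_smul[OF alt_lin1[OF aN]] by simp
      qed
      then have "b \<odot> x = a \<odot> y" using eq by simp
      then have "b * ?N (x, f0) = a * ?N (y, f0)" using lin_smul[OF alt_lin1[OF aN]] by metis
      then have "?N (y, f0) = 0" using x(2) f0(1) a by simp
      moreover have "?N (y, f0) + N (y, f0) = 0" using y(2) f0(1) by simp
      ultimately have "N (y, f0) = 0" by (metis add_0)
      then show False using Ny[OF f0(1)] b f0(2) by simp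
    qed
    moreover have "L' + N \<in> D" using L' N(1) fds_add[OF assms(1)] by blast
    ultimately show ?thesis using L'(1) unfolding add.assoc by blast
  qed
qed

lemma dim_0: "fds {0 :: 'i \<Rightarrow> 'a::field}" "fs.dim {0 :: 'i \<Rightarrow> 'a} = 0"
  using fds_span[of "{}"] fds_dim_0[of "{0}"] by auto

lemma finite_spanning_rest:
  fixes C :: "('i \<Rightarrow> 'a::field) set"
  assumes "fds C" "b \<in> C" "b \<noteq> 0"
  obtains X where "finite X" "card X + 1 = fs.dim C" "fs.span (insert b X) = C"
proof -
  have "fs.span {b} \<subseteq> C" using fs.span_minimal[of "{b}" C] assms fds_subspace by auto
  then obtain F where F: "fds F" "F \<subseteq> C" "fs.dim (fs.span {b}) + fs.dim F = fs.dim C" "fs.span {b} \<inter> F = {0}"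
    "\<forall>v\<in>C. \<exists>w\<in>fs.span {b}. \<exists>c\<in>F. v = w + c" by (rule fds_complement[OF assms(1) fs.subspace_span])
  obtain X where X: "finite X" "\<not> fs.dependent X" "fs.span X = F" "card X = fs.dim F"
    using fds_basis[OF F(1)] by metis
  have "fs.span (insert b X) = C"
  proof
    show "fs.span (insert b X) \<subseteq> C"
      using fs.span_minimal[of "insert b X" C] assms fds_subspace[OF assms(1)] F(2) X(3) fs.span_superset[of X] by auto
    show "C \<subseteq> fs.span (insert b X)"
    proof
      fix v assume "v \<in> C"
      then obtain w c where "w \<in> fs.span {b}" "c \<in> F" "v = w + c" using F(5) by blast
      then show "v \<in> fs.span (insert b X)"
        using fs.span_mono[of "{b}" "insert b X"] fs.span_mono[of X "insert b X"] X(3) fs.span_add by blast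
    qed
  qed
  moreover have "fs.dim (fs.span {b}) = 1" using fs.dim_span_eq_card_independent[of "{b}"] assms(3) by simp
  ultimately show thesis using that[of X] X F(3) by simp
qed

text \<open>Evaluation at \<open>(e, v)\<close> vanishes on \<open>S\<close> wherever all
  evaluations at \<open>(c, v)\<close> do, hence is a combination of them. The vector
  \<open>h\<close> depends on \<open>v\<close>; making it uniform is the difficulty of the lifting
  lemmas.\<close>

lemma functional_representative:
  assumes "fds S" "\<And>N. N \<in> S \<Longrightarrow> alt N" "fds C"
    "\<And>N. N \<in> S \<Longrightarrow> (\<And>c. c \<in> C \<Longrightarrow> N (c, v) = 0) \<Longrightarrow> N (e, v) = 0"
  obtains h where "h \<in> C" "\<And>N. N \<in> S \<Longrightarrow> N (e, v) = N (h, v)"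
proof -
  obtain B where B: "finite B" "\<not> fs.dependent B" "fs.span B = C" "card B = fs.dim C"
    using fds_basis[OF assms(3)] by metis
  have "\<exists>a. \<forall>N\<in>S. N (e, v) = (\<Sum>i\<in>B. a i * N (i, v))"
  proof (rule lin_kernel_combination[OF B(1) lin_eval lin_eval fds_subspace[OF assms(1)]])
    fix N assume N: "N \<in> S" "\<And>i. i \<in> B \<Longrightarrow> N (i, v) = 0"
    show "N (e, v) = 0"
      by (rule assms(4)[OF N(1)], rule alt_zero_span1[OF assms(2)[OF N(1)] N(2)]) (use B in auto)
  qed
  then obtain a where a: "\<And>N. N \<in> S \<Longrightarrow> N (e, v) = (\<Sum>i\<in>B. a i * N (i, v))" by blast
  have "(\<Sum>i\<in>B. a i \<odot> i) \<in> C" unfolding B(3)[symmetric] by (intro fs.span_sum fs.span_scale fs.span_base)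
  moreover have "N (e, v) = N (\<Sum>i\<in>B. a i \<odot> i, v)" if "N \<in> S" for N
    using a[OF that] assms(2)[OF that] by (simp add: alt_sum1 alt_simps)
  ultimately show thesis using that by blast
qed

text \<open>Some \<open>w \<in> F\<close> avoids all relations \<open>N (a, v0) + N (b, w) = 0\<close> valid on the whole of \<open>S\<close> with
  \<open>b \<noteq> 0\<close>: otherwise a basis of \<open>F\<close> would give almost \<open>dim F\<close> independent relations on \<open>C \<times> F\<close>.\<close>

lemma bad_vectors_do_not_span:
  fixes S :: "(('i \<Rightarrow> 'a::field) \<times> ('i \<Rightarrow> 'a) \<Rightarrow> 'a) set"
  assumes "fds S" "\<And>N. N \<in> S \<Longrightarrow> alt N" "fds C" "fds F" "fs.dim C = s" "fs.dim F = m" "1 \<le> s"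
    "m * (s - 1) + 2 \<le> delta S (C \<times> F)" "v0 \<in> F"
  obtains z where "z \<in> F"
    "z \<notin> fs.span (insert v0 {w \<in> F. \<exists>a\<in>C. \<exists>b\<in>C. b \<noteq> 0 \<and> (\<forall>N\<in>S. N (a, v0) + N (b, w) = 0)})"
proof (rule ccontr)
  let ?W = "{w \<in> F. \<exists>a\<in>C. \<exists>b\<in>C. b \<noteq> 0 \<and> (\<forall>N\<in>S. N (a, v0) + N (b, w) = 0)}"
  assume "\<not> thesis"
  then have sub: "F \<subseteq> fs.span (insert v0 ?W)" using that by blast
  \<comment> \<open>A nonzero \<open>v0\<close> is put into the basis of \<open>F\<close> first, so
    that all other basis vectors are bad.\<close>
  let ?I = "if v0 = 0 then {} else {v0}"
  have I: "?I \<subseteq> insert v0 ?W" "\<not> fs.dependent ?I" by (auto simp: fs.independent_empty)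
  obtain B where B: "?I \<subseteq> B" "B \<subseteq> insert v0 ?W" "\<not> fs.dependent B" "insert v0 ?W \<subseteq> fs.span B"
    by (rule fs.maximal_independent_subset_extend[OF I])
  have BF: "B \<subseteq> F" using B(2) assms(9) by auto
  have fB: "finite B" using fds_independent(1)[OF assms(4) BF B(3)] .
  have "F \<subseteq> fs.span B" using sub fs.span_minimal[OF B(4)] by auto
  then have sB: "fs.span B = F" using fs.span_minimal[OF BF fds_subspace[OF assms(4)]] by auto
  have cB: "card B = m" using fs.dim_span_eq_card_independent[OF B(3)] sB assms(6) by simp
  have v0B: "w \<noteq> v0 \<Longrightarrow> w \<in> B \<Longrightarrow> w \<in> ?W" for w using B(2) by blast
  have "\<exists>a b X. a \<in> C \<and> b \<in> C \<and> (\<forall>N\<in>S. N (a, v0) + N (b, w) = 0) \<and> finite X \<and> card X + 1 = s \<and> fs.span (insert b X) = C"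
    if w: "w \<in> B - {v0}" for w
  proof -
    obtain a b where ab: "a \<in> C" "b \<in> C" "b \<noteq> 0" "\<forall>N\<in>S. N (a, v0) + N (b, w) = 0" using v0B[of w] w by blast
    obtain X where "finite X" "card X + 1 = fs.dim C" "fs.span (insert b X) = C"
      by (rule finite_spanning_rest[OF assms(3) ab(2,3)])
    then show ?thesis using ab assms(5) by blast
  qed
  then obtain a b X where abX: "\<And>w. w \<in> B - {v0} \<Longrightarrow> a w \<in> C \<and> b w \<in> C \<and> (\<forall>N\<in>S. N (a w, v0) + N (b w, w) = 0)
    \<and> finite (X w) \<and> card (X w) + 1 = s \<and> fs.span (insert (b w) (X w)) = C" by metis
  obtain Y where Y: "finite Y" "\<not> fs.dependent Y" "fs.span Y = C" "card Y = fs.dim C"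
    using fds_basis[OF assms(3)] by metis
  \<comment> \<open>Once \<open>N (C, v0) = 0\<close>, the relation of a bad \<open>w\<close> gives
    \<open>N (b, w) = 0\<close> for free, so \<open>s - 1\<close> conditions settle
    \<open>w\<close>. With at most \<open>s\<close> conditions at \<open>v0\<close>, the total is at
    most \<open>m * (s - 1) + 1\<close>.\<close>
  let ?P = "(if v0 = 0 then {} else Y \<times> {v0}) \<union> (\<Union>w\<in>B - {v0}. X w \<times> {w})"
  have "delta S (C \<times> F) \<le> card ?P"
  proof (rule delta_le_card[OF assms(1)])
    show "finite ?P" using Y fB abX by auto
    fix N assume N: "N \<in> S" "N \<in> van ?P"
    have aN: "alt N" using assms(2) N by simp
    have v0: "N (c, v0) = 0" if "c \<in> C" for c
    proof (cases "v0 = 0")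
      case True then show ?thesis using aN by (simp add: alt_simps)
    next
      case False
      show ?thesis by (rule alt_zero_span1[OF aN, of Y]) (use N(2) False that Y in \<open>auto simp: in_van\<close>)
    qed
    have "N (c, w) = 0" if "c \<in> C" "w \<in> B" for c w
    proof (cases "w = v0")
      case False
      then have w: "w \<in> B - {v0}" using that by simp
      have "N (a w, v0) + N (b w, w) = 0" "N (a w, v0) = 0" using abX[OF w] N(1) v0 by auto
      then have bw: "N (b w, w) = 0" by simp
      show ?thesis
      proof (rule alt_zero_span1[OF aN, of "insert (b w) (X w)"])
        show "N (x, w) = 0" if "x \<in> insert (b w) (X w)" for x
          using that bw w N(2) unfolding in_van by fastforce
        show "c \<in> fs.span (insert (b w) (X w))" using abX[OF w] that by simp
      qed
    qed (use v0 that in auto)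
    then have "N (c, f) = 0" if "c \<in> C" "f \<in> F" for c f
      using alt_zero_span2[OF aN, of B c f] that sB by blast
    then show "N \<in> van (C \<times> F)" by (auto simp: in_van)
  qed
  moreover have "card ?P \<le> m * (s - 1) + 1"
  proof -
    have U: "card (\<Union>w\<in>B - {v0}. X w \<times> {w}) \<le> card (B - {v0}) * (s - 1)"
    proof -
      have "card (\<Union>w\<in>B - {v0}. X w \<times> {w}) \<le> (\<Sum>w\<in>B - {v0}. card (X w \<times> {w}))"
        by (rule card_UN_le) (use fB in simp)
      also have "\<dots> = (\<Sum>w\<in>B - {v0}. s - 1)"
        by (rule sum.cong) (use abX in \<open>force simp: card_cartesian_product\<close>)+
      finally show ?thesis by simp
    qed
    show ?thesis
    proof (cases "v0 = 0")
      case True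
      have "card (B - {v0}) * (s - 1) \<le> m * (s - 1)"
        by (rule mult_le_mono1) (use cB card_Diff1_le[of B v0] in simp)
      then have "card (\<Union>w\<in>B - {v0}. X w \<times> {w}) \<le> m * (s - 1) + 1" using U by linarith
      then show ?thesis using True by simp
    next
      case False
      then have "v0 \<in> B" using B(1) by simp
      then have m: "card (B - {v0}) + 1 = m" using cB fB card_Suc_Diff1 by fastforce
      have "card ?P \<le> card (Y \<times> {v0}) + card (B - {v0}) * (s - 1)"
        using card_Un_le[of "Y \<times> {v0}" "\<Union>w\<in>B - {v0}. X w \<times> {w}"] U False by simp
      also have "\<dots> = s + card (B - {v0}) * (s - 1)" using Y(4) assms(5) by (simp add: card_cartesian_product)
      also have "\<dots> = m * (s - 1) + 1" using m assms(7) by (simp flip: m)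
      finally show ?thesis .
    qed
  qed
  ultimately show False using assms(8) by simp
qed

text \<open>Writing \<open>H = F1 \<oplus> C\<close>, the map \<open>N \<mapsto> N (e, \<cdot>)\<close> on \<open>F1\<close> kills every \<open>v\<close> with \<open>N (C, v) = 0\<close>, since otherwise some
  form of \<open>S\<close> would have rank \<open>2s + 2\<close>. As \<open>S\<close> is large on \<open>C \<times> F1\<close>, one \<open>h \<in> C\<close> satisfies \<open>N (e - h, F1) = 0\<close> for all \<open>N\<close>.\<close>

lemma isotropic_lift:
  assumes fS: "fds S" and aS: "\<And>N. N \<in> S \<Longrightarrow> alt N" and fE: "fds E"
    and rank: "\<And>N F. N \<in> S \<Longrightarrow> fds F \<Longrightarrow> F \<subseteq> E \<Longrightarrow> fs.dim F = 2 * s + 2 \<Longrightarrow> \<not> nondeg N F"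
    and u: "lin u" "e \<in> E" "u e = 1" and F1: "fds F1" "F1 \<subseteq> hyp E u" "fs.dim F1 = m"
    and iso: "\<And>N x y. N \<in> S \<Longrightarrow> x \<in> F1 \<Longrightarrow> y \<in> F1 \<Longrightarrow> N (x, y) = 0"
    and dE: "fs.dim E = m + s + 1" and s: "1 \<le> s" "s + 1 \<le> m" and wd: "wd S E u \<le> s - 1"
    and big: "((s - 1) choose 2) + 3 + (s - 1) * (m + 2) < delta S (E \<times> E)"
  obtains F where "fds F" "F \<subseteq> E" "fs.dim F = m + 1" "\<And>N x y. N \<in> S \<Longrightarrow> x \<in> F \<Longrightarrow> y \<in> F \<Longrightarrow> N (x, y) = 0"
proof -
  let ?H = "hyp E u"
  have H: "fds ?H" by (rule fds_hyp[OF fE u(1)])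
  have dH: "fs.dim ?H = m + s" using dim_hyp[OF fE u(1,2)] u(3) dE by simp
  obtain C where C: "fds C" "C \<subseteq> ?H" "fs.dim F1 + fs.dim C = fs.dim ?H" "F1 \<inter> C = {0}"
    "\<forall>v\<in>?H. \<exists>w\<in>F1. \<exists>c\<in>C. v = w + c" by (rule fds_complement[OF H fds_subspace[OF F1(1)] F1(2)])
  have dC: "fs.dim C = s" using C(3) dH F1(3) by simp
  have CE: "C \<subseteq> E" and F1E: "F1 \<subseteq> E" using C(2) F1(2) hyp_subset by blast+
  \<comment> \<open>As \<open>F1\<close> is isotropic, only the blocks \<open>C \<times> F1\<close>
    and \<open>C \<times> C\<close> survive on \<open>H\<close>. The block
    \<open>C \<times> C\<close> costs \<open>((s - 1) choose 2) + (s - 1)\<close> and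
    \<open>wd\<close> costs another \<open>s - 1\<close>; together they use up the excess
    \<open>2 * (s - 1)\<close> in \<open>(s - 1) * (m + 2)\<close>.\<close>
  have bound: "m * (s - 1) + 4 \<le> delta S (C \<times> F1)"
  proof -
    let ?S = "S \<inter> van (C \<times> F1)"
    have fS': "fds ?S" by (rule fds_van(1)[OF fS])
    have aS': "\<And>N. N \<in> ?S \<Longrightarrow> alt N" using aS by blast
    have "delta S (E \<times> E) = delta S (?H \<times> ?H) + wd S E u" by (rule wd_delta[OF fS])
    moreover have "delta S (?H \<times> ?H) = delta S (C \<times> F1) + delta ?S (?H \<times> ?H)"
      by (rule delta_split[OF fS]) (use C(2) F1(2) in blast)
    moreover have "delta ?S (?H \<times> ?H) \<le> delta ?S (C \<times> C)"
    proof (rule delta_mono[OF fS'])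
      fix N assume N: "N \<in> ?S" "N \<in> van (C \<times> C)"
      have aN: "alt N" by (rule aS'[OF N(1)])
      have "N (x, y) = 0" if xy: "x \<in> ?H" "y \<in> ?H" for x y
      proof -
        obtain f c where fc: "f \<in> F1" "c \<in> C" "x = f + c" using C(5) xy(1) by blast
        obtain f' c' where fc': "f' \<in> F1" "c' \<in> C" "y = f' + c'" using C(5) xy(2) by blast
        have "N (f, f') = 0" using iso N(1) fc fc' by blast
        moreover have "N (c, f') = 0" "N (c', f) = 0" "N (c, c') = 0" using N fc fc' by (auto simp: in_van)
        ultimately show ?thesis
          unfolding fc(3) fc'(3) using aN alt_zero_swap[OF aN, of c' f] by (simp add: alt_simps)
      qed
      then show "N \<in> van (?H \<times> ?H)" by (auto simp: in_van)
    qed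
    moreover have "delta ?S (C \<times> C) \<le> s choose 2" using delta_square[OF fS' aS' C(1)] dC by simp
    moreover have "s choose 2 = ((s - 1) choose 2) + (s - 1)" using choose_two_Suc[of "s - 1"] s(1) by simp
    moreover have "(s - 1) * (m + 2) = m * (s - 1) + 2 * (s - 1)"
      by (simp only: distrib_left mult.commute)
    ultimately show ?thesis using big wd s(1) by linarith
  qed
  have compat: "N (e, v) = 0" if N: "N \<in> S" and v: "v \<in> F1" and Cv: "\<And>c. c \<in> C \<Longrightarrow> N (c, v) = 0" for N v
  proof (rule ccontr)
    assume n: "N (e, v) \<noteq> 0"
    have aN: "alt N" by (rule aS[OF N])
    have v0: "v \<noteq> 0" using n aN by (auto simp: alt_simps)
    have spv: "fs.span {v} \<subseteq> F1" using fs.span_minimal[of "{v}" F1] v fds_subspace[OF F1(1)] by auto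
    obtain F' where F': "fds F'" "F' \<subseteq> F1" "fs.dim (fs.span {v}) + fs.dim F' = fs.dim F1" "fs.span {v} \<inter> F' = {0}"
      "\<forall>x\<in>F1. \<exists>w\<in>fs.span {v}. \<exists>c\<in>F'. x = w + c" by (rule fds_complement[OF F1(1) fs.subspace_span spv])
    have "fs.dim (fs.span {v}) = 1" using fs.dim_span_eq_card_independent[of "{v}"] v0 by simp
    then have dF': "fs.dim F' + 1 = m" using F'(3) F1(3) by simp
    obtain X where X: "finite X" "\<not> fs.dependent X" "fs.span X = C" "card X = fs.dim C"
      using fds_basis[OF C(1)] by metis
    \<comment> \<open>Perturbations from \<open>?D\<close> preserve \<open>N (e, v)\<close> and
      \<open>N (C, v) = 0\<close>. These \<open>s + 1\<close> conditions still leave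
      \<open>?D\<close> large enough to make \<open>N + L\<close> of full row rank on
      \<open>C \<times> F'\<close>.\<close>
    let ?P = "insert (e, v) ((\<lambda>x. (x, v)) ` X)"
    let ?D = "S \<inter> van ?P"
    have fD: "fds ?D" by (rule fds_van(1)[OF fS])
    have aD: "\<And>N. N \<in> ?D \<Longrightarrow> alt N" using aS by blast
    have Dv: "N (c, v) = 0" if "N \<in> ?D" "c \<in> C" for N c
      by (rule alt_zero_span1[OF aD[OF that(1)], of X]) (use that X in \<open>auto simp: in_van\<close>)
    have "delta S (C \<times> F1) \<le> delta ?D (C \<times> F1) + card ?P"
      by (rule delta_restrict[OF fS _ _ _ fD]) (use X in auto)
    moreover have "card ?P \<le> s + 1"
      using card_insert_le_m1[of "s + 1" "(\<lambda>x. (x, v)) ` X" "(e, v)"] card_image_le[OF X(1), of "\<lambda>x. (x, v)"] X(4) dC by simp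
    moreover have "delta ?D (C \<times> F1) \<le> delta ?D (C \<times> F')"
    proof (rule delta_mono[OF fD])
      fix N assume N: "N \<in> ?D" "N \<in> van (C \<times> F')"
      have a: "alt N" by (rule aD[OF N(1)])
      have "N (c, x) = 0" if "c \<in> C" "x \<in> F1" for c x
      proof -
        obtain w f where wf: "w \<in> fs.span {v}" "f \<in> F'" "x = w + f" using F'(5) \<open>x \<in> F1\<close> by blast
        have "N (c, w) = 0" by (rule alt_zero_span2[OF a, of "{v}"]) (use Dv N(1) that wf in auto)
        then show ?thesis using N(2) that wf a by (auto simp: in_van alt_simps)
      qed
      then show "N \<in> van (C \<times> F1)" by (auto simp: in_van)
    qed
    ultimately have "m * (s - 1) + 4 \<le> delta ?D (C \<times> F') + (s + 1)" using bound by linarith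
    then have "s * fs.dim F' \<le> delta ?D (C \<times> F') + fs.dim F' - 1"
      using dF' s by (cases s; cases m) (auto simp: algebra_simps)
    then obtain L where L: "L \<in> ?D" "left_nondeg (N + L) C F'"
      using affine_left_nondeg[OF fD aD aN C(1) F'(1) dC] dF' s(2) by auto
    let ?N = "N + L"
    have NS: "?N \<in> S" using N L fds_add[OF fS] by blast
    have aNL: "alt ?N" by (rule aS[OF NS])
    \<comment> \<open>Full row rank gives \<open>?Z\<close> codimension \<open>s\<close> in
      \<open>F'\<close>. With a complement \<open>F2\<close> of it, \<open>C + F2\<close> is
      nondegenerate of dimension \<open>2 * s\<close> since \<open>F2\<close> is isotropic, and
      \<open>e\<close>, \<open>v\<close> then produce rank \<open>2 * s + 2\<close>.\<close>
    let ?Z = "{x \<in> F'. \<forall>c\<in>C. ?N (c, x) = 0}"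
    have dZ: "fs.dim ?Z + s = fs.dim F'"
      using perp_dim[OF aNL F'(1) C(1)] left_nondegD[OF L(2)] dC by blast
    have fZ: "fds ?Z" by (rule fds_perp(1)[OF aNL F'(1)])
    have ZF: "?Z \<subseteq> F'" by auto
    obtain F2 where F2: "fds F2" "F2 \<subseteq> F'" "fs.dim ?Z + fs.dim F2 = fs.dim F'" "?Z \<inter> F2 = {0}"
      "\<forall>x\<in>F'. \<exists>w\<in>?Z. \<exists>c\<in>F2. x = w + c" by (rule fds_complement[OF F'(1) fds_subspace[OF fZ] ZF])
    let ?G = "ssum C F2"
    have CF2: "C \<inter> F2 = {0}" using C(4) F2(2) F'(2) fds_0[OF C(1)] fds_0[OF F2(1)] by blast
    have G: "fds ?G" "fs.dim ?G = 2 * s" using fds_ssum(1,3)[OF C(1) F2(1)] CF2 dZ F2(3) dC by auto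
    have GE: "?G \<subseteq> E" by (rule ssum_subset[OF fE]) (use CE F2(2) F'(2) F1E in auto)
    have F2iso: "?N (x, y) = 0" if "x \<in> F1" "y \<in> F1" for x y by (rule iso[OF NS that])
    have F2F1: "F2 \<subseteq> F1" using F2(2) F'(2) by blast
    have nd: "nondeg ?N ?G" unfolding nondeg_def
    proof (intro ballI impI)
      fix x assume x: "x \<in> ?G" "\<forall>y\<in>?G. ?N (x, y) = 0"
      obtain c f where cf: "c \<in> C" "f \<in> F2" "x = c + f" using x(1) by (rule ssumE)
      have "?N (c, y) = 0" if y: "y \<in> F'" for y
      proof -
        obtain w z where wz: "w \<in> ?Z" "z \<in> F2" "y = w + z" using F2(5) y by blast
        have "?N (x, z) = 0" using x(2) wz(2) ssum_superset(2)[OF C(1) F2(1)] by blast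
        then have "?N (c, z) + ?N (f, z) = 0" unfolding cf(3) using lin_add[OF alt_lin1[OF aNL]] by metis
        moreover have "?N (f, z) = 0" using F2iso[of f z] cf(2) wz(2) F2F1 by blast
        ultimately have "?N (c, z) = 0" by (metis add.right_neutral)
        moreover have "?N (c, w) = 0" using wz(1) cf(1) by blast
        ultimately show ?thesis unfolding wz(3) using lin_add[OF alt_lin2[OF aNL]] by simp
      qed
      then have "c = 0" using left_nondegD[OF L(2) cf(1)] by blast
      then have xf: "x = f" using cf by simp
      have "f \<in> ?Z"
      proof -
        have "?N (c', f) = 0" if "c' \<in> C" for c'
        proof -
          have "?N (f, c') = 0" using x(2) that ssum_superset(1)[OF C(1) F2(1)] xf by blast
          then show ?thesis using alt_zero_swap[OF aNL, of f c'] by blast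
        qed
        then show ?thesis using cf(2) F2(2) by blast
      qed
      then show "x = 0" using xf cf(2) F2(4) by blast
    qed
    have Nv: "?N (x, v) = 0" if x: "x \<in> ?G" for x
    proof -
      obtain c f where cf: "c \<in> C" "f \<in> F2" "x = c + f" using x by (rule ssumE)
      have "?N (c, v) = 0" using Cv[OF cf(1)] Dv[OF L(1) cf(1)] by simp
      moreover have "?N (f, v) = 0" using F2iso[of f v] cf(2) F2F1 v by blast
      ultimately show ?thesis unfolding cf(3) using lin_add[OF alt_lin1[OF aNL]] by simp
    qed
    obtain a where a: "a \<in> ?G" "\<And>x. x \<in> ?G \<Longrightarrow> ?N (e - a, x) = 0" using nondeg_project[OF aNL G(1) nd] by metis
    have Nev: "?N (e, v) \<noteq> 0" using n L(1) by (simp add: in_van)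
    have "?N (e - a, v) = ?N (e, v) - ?N (a, v)" by (rule lin_diff[OF alt_lin1[OF aNL]])
    then have pv: "?N (e - a, v) \<noteq> 0" using Nv[OF a(1)] Nev by simp
    have vp: "?N (v, x) = 0" if "x \<in> ?G" for x using Nv[OF that] alt_zero_swap[OF aNL, of x v] by blast
    have "e - a \<in> E" "v \<in> E" using u(2) a(1) GE v F1E fds_diff[OF fE] by auto
    then obtain G' where "fds G'" "G' \<subseteq> E" "fs.dim G' = fs.dim ?G + 2" "nondeg ?N G'"
      using nondeg_extend[OF aNL G(1) nd fE GE _ _ a(2) vp pv] by metis
    then show False using rank[OF NS] G(2) by simp
  qed
  have ex_h: "\<exists>h\<in>C. \<forall>N\<in>S. N (e, v) = N (h, v)" if v: "v \<in> F1" for v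
  proof -
    obtain h where "h \<in> C" "\<And>N. N \<in> S \<Longrightarrow> N (e, v) = N (h, v)"
      using functional_representative[OF fS aS C(1), of v e] compat[OF _ v] by metis
    then show ?thesis by blast
  qed
  have b2: "m * (s - 1) + 2 \<le> delta S (C \<times> F1)" using bound by simp
  \<comment> \<open>With 0 in the role of the fixed vector, a relation reads
    \<open>N (b, w) = 0\<close> on \<open>S\<close>. The resulting \<open>v0\<close> therefore
    separates the vectors of \<open>C\<close>.\<close>
  obtain v0 where v0: "v0 \<in> F1" "v0 \<notin> fs.span (insert 0 {w \<in> F1. \<exists>a\<in>C. \<exists>b\<in>C. b \<noteq> 0 \<and> (\<forall>N\<in>S. N (a, 0) + N (b, w) = 0)})"
    by (rule bad_vectors_do_not_span[OF fS aS C(1) F1(1) dC F1(3) s(1) b2 fds_0[OF F1(1)]])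
  have good: "b = 0" if b: "b \<in> C" "\<And>N. N \<in> S \<Longrightarrow> N (b, v0) = 0" for b
  proof (rule ccontr)
    assume "b \<noteq> 0"
    moreover have "N (0, 0) + N (b, v0) = 0" if "N \<in> S" for N using b(2)[OF that] alt_self[OF aS[OF that]] by simp
    ultimately have "v0 \<in> {w \<in> F1. \<exists>a\<in>C. \<exists>b\<in>C. b \<noteq> 0 \<and> (\<forall>N\<in>S. N (a, 0) + N (b, w) = 0)}"
      using v0(1) b(1) fds_0[OF C(1)] by blast
    then show False using v0(2) fs.span_superset[of "insert 0 {w \<in> F1. \<exists>a\<in>C. \<exists>b\<in>C. b \<noteq> 0 \<and> (\<forall>N\<in>S. N (a, 0) + N (b, w) = 0)}"] by blast
  qed
  let ?W = "{w \<in> F1. \<exists>a\<in>C. \<exists>b\<in>C. b \<noteq> 0 \<and> (\<forall>N\<in>S. N (a, v0) + N (b, w) = 0)}"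
  let ?T = "fs.span (insert v0 ?W)"
  obtain z where z: "z \<in> F1" "z \<notin> ?T"
    by (rule bad_vectors_do_not_span[OF fS aS C(1) F1(1) dC F1(3) s(1) b2 v0(1)])
  obtain h where h: "h \<in> C" "\<And>N. N \<in> S \<Longrightarrow> N (e, v0) = N (h, v0)" using ex_h[OF v0(1)] by blast
  \<comment> \<open>Compare the vectors \<open>h\<close>, \<open>g\<close>, \<open>k\<close>
    attached to \<open>v0\<close>, \<open>w\<close> and \<open>v0 + w\<close>: additivity yields a
    relation between \<open>k - h\<close> and \<open>k - g\<close>. As \<open>w\<close> is not bad,
    \<open>k = g\<close>, and then the choice of \<open>v0\<close> gives
    \<open>k = h\<close>.\<close>
  have off: "N (e - h, w) = 0" if N: "N \<in> S" and w: "w \<in> F1" "w \<notin> ?T" for N w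
  proof -
    obtain g where g: "g \<in> C" "\<And>N. N \<in> S \<Longrightarrow> N (e, w) = N (g, w)" using ex_h[OF w(1)] by blast
    obtain k where k: "k \<in> C" "\<And>N. N \<in> S \<Longrightarrow> N (e, v0 + w) = N (k, v0 + w)"
      using ex_h[of "v0 + w"] w(1) v0(1) fds_add[OF F1(1)] by blast
    have rel: "N (k - h, v0) + N (k - g, w) = 0" if N: "N \<in> S" for N
    proof -
      have a: "alt N" by (rule aS[OF N])
      have "N (e, v0) + N (e, w) = N (k, v0) + N (k, w)" using k(2)[OF N] a by (simp add: alt_simps)
      moreover have "N (k - h, v0) + N (k - g, w) = (N (k, v0) + N (k, w)) - (N (h, v0) + N (g, w))"
        using a by (simp add: alt_simps)
      ultimately show ?thesis using h(2)[OF N] g(2)[OF N] by simp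
    qed
    have kg: "k - g = 0"
    proof (rule ccontr)
      assume "k - g \<noteq> 0"
      moreover have "k - h \<in> C" "k - g \<in> C" using fds_diff[OF C(1)] k(1) g(1) h(1) by auto
      ultimately have "w \<in> ?W" using rel w(1) by blast
      then show False using w(2) fs.span_superset[of "insert v0 ?W"] by blast
    qed
    have "k - h = 0"
    proof (rule good)
      show "k - h \<in> C" using k(1) h(1) fds_diff[OF C(1)] by blast
      fix N assume N: "N \<in> S"
      show "N (k - h, v0) = 0" using rel[OF N] kg lin_zero[OF alt_lin1[OF aS[OF N]]] by simp
    qed
    then show ?thesis using kg g(2)[OF N] aS[OF N] by (simp add: alt_simps)
  qed
  \<comment> \<open>The complement of a proper subspace spans, and \<open>z\<close> shows that
    \<open>?T\<close> does not contain \<open>F1\<close>.\<close>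
  have all: "N (e - h, w) = 0" if N: "N \<in> S" and w: "w \<in> F1" for N w
    by (rule lin_zero_off_subspace[OF alt_lin2[OF aS[OF N]] fs.subspace_span F1(1) z]) (use off N w in auto)
  let ?F = "fs.span (insert (e - h) F1)"
  have "u (e - h) = 1" using u h(1) C(2) by (auto simp: lin_simps hyp_def)
  then have notF1: "e - h \<notin> F1" using F1(2) by (auto simp: hyp_def)
  have ehE: "e - h \<in> E" using u(2) h(1) CE fds_diff[OF fE] by blast
  show thesis
  proof (rule that[of ?F])
    show "fds ?F" "fs.dim ?F = m + 1" using fds_insert[OF F1(1) notF1] F1(3) by auto
    show "?F \<subseteq> E" using fs.span_minimal[of "insert (e - h) F1" E] ehE F1E fds_subspace[OF fE] by auto
    fix N x y assume N: "N \<in> S" and xy: "x \<in> ?F" "y \<in> ?F"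
    have aN: "alt N" by (rule aS[OF N])
    obtain a f where af: "f \<in> F1" "x = a \<odot> (e - h) + f"
      using xy(1) in_span_insert_iff[OF fds_subspace[OF F1(1)]] by blast
    obtain b g where bg: "g \<in> F1" "y = b \<odot> (e - h) + g"
      using xy(2) in_span_insert_iff[OF fds_subspace[OF F1(1)]] by blast
    have "N (f, e - h) = 0" "N (e - h, g) = 0" "N (f, g) = 0"
      using all[OF N] iso[OF N] af(1) bg(1) alt_zero_swap[OF aN] by blast+
    then show "N (x, y) = 0" unfolding af(2) bg(2)
      using alt_self[OF aN] by (simp only: lin_add[OF alt_lin1[OF aN]] lin_add[OF alt_lin2[OF aN]]
        lin_smul[OF alt_lin1[OF aN]] lin_smul[OF alt_lin2[OF aN]] mult_zero_right add_0)
  qed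
qed

section \<open>Range-compatible maps on alternating forms are local\<close>

definition wedge_in :: "(('i \<Rightarrow> 'a::field) \<times> ('i \<Rightarrow> 'a) \<Rightarrow> 'a) set \<Rightarrow> ('i \<Rightarrow> 'a) set
    \<Rightarrow> (('i \<Rightarrow> 'a) \<Rightarrow> 'a) \<Rightarrow> (('i \<Rightarrow> 'a) \<Rightarrow> 'a) \<Rightarrow> bool" where
  "wedge_in S C f g \<longleftrightarrow> (\<exists>N\<in>S. \<forall>x\<in>C. \<forall>y\<in>C. N (x, y) = f x * g y - f y * g x)"

lemma wedge_in_diff:
  assumes "fds S" "wedge_in S C f g" "wedge_in S C f' g"
  shows "wedge_in S C (\<lambda>x. f x - f' x) g"
proof -
  obtain N N' where N: "N \<in> S" "\<forall>x\<in>C. \<forall>y\<in>C. N (x, y) = f x * g y - f y * g x"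
    "N' \<in> S" "\<forall>x\<in>C. \<forall>y\<in>C. N' (x, y) = f' x * g y - f' y * g x" using assms by (auto simp: wedge_in_def)
  have "(N - N') (x, y) = (f x - f' x) * g y - (f y - f' y) * g x" if "x \<in> C" "y \<in> C" for x y
    using that N by simp (simp add: algebra_simps)
  moreover have "N - N' \<in> S" using N fds_diff[OF assms(1)] by blast
  ultimately show ?thesis unfolding wedge_in_def by blast
qed

lemma fds_proper:
  assumes "fds C" "fds T" "fs.dim T < fs.dim C"
  obtains z where "z \<in> C" "z \<notin> T"
proof -
  have "\<not> C \<subseteq> T" using fds_dim_mono[OF assms(2,1)] assms(3) by linarith
  then show thesis using that by blast
qed

lemma fds_insert_le: "fds V \<Longrightarrow> fds (fs.span (insert x V)) \<and> fs.dim (fs.span (insert x V)) \<le> fs.dim V + 1"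
proof -
  assume V: "fds V"
  show ?thesis
  proof (cases "x \<in> V")
    case True
    then have "fs.span (insert x V) = V"
      using fs.span_redundant[of x V] fs.span_eq_iff[THEN iffD2, OF fds_subspace[OF V]] by auto
    then show ?thesis using V by simp
  next
    case False then show ?thesis using fds_insert[OF V] by simp
  qed
qed

text \<open>The pointwise representative \<open>H v\<close> matters only modulo \<open>v\<close>.
  Since all wedges are available, comparing \<open>v\<close>, \<open>w\<close> and
  \<open>v + w\<close> puts \<open>H w - H v\<close> into the span of \<open>v\<close> and
  \<open>w\<close>; comparison with two fixed vectors then shows that one correction of
  \<open>H v0\<close> serves for all \<open>w\<close> outside a proper subspace.\<close>

lemma range_compat_full:
  assumes fS: "fds S" and aS: "\<And>N. N \<in> S \<Longrightarrow> alt N" and fC: "fds C" and fQ: "fds Q" and QC: "Q \<subseteq> C"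
    and dim: "fs.dim Q + 3 \<le> fs.dim C"
    and compat: "\<And>N v. N \<in> S \<Longrightarrow> v \<in> C \<Longrightarrow> v \<notin> Q \<Longrightarrow> (\<And>w. w \<in> C \<Longrightarrow> N (v, w) = 0) \<Longrightarrow> N (e, v) = 0"
    and full: "\<And>f g. lin f \<Longrightarrow> lin g \<Longrightarrow> wedge_in S C f g"
  shows "\<exists>h\<in>C. \<forall>N\<in>S. \<forall>v\<in>C. N (e, v) = N (h, v)"
proof -
  have "\<exists>h. h \<in> C \<and> (\<forall>N\<in>S. N (e, v) = N (h, v))" if v: "v \<in> C" "v \<notin> Q" for v
  proof -
    have "N (e, v) = 0" if "N \<in> S" "\<And>c. c \<in> C \<Longrightarrow> N (c, v) = 0" for N
      using compat[OF that(1) v] that(2) alt_zero_swap[OF aS[OF that(1)]] by blast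
    then obtain h where "h \<in> C" "\<And>N. N \<in> S \<Longrightarrow> N (e, v) = N (h, v)"
      using functional_representative[OF fS aS fC, of v e] by metis
    then show ?thesis by blast
  qed
  then obtain H where H: "\<And>v. v \<in> C \<Longrightarrow> v \<notin> Q \<Longrightarrow> H v \<in> C" "\<And>v N. v \<in> C \<Longrightarrow> v \<notin> Q \<Longrightarrow> N \<in> S \<Longrightarrow> N (e, v) = N (H v, v)"
    by metis
  \<comment> \<open>Otherwise a functional \<open>f\<close> separates \<open>?b - ?a\<close> from
    \<open>v\<close>, \<open>w\<close>; the wedges of \<open>f\<close> with functionals dual to
    \<open>v\<close> and to \<open>w\<close>, put into the relation at \<open>v + w\<close>, give
    \<open>f ?a = 0\<close> and \<open>f ?b = 0\<close>.\<close>
  have diff: "\<exists>\<alpha> \<beta>. H w - H v = \<alpha> \<odot> v + \<beta> \<odot> w"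
    if v: "v \<in> C" "v \<notin> Q" and w: "w \<in> C" "w \<notin> fs.span (insert v Q)" for v w
  proof (rule ccontr)
    assume n: "\<not> ?thesis"
    have wQ: "w \<notin> Q" "w \<notin> fs.span {v}"
      using w(2) fs.span_superset[of "insert v Q"] fs.span_mono[of "{v}" "insert v Q"] by auto
    have vw: "v + w \<in> C" using v w fds_add[OF fC] by blast
    have vwQ: "v + w \<notin> Q"
    proof
      assume "v + w \<in> Q"
      then have "(v + w) - v \<in> fs.span (insert v Q)" by (intro fs.span_diff fs.span_base) auto
      then show False using w(2) by simp
    qed
    let ?a = "H (v + w) - H v" let ?b = "H (v + w) - H w"
    have rel: "N (?a, v) + N (?b, w) = 0" if N: "N \<in> S" for N
    proof -
      have aN: "alt N" by (rule aS[OF N])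
      have "N (e, v) + N (e, w) = N (H (v + w), v) + N (H (v + w), w)"
        using H(2)[OF vw vwQ N] aN by (simp add: alt_simps)
      moreover have "N (?a, v) + N (?b, w) = (N (H (v + w), v) + N (H (v + w), w)) - (N (H v, v) + N (H w, w))"
        using aN by (simp add: alt_simps)
      ultimately show ?thesis using H(2)[OF v N] H(2)[OF w(1) wQ(1) N] by simp
    qed
    have v0: "v \<noteq> 0" using v(2) fds_0[OF fQ] by auto
    have vw0: "v \<notin> fs.span {w}"
    proof
      assume "v \<in> fs.span {w}"
      then obtain c where c: "v = c \<odot> w" using fs.span_singleton[of w] by auto
      then have "c \<noteq> 0" using v0 by auto
      then have "w = (1 / c) \<odot> v" unfolding c by (simp add: fun_eq_iff smul_apply)
      then show False using wQ(2) fs.span_singleton[of v] by auto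
    qed
    have "?b - ?a \<notin> fs.span {v, w}"
    proof
      assume "?b - ?a \<in> fs.span {v, w}"
      then obtain k where "?b - ?a - k \<odot> v \<in> fs.span {w}" using fs.span_insert[of v "{w}"] by auto
      then obtain c where "?b - ?a - k \<odot> v = c \<odot> w" using fs.span_singleton[of w] by auto
      then have "H w - H v = (- k) \<odot> v + (- c) \<odot> w" by (auto simp: fun_eq_iff smul_apply algebra_simps)
      then show False using n by blast
    qed
    then obtain f where f: "lin f" "f (?b - ?a) = 1" "\<And>x. x \<in> fs.span {v, w} \<Longrightarrow> f x = 0"
      using lin_separate[OF fs.subspace_span] by metis
    have f0: "f v = 0" "f w = 0" using f(3) fs.span_base[of _ "{v, w}"] by auto
    obtain g where g: "lin g" "g v = 1" "\<And>x. x \<in> fs.span {w} \<Longrightarrow> g x = 0"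
      using lin_separate[OF fs.subspace_span vw0] by metis
    obtain g' where g': "lin g'" "g' w = 1" "\<And>x. x \<in> fs.span {v} \<Longrightarrow> g' x = 0"
      using lin_separate[OF fs.subspace_span wQ(2)] by metis
    have g0: "g w = 0" "g' v = 0" using g(3) g'(3) fs.span_base by auto
    have ab: "?a \<in> C" "?b \<in> C" using H(1) v w vw vwQ wQ fds_diff[OF fC] by auto
    obtain N where N: "N \<in> S" "\<forall>x\<in>C. \<forall>y\<in>C. N (x, y) = f x * g y - f y * g x"
      using full[OF f(1) g(1)] by (auto simp: wedge_in_def)
    have "f ?a = 0" using rel[OF N(1)] N(2) ab v(1) w(1) f0 g0 g(2) by simp
    moreover obtain N' where N': "N' \<in> S" "\<forall>x\<in>C. \<forall>y\<in>C. N' (x, y) = f x * g' y - f y * g' x"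
      using full[OF f(1) g'(1)] by (auto simp: wedge_in_def)
    then have "f ?b = 0" using rel[OF N'(1)] ab v(1) w(1) f0 g0 g'(2) by simp
    ultimately show False using f(2) lin_diff[OF f(1), of ?b ?a] by simp
  qed
  obtain v0 where v0: "v0 \<in> C" "v0 \<notin> Q" using fds_proper[OF fC fQ] dim by auto
  let ?Q1 = "fs.span (insert v0 Q)"
  have Q1: "fds ?Q1" "fs.dim ?Q1 \<le> fs.dim Q + 1" using fds_insert_le[OF fQ] by auto
  obtain w1 where w1: "w1 \<in> C" "w1 \<notin> ?Q1" using fds_proper[OF fC Q1(1)] Q1(2) dim by auto
  let ?Q2 = "fs.span (insert w1 ?Q1)"
  have Q2: "fds ?Q2" "fs.dim ?Q2 \<le> fs.dim Q + 2" using fds_insert_le[OF Q1(1), of w1] Q1(2) by auto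
  obtain z where z: "z \<in> C" "z \<notin> ?Q2" using fds_proper[OF fC Q2(1)] Q2(2) dim by auto
  have sub: "insert v0 Q \<subseteq> ?Q1" "?Q1 \<subseteq> ?Q2" "w1 \<in> ?Q2" "fs.span (insert w1 Q) \<subseteq> ?Q2"
  proof -
    show s1: "insert v0 Q \<subseteq> ?Q1" by (rule fs.span_superset)
    show "?Q1 \<subseteq> ?Q2" "w1 \<in> ?Q2" using fs.span_superset[of "insert w1 ?Q1"] by auto
    show "fs.span (insert w1 Q) \<subseteq> ?Q2" by (rule fs.span_mono) (use s1 in auto)
  qed
  have w1Q: "w1 \<notin> Q" using w1(2) sub(1) by blast
  obtain \<alpha> \<beta> where ab: "H w1 - H v0 = \<alpha> \<odot> v0 + \<beta> \<odot> w1" using diff[OF v0 w1] by blast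
  \<comment> \<open>The multiple of \<open>v0\<close> is invisible at \<open>v0\<close> and absorbs
    the difference to \<open>H w1\<close>; only a multiple of \<open>w\<close> then separates
    \<open>H w\<close> from \<open>?h\<close>, and alternation kills it.\<close>
  let ?h = "H v0 + \<alpha> \<odot> v0"
  have hC: "?h \<in> C" using H(1)[OF v0] v0(1) fC by (simp add: fds_closed)
  have off: "N (e - ?h, w) = 0" if N: "N \<in> S" and w: "w \<in> C" "w \<notin> ?Q2" for N w
  proof -
    have wQ: "w \<notin> Q" "w \<notin> ?Q1" "w \<notin> fs.span (insert w1 Q)" using w(2) sub by auto
    obtain a b where a: "H w - H v0 = a \<odot> v0 + b \<odot> w" using diff[OF v0 w(1) wQ(2)] by blast
    obtain c d where c: "H w - H w1 = c \<odot> w1 + d \<odot> w" using diff[OF w1(1) w1Q w(1) wQ(3)] by blast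
    have eq: "(d - b) \<odot> w = (a - \<alpha>) \<odot> v0 - (c + \<beta>) \<odot> w1"
    proof -
      have "(H w - H v0) - (H w - H w1) = H w1 - H v0" by simp
      then have "(a \<odot> v0 + b \<odot> w) - (c \<odot> w1 + d \<odot> w) = \<alpha> \<odot> v0 + \<beta> \<odot> w1" unfolding a c ab .
      then show ?thesis by (simp add: fun_eq_iff smul_apply algebra_simps)
    qed
    have v0Q2: "v0 \<in> ?Q2" using sub by auto
    have db: "d - b = 0"
    proof (rule ccontr)
      assume n: "d - b \<noteq> 0"
      have "(d - b) \<odot> w \<in> ?Q2" unfolding eq using Q2(1) v0Q2 sub(3) by (simp add: fds_closed)
      then have "(1 / (d - b)) \<odot> ((d - b) \<odot> w) \<in> ?Q2" by (rule fs.span_scale)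
      then show False using n w(2) by simp
    qed
    have cb: "c + \<beta> = 0"
    proof (rule ccontr)
      assume n: "c + \<beta> \<noteq> 0"
      have "(c + \<beta>) \<odot> w1 = (a - \<alpha>) \<odot> v0" using eq db by simp
      moreover have "v0 \<in> ?Q1" using sub by auto
      ultimately have "(c + \<beta>) \<odot> w1 \<in> ?Q1" using fs.span_scale by metis
      then have "(1 / (c + \<beta>)) \<odot> ((c + \<beta>) \<odot> w1) \<in> ?Q1" by (rule fs.span_scale)
      then show False using n w1(2) by simp
    qed
    have "c = - \<beta>" using cb by (simp add: eq_neg_iff_add_eq_0)
    moreover have "H w - ?h = (H w - H w1) + (H w1 - H v0) - \<alpha> \<odot> v0" by simp
    ultimately have "H w - ?h = d \<odot> w" unfolding c ab by (simp add: fun_eq_iff smul_apply)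
    then have "N (H w - ?h, w) = 0" using aS[OF N] by (simp add: alt_simps)
    then have "N (H w, w) = N (?h, w)" using lin_diff[OF alt_lin1[OF aS[OF N]]] by simp
    then show ?thesis using H(2)[OF w(1) wQ(1) N] lin_diff[OF alt_lin1[OF aS[OF N]]] by simp
  qed
  have "N (e, v) = N (?h, v)" if N: "N \<in> S" and v: "v \<in> C" for N v
  proof -
    have "N (e - ?h, v) = 0"
      by (rule lin_zero_off_subspace[OF alt_lin2[OF aS[OF N]] fs.subspace_span fC z]) (use off N v in auto)
    then show ?thesis using lin_diff[OF alt_lin1[OF aS[OF N]]] by simp
  qed
  then show ?thesis using hC by blast
qed

text \<open>No nonzero vector of the span is annihilated by all \<open>N (a, \<cdot>)\<close>, so
  evaluation at \<open>a\<close> maps \<open>S\<close> onto the dual of the span. The proof builds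
  forms dual to \<open>B\<close> and combines them.\<close>

lemma dual_forms_exist:
  assumes "fds S" "finite B" "\<not> fs.dependent B"
    "\<And>v. v \<in> fs.span B \<Longrightarrow> (\<And>N. N \<in> S \<Longrightarrow> N (a, v) = 0) \<Longrightarrow> v = 0"
    "\<And>N. N \<in> S \<Longrightarrow> alt N" "lin g"
  obtains N where "N \<in> S" "\<forall>v\<in>fs.span B. N (a, v) = g v"
proof -
  have "\<exists>N\<in>S. N (a, b) = 1 \<and> (\<forall>c\<in>B - {b}. N (a, c) = 0)" if b: "b \<in> B" for b
  proof -
    have "\<exists>N\<in>S. N (a, b) \<noteq> 0 \<and> (\<forall>c\<in>B - {b}. N (a, c) = 0)"
    proof (rule ccontr)
      assume n: "\<not> ?thesis"
      have "\<exists>k. \<forall>N\<in>S. N (a, b) = (\<Sum>c\<in>B - {b}. k c * N (a, c))"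
        by (rule lin_kernel_combination[OF _ lin_eval lin_eval fds_subspace[OF assms(1)]]) (use n assms(2) in auto)
      then obtain k where k: "\<And>N. N \<in> S \<Longrightarrow> N (a, b) = (\<Sum>c\<in>B - {b}. k c * N (a, c))" by blast
      let ?s = "\<Sum>c\<in>B - {b}. k c \<odot> c"
      have s: "?s \<in> fs.span (B - {b})" by (intro fs.span_sum fs.span_scale fs.span_base)
      have "b - ?s = 0"
      proof (rule assms(4))
        show "b - ?s \<in> fs.span B"
          using fs.span_diff[OF fs.span_base[OF b] subsetD[OF fs.span_mono[of "B - {b}" B] s]] by blast
        fix N assume N: "N \<in> S"
        have "N (a, ?s) = (\<Sum>c\<in>B - {b}. k c * N (a, c))"
          using assms(5)[OF N] by (simp add: alt_sum2 alt_simps)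
        then show "N (a, b - ?s) = 0" using k[OF N] lin_diff[OF alt_lin2[OF assms(5)[OF N]]] by simp
      qed
      then have "b \<in> fs.span (B - {b})" using s by simp
      then show False using assms(3) b unfolding fs.dependent_def by blast
    qed
    then obtain N where N: "N \<in> S" "N (a, b) \<noteq> 0" "\<forall>c\<in>B - {b}. N (a, c) = 0" by blast
    let ?N = "(1 / N (a, b)) \<odot> N"
    have "?N \<in> S" "?N (a, b) = 1" "\<forall>c\<in>B - {b}. ?N (a, c) = 0"
      using N fds_smul[OF assms(1)] by (auto simp: smul_apply)
    then show ?thesis by blast
  qed
  then obtain M where M: "\<And>b. b \<in> B \<Longrightarrow> M b \<in> S" "\<And>b. b \<in> B \<Longrightarrow> M b (a, b) = 1"
    "\<And>b c. b \<in> B \<Longrightarrow> c \<in> B - {b} \<Longrightarrow> M b (a, c) = 0" by metis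
  let ?N = "\<Sum>b\<in>B. g b \<odot> M b"
  have N: "?N \<in> S" using M(1) assms(1) by (intro fds_sum) (auto intro: fds_smul)
  have aN: "alt ?N" by (rule assms(5)[OF N])
  have ev: "?N (a, c) = g c" if c: "c \<in> B" for c
  proof -
    have "?N (a, c) = (\<Sum>b\<in>B. g b * M b (a, c))"
      using lin_sum[OF lin_eval[of "(a, c)"], of "\<lambda>b. g b \<odot> M b" B] by (simp add: smul_apply)
    also have "\<dots> = (\<Sum>b\<in>B. if b = c then g c else 0)"
      using M(2,3) c by (intro sum.cong) auto
    finally show ?thesis using assms(2) c by simp
  qed
  have "?N (a, v) = g v" if v: "v \<in> fs.span B" for v
  proof -
    have "lin (\<lambda>v. ?N (a, v) - g v)" by (rule lin_minus[OF alt_lin2[OF aN] assms(6)])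
    then have "?N (a, v) - g v = 0" by (rule lin_zero_on_span[where B = B]) (use ev v in auto)
    then show ?thesis by simp
  qed
  then show thesis using that[OF N] by blast
qed

text \<open>The missing wedge \<open>f \<and> g\<close> means that the forms of \<open>S\<close>
  vanishing on the kernel \<open>?B\<close> of \<open>f\<close> all miss some nonzero vectors,
  collected in \<open>?Q\<close>. On these forms, \<open>N (e, \<cdot>)\<close> is a constant
  multiple \<open>l\<close> of \<open>N (a, \<cdot>)\<close> on \<open>?B\<close>; after replacing
  \<open>e\<close> by \<open>e - l \<odot> a\<close> the hypotheses hold again on \<open>?B\<close>,
  with \<open>?Q\<close> added to the exceptional subspace.\<close>

lemma range_compat_hyperplane:
  assumes fS: "fds S" and aS: "\<And>N. N \<in> S \<Longrightarrow> alt N" and fC: "fds C" and fQ: "fds Q" and QC: "Q \<subseteq> C"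
    and compat: "\<And>N v. N \<in> S \<Longrightarrow> v \<in> C \<Longrightarrow> v \<notin> Q \<Longrightarrow> (\<And>w. w \<in> C \<Longrightarrow> N (v, w) = 0) \<Longrightarrow> N (e, v) = 0"
    and big: "(fs.dim C choose 2) + 3 + fs.dim Q \<le> delta S (C \<times> C) + fs.dim C"
    and f: "lin f" "q1 \<in> Q" "f q1 \<noteq> 0" and g: "lin g" "\<not> wedge_in S C f g"
    and IH: "\<And>Q' e'. fds Q' \<Longrightarrow> Q' \<subseteq> hyp C f \<Longrightarrow> 1 \<le> fs.dim Q' \<Longrightarrow>
      (\<And>N v. N \<in> S \<Longrightarrow> v \<in> hyp C f \<Longrightarrow> v \<notin> Q' \<Longrightarrow> (\<And>w. w \<in> hyp C f \<Longrightarrow> N (v, w) = 0) \<Longrightarrow> N (e', v) = 0) \<Longrightarrow>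
      (fs.dim (hyp C f) choose 2) + 3 + fs.dim Q' \<le> delta S (hyp C f \<times> hyp C f) + fs.dim (hyp C f) \<Longrightarrow>
      \<exists>h\<in>hyp C f. \<forall>N\<in>S. \<forall>v\<in>hyp C f. N (e', v) = N (h, v)"
  shows "\<exists>h\<in>C. \<forall>N\<in>S. \<forall>v\<in>hyp C f. N (e, v) = N (h, v)"
proof -
  let ?B = "hyp C f"
  have "(1 / f q1) \<odot> q1 \<in> Q" "f ((1 / f q1) \<odot> q1) = 1" using f fds_smul[OF fQ] by (auto simp: lin_simps)
  then obtain a where a: "a \<in> Q" "a \<in> C" "f a = 1" using QC by blast
  have B: "fds ?B" "?B \<subseteq> C" by (rule fds_hyp[OF fC f(1)]) (rule hyp_subset)
  have dB: "fs.dim C = fs.dim ?B + 1" using dim_hyp[OF fC f(1) a(2)] a(3) by simp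
  let ?S = "S \<inter> van (?B \<times> ?B)"
  have fSB: "fds ?S" by (rule fds_van(1)[OF fS])
  have aSB: "\<And>N. N \<in> ?S \<Longrightarrow> alt N" using aS by blast
  have form: "N (x, y) = f x * N (a, y) - f y * N (a, x)" if "N \<in> ?S" "x \<in> C" "y \<in> C" for N x y
    using van_hyp_eq[OF aSB[OF that(1)] f(1) fC a(2,3) _ that(2,3)] that(1) by blast
  let ?Q = "{v \<in> ?B. \<forall>N\<in>?S. N (a, v) = 0}"
  have "fs.subspace ?Q"
    unfolding fs.subspace_def
  proof (intro conjI allI ballI)
    show "0 \<in> ?Q" using fds_0[OF B(1)] lin_zero[OF alt_lin2[OF aSB]] by blast
    show "x + y \<in> ?Q" if "x \<in> ?Q" "y \<in> ?Q" for x y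
    proof -
      have "N (a, x + y) = 0" if N: "N \<in> ?S" for N
      proof -
        have "N (a, x) = 0" "N (a, y) = 0" using \<open>x \<in> ?Q\<close> \<open>y \<in> ?Q\<close> N by auto
        then show ?thesis using lin_add[OF alt_lin2[OF aSB[OF N]]] by simp
      qed
      moreover have "x + y \<in> ?B" using that fds_add[OF B(1)] by simp
      ultimately show ?thesis by blast
    qed
    show "c \<odot> x \<in> ?Q" if "x \<in> ?Q" for x c
    proof -
      have "N (a, c \<odot> x) = 0" if N: "N \<in> ?S" for N
      proof -
        have "N (a, x) = 0" using \<open>x \<in> ?Q\<close> N by auto
        then show ?thesis using lin_smul[OF alt_lin2[OF aSB[OF N]]] by simp
      qed
      moreover have "c \<odot> x \<in> ?B" using that fds_smul[OF B(1)] by simp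
      ultimately show ?thesis by blast
    qed
  qed
  then have Q': "fds ?Q" using fds_subset(1)[OF B(1)] by blast
  have Q'B: "?Q \<subseteq> ?B" by blast
  \<comment> \<open>Otherwise the functionals \<open>N (a, \<cdot>)\<close> would be arbitrary on
    \<open>?B\<close>, and \<open>f \<and> g\<close> would be among the forms.\<close>
  have "?Q \<noteq> {0}"
  proof
    assume z: "?Q = {0}"
    obtain Y where Y: "finite Y" "\<not> fs.dependent Y" "fs.span Y = ?B" "card Y = fs.dim ?B"
      using fds_basis[OF B(1)] by metis
    have inj: "v = 0" if "v \<in> fs.span Y" "\<And>N. N \<in> ?S \<Longrightarrow> N (a, v) = 0" for v
    proof -
      have "v \<in> ?Q" using that Y(3) by blast
      then show ?thesis using z by blast
    qed
    obtain N where N: "N \<in> ?S" "\<forall>v\<in>fs.span Y. N (a, v) = g v"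
      by (rule dual_forms_exist[OF fSB Y(1,2) inj aSB g(1)])
    have ev: "N (a, y) = g y - f y * g a" if y: "y \<in> C" for y
    proof -
      have "N (a, y - f y \<odot> a) = g (y - f y \<odot> a)"
        by (rule N(2)[rule_format]) (use hyp_decompose[OF fC f(1) a(2,3) y] Y(3) in simp)
      moreover have "N (a, y - f y \<odot> a) = N (a, y)"
        using lin_diff[OF alt_lin2[OF aSB[OF N(1)]]] lin_smul[OF alt_lin2[OF aSB[OF N(1)]]] alt_self[OF aSB[OF N(1)], of a] by simp
      ultimately show ?thesis using g(1) by (simp only: lin_diff lin_smul)
    qed
    have "N (x, y) = f x * g y - f y * g x" if "x \<in> C" "y \<in> C" for x y
      using form[OF N(1) that] ev that by (simp add: algebra_simps)
    then have "wedge_in S C f g" using N(1) unfolding wedge_in_def by blast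
    then show False using g(2) by blast
  qed
  then have dQ': "1 \<le> fs.dim ?Q" using fds_dim_0[OF Q'] by (cases "fs.dim ?Q") auto
  have dS: "delta ?S (C \<times> C) + fs.dim ?Q \<le> fs.dim ?B"
  proof -
    obtain X where X: "fds X" "X \<subseteq> ?B" "fs.dim ?Q + fs.dim X = fs.dim ?B" "?Q \<inter> X = {0}"
      "\<forall>v\<in>?B. \<exists>w\<in>?Q. \<exists>c\<in>X. v = w + c" by (rule fds_complement[OF B(1) fds_subspace[OF Q'] Q'B])
    obtain Y where Y: "finite Y" "\<not> fs.dependent Y" "fs.span Y = X" "card Y = fs.dim X"
      using fds_basis[OF X(1)] by metis
    have "delta ?S (C \<times> C) \<le> card (Pair a ` Y)"
    proof (rule delta_le_card[OF fSB])
      fix N assume N: "N \<in> ?S" "N \<in> van (Pair a ` Y)"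
      have aN: "alt N" by (rule aSB[OF N(1)])
      have aX: "N (a, x) = 0" if "x \<in> X" for x
        by (rule alt_zero_span2[OF aN, of Y]) (use N(2) that Y in \<open>auto simp: in_van\<close>)
      have aB: "N (a, v) = 0" if v: "v \<in> ?B" for v
      proof -
        obtain w c where wc: "w \<in> ?Q" "c \<in> X" "v = w + c" using X(5) v by blast
        have "N (a, w) = 0" using wc(1) N(1) by blast
        then show ?thesis using aX[OF wc(2)] unfolding wc(3) lin_add[OF alt_lin2[OF aN]] by simp
      qed
      have aC: "N (a, y) = 0" if y: "y \<in> C" for y
      proof -
        have "N (a, y - f y \<odot> a) = 0" by (rule aB[OF hyp_decompose[OF fC f(1) a(2,3) y]])
        then show ?thesis using lin_diff[OF alt_lin2[OF aN]] lin_smul[OF alt_lin2[OF aN]] alt_self[OF aN, of a] by simp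
      qed
      show "N \<in> van (C \<times> C)" using form[OF N(1)] aC by (auto simp: in_van)
    qed (use Y in auto)
    then show ?thesis using card_image_le[OF Y(1), of "Pair a"] Y(4) X(3) by simp
  qed
  let ?QB = "ssum (Q \<inter> ?B) ?Q"
  have QiB: "fds (Q \<inter> ?B)" using fds_Int[OF fQ fds_subspace[OF B(1)]] .
  have QB: "fds ?QB" "fs.dim ?QB \<le> fs.dim (Q \<inter> ?B) + fs.dim ?Q" using fds_ssum[OF QiB Q'] by auto
  have QBB: "?QB \<subseteq> ?B" by (rule ssum_subset[OF B(1)]) auto
  have Qsub: "Q \<inter> ?B \<subseteq> ?QB" "?Q \<subseteq> ?QB" using ssum_superset[OF QiB Q'] by auto
  have "Q \<inter> ?B = hyp Q f" using QC by (auto simp: hyp_def)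
  then have dQB: "fs.dim Q = fs.dim (Q \<inter> ?B) + 1" using dim_hyp[OF fQ f(1) f(2,3)] by simp
  have d1: "1 \<le> fs.dim ?QB" using fds_dim_mono[OF QB(1) Q' Qsub(2)] dQ' by linarith
  have ch: "(fs.dim C choose 2) = (fs.dim ?B choose 2) + fs.dim ?B" using choose_two_Suc[of "fs.dim ?B"] dB by simp
  have "delta S (C \<times> C) = delta S (?B \<times> ?B) + delta ?S (C \<times> C)" by (rule delta_split[OF fS]) (use B(2) in blast)
  \<comment> \<open>Restriction to \<open>?B\<close> loses at most \<open>dim ?B - dim ?Q\<close>.
    The exceptional subspace gains at most \<open>dim ?Q\<close> but loses one dimension of
    \<open>Q\<close>, as \<open>q1\<close> is not in \<open>?B\<close>; so the inequality
    survives.\<close>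
  then have bigB: "(fs.dim ?B choose 2) + 3 + fs.dim ?QB \<le> delta S (?B \<times> ?B) + fs.dim ?B"
    using big dS QB(2) dQB ch dB by linarith
  then have dimB: "fs.dim ?QB + 3 \<le> fs.dim ?B" using delta_square[OF fS aS B(1)] by linarith
  have CB: "N (v, w) = 0" if N: "alt N" and v: "\<And>w. w \<in> ?B \<Longrightarrow> N (v, w) = 0" "N (v, a) = 0" and w: "w \<in> C" for N v w
  proof -
    have "N (v, w - f w \<odot> a) = 0" by (rule v(1)[OF hyp_decompose[OF fC f(1) a(2,3) w]])
    then show ?thesis using v(2) lin_diff[OF alt_lin2[OF N]] lin_smul[OF alt_lin2[OF N]] by simp
  qed
  \<comment> \<open>A form of \<open>?S\<close> with \<open>N (a, v) = 0\<close> has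
    \<open>v\<close> in its radical on \<open>C\<close>, so \<open>compat\<close> applies. The
    factor still depends on \<open>v\<close>; this is removed next by additivity.\<close>
  have lam: "\<exists>l. \<forall>N\<in>?S. N (e, v) = l * N (a, v)" if v: "v \<in> ?B" "v \<notin> ?QB" for v
  proof -
    have "\<exists>l. \<forall>N\<in>?S. N (e, v) = (\<Sum>i\<in>{a}. l i * N (i, v))"
    proof (rule lin_kernel_combination[OF _ lin_eval lin_eval fds_subspace[OF fSB]])
      fix N assume N: "N \<in> ?S" "\<And>i. i \<in> {a} \<Longrightarrow> N (i, v) = 0"
      have aN: "alt N" by (rule aSB[OF N(1)])
      have "v \<notin> Q" "v \<in> C" using v Qsub B(2) by auto
      moreover have "N (v, w) = 0" if "w \<in> C" for w
      proof (rule CB[OF aN _ _ that])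
        show "N (v, w) = 0" if "w \<in> ?B" for w using N(1) v(1) that by (auto simp: in_van)
        show "N (v, a) = 0" using N(2)[of a] alt_zero_swap[OF aN, of v a] by simp
      qed
      ultimately show "N (e, v) = 0" using compat N(1) by blast
    qed auto
    then show ?thesis by auto
  qed
  obtain v1 where v1: "v1 \<in> ?B" "v1 \<notin> ?QB" using fds_proper[OF B(1) QB(1)] dimB by auto
  obtain l where l: "\<And>N. N \<in> ?S \<Longrightarrow> N (e, v1) = l * N (a, v1)" using lam[OF v1] by blast
  let ?T = "fs.span (insert v1 ?QB)"
  have T: "fds ?T" "fs.dim ?T \<le> fs.dim ?QB + 1" using fds_insert_le[OF QB(1)] by auto
  obtain z where z: "z \<in> ?B" "z \<notin> ?T" using fds_proper[OF B(1) T(1)] T(2) dimB by auto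
  have off: "N (e - l \<odot> a, w) = 0" if N: "N \<in> ?S" and w: "w \<in> ?B" "w \<notin> ?T" for N w
  proof -
    have wQ: "w \<notin> ?QB" using w(2) fs.span_superset[of "insert v1 ?QB"] by blast
    have vw: "v1 + w \<in> ?B" using v1(1) w(1) fds_add[OF B(1)] by blast
    have vwQ: "v1 + w \<notin> ?QB"
    proof
      assume "v1 + w \<in> ?QB"
      then have "(v1 + w) - v1 \<in> ?T" by (intro fs.span_diff fs.span_base) auto
      then show False using w(2) by simp
    qed
    obtain m where m: "\<And>N. N \<in> ?S \<Longrightarrow> N (e, w) = m * N (a, w)" using lam[OF w(1) wQ] by blast
    obtain k where k: "\<And>N. N \<in> ?S \<Longrightarrow> N (e, v1 + w) = k * N (a, v1 + w)" using lam[OF vw vwQ] by blast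
    let ?r = "(k - l) \<odot> v1 + (k - m) \<odot> w"
    have rB: "?r \<in> ?B" using v1(1) w(1) B(1) by (simp add: fds_closed)
    have "N (a, ?r) = 0" if N: "N \<in> ?S" for N
    proof -
      have aN: "alt N" by (rule aSB[OF N])
      have "N (e, v1) + N (e, w) = k * (N (a, v1) + N (a, w))"
        using k[OF N] lin_add[OF alt_lin2[OF aN]] by metis
      then have "(k - l) * N (a, v1) + (k - m) * N (a, w) = 0" using l[OF N] m[OF N] by (simp add: algebra_simps)
      then show ?thesis using lin_add[OF alt_lin2[OF aN]] lin_smul[OF alt_lin2[OF aN]] by simp
    qed
    then have rQ: "?r \<in> ?QB" using rB Qsub(2) by blast
    have km: "k - m = 0"
    proof (rule ccontr)
      assume n: "k - m \<noteq> 0"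
      have "?r - (k - l) \<odot> v1 \<in> ?T" using rQ by (intro fs.span_diff fs.span_scale fs.span_base) auto
      then have "(k - m) \<odot> w \<in> ?T" by simp
      then have "(1 / (k - m)) \<odot> ((k - m) \<odot> w) \<in> ?T" by (rule fs.span_scale)
      then show False using n w(2) by simp
    qed
    have "k - l = 0"
    proof (rule ccontr)
      assume n: "k - l \<noteq> 0"
      have "(k - l) \<odot> v1 \<in> ?QB" using rQ km by simp
      then have "(1 / (k - l)) \<odot> ((k - l) \<odot> v1) \<in> ?QB" by (rule fds_smul[OF QB(1)])
      then show False using n v1(2) by simp
    qed
    then have "N (e, w) = l * N (a, w)" using m[OF N] km by simp
    then show ?thesis using lin_diff[OF alt_lin1[OF aSB[OF N]]] lin_smul[OF alt_lin1[OF aSB[OF N]]] by simp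
  qed
  have all: "N (e, v) = l * N (a, v)" if N: "N \<in> ?S" and v: "v \<in> ?B" for N v
  proof -
    have "N (e - l \<odot> a, v) = 0"
      by (rule lin_zero_off_subspace[OF alt_lin2[OF aSB[OF N]] fs.subspace_span B(1) z]) (use off N v in auto)
    then show ?thesis using lin_diff[OF alt_lin1[OF aSB[OF N]]] lin_smul[OF alt_lin1[OF aSB[OF N]]] by simp
  qed
  have "\<exists>h\<in>?B. \<forall>N\<in>S. \<forall>v\<in>?B. N (e - l \<odot> a, v) = N (h, v)"
  proof (rule IH[OF QB(1) QBB d1 _ bigB])
    fix N v assume N: "N \<in> S" and v: "v \<in> ?B" "v \<notin> ?QB" and Nv: "\<And>w. w \<in> ?B \<Longrightarrow> N (v, w) = 0"
    have "v \<notin> ?Q" using v(2) Qsub(2) by blast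
    then obtain N1 where N1: "N1 \<in> ?S" "N1 (a, v) \<noteq> 0" using v(1) by blast
    \<comment> \<open>Subtracting this multiple of \<open>N1\<close> makes \<open>v\<close>
      orthogonal to \<open>a\<close> without changing values on \<open>?B\<close>, so that
      \<open>v\<close> is radical on all of \<open>C\<close> and \<open>compat\<close> applies to
      the difference.\<close>
    let ?c = "N (a, v) / N1 (a, v)"
    let ?N = "N - ?c \<odot> N1"
    have NS: "?N \<in> S" using N N1(1) fS by (auto intro!: fds_diff fds_smul)
    have aN: "alt ?N" by (rule aS[OF NS])
    have ev: "?N p = N p - ?c * N1 p" for p by (simp add: smul_apply)
    have "?N (a, v) = 0" unfolding ev using N1(2) by simp
    then have va: "?N (v, a) = 0" using alt_zero_swap[OF aN, of v a] by blast
    have "?N (v, w) = 0" if "w \<in> C" for w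
    proof (rule CB[OF aN _ va that])
      fix w assume w: "w \<in> ?B"
      have "N1 (v, w) = 0" using N1(1) v(1) w by (auto simp: in_van)
      then show "?N (v, w) = 0" unfolding ev using Nv[OF w] by simp
    qed
    moreover have "v \<notin> Q" "v \<in> C" using v Qsub B(2) by auto
    ultimately have "?N (e, v) = 0" using compat[OF NS] by blast
    then have "N (e, v) = ?c * N1 (e, v)" unfolding ev by simp
    also have "\<dots> = ?c * (l * N1 (a, v))" using all[OF N1(1) v(1)] by simp
    also have "\<dots> = l * N (a, v)" using N1(2) by simp
    finally show "N (e - l \<odot> a, v) = 0" using lin_diff[OF alt_lin1[OF aS[OF N]]] lin_smul[OF alt_lin1[OF aS[OF N]]] by simp
  qed
  then obtain h where h: "h \<in> ?B" "\<And>N v. N \<in> S \<Longrightarrow> v \<in> ?B \<Longrightarrow> N (e - l \<odot> a, v) = N (h, v)" by blast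
  have "N (e, v) = N (l \<odot> a + h, v)" if N: "N \<in> S" and v: "v \<in> ?B" for N v
    using h(2)[OF N v] lin_add[OF alt_lin1[OF aS[OF N]]] lin_diff[OF alt_lin1[OF aS[OF N]], of e "l \<odot> a"]
    by (simp add: algebra_simps)
  moreover have "l \<odot> a + h \<in> C" using h(1) B(2) a(2) fC by (auto intro!: fds_add fds_smul)
  ultimately show ?thesis by blast
qed


lemma choose_two_mono: "m \<le> n \<Longrightarrow> (m choose 2) \<le> (n choose 2)"
  by (rule lift_Suc_mono_le[of "\<lambda>n. n choose 2"]) (simp add: choose_two_Suc)

text \<open>Induction on \<open>dim C\<close>. If some \<open>f \<and> g\<close> is missing from \<open>S\<close>, there are two different hyperplanes
  \<open>ker f\<close> to which the induction applies, at the price of an enlarged exceptional subspace \<open>Q\<close>;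
  the two local vectors agree, since otherwise \<open>S\<close> would be too small.\<close>

lemma range_compat_local:
  assumes fS: "fds S" and aS: "\<And>N. N \<in> S \<Longrightarrow> alt N"
  shows "fds C \<Longrightarrow> fds Q \<Longrightarrow> Q \<subseteq> C \<Longrightarrow> 1 \<le> fs.dim Q \<Longrightarrow>
    (\<And>N v. N \<in> S \<Longrightarrow> v \<in> C \<Longrightarrow> v \<notin> Q \<Longrightarrow> (\<And>w. w \<in> C \<Longrightarrow> N (v, w) = 0) \<Longrightarrow> N (e, v) = 0) \<Longrightarrow>
    (fs.dim C choose 2) + 3 + fs.dim Q \<le> delta S (C \<times> C) + fs.dim C \<Longrightarrow>
    \<exists>h\<in>C. \<forall>N\<in>S. \<forall>v\<in>C. N (e, v) = N (h, v)"
proof (induction "fs.dim C" arbitrary: C Q e rule: less_induct)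
  case less
  note fC = less.prems(1) and fQ = less.prems(2) and QC = less.prems(3) and compat = less.prems(5) and big = less.prems(6)
  have dim: "fs.dim Q + 3 \<le> fs.dim C" using big delta_square[OF fS aS fC] by linarith
  show ?case
  proof (cases "\<forall>f g. lin f \<longrightarrow> lin g \<longrightarrow> wedge_in S C f g")
    case True
    show ?thesis
    proof (rule range_compat_full[OF fS aS fC fQ QC dim])
      show "N (e, v) = 0" if "N \<in> S" "v \<in> C" "v \<notin> Q" "\<And>w. w \<in> C \<Longrightarrow> N (v, w) = 0" for N v
        by (rule compat[OF that])
      show "wedge_in S C f g" if "lin f" "lin g" for f g using True that by blast
    qed
  next
    case False
    let ?Z = "\<lambda>f. \<forall>g. lin g \<longrightarrow> wedge_in S C f g"
    have Zdiff: "?Z (\<lambda>x. f x - f' x)" if "?Z f" "?Z f'" for f f' using wedge_in_diff[OF fS] that by blast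
    obtain f0 where f0: "lin f0" "\<not> ?Z f0" using False by blast
    obtain q1 where q1: "q1 \<in> Q" "q1 \<noteq> 0"
    proof -
      have "Q \<noteq> {0}" using less.prems(4) fds_dim_0[OF fQ] by auto
      then show thesis using that fds_0[OF fQ] by blast
    qed
    obtain f' where f': "lin f'" "f' q1 = 1"
    proof -
      have "q1 \<notin> {0}" using q1 by simp
      then show thesis using lin_separate[OF fds_subspace[OF dim_0(1)]] that by metis
    qed
    \<comment> \<open>Functionals all of whose wedges lie in \<open>S\<close> are closed under
      differences, so one of \<open>f0\<close>, \<open>f'\<close>, \<open>f' - f0\<close> is nonzero
      at \<open>q1\<close> and still misses a wedge.\<close>
    obtain f1 where f1: "lin f1" "\<not> ?Z f1" "f1 q1 \<noteq> 0"
    proof (cases "f0 q1 = 0 \<and> ?Z f'")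
      case True
      have "\<not> ?Z (\<lambda>x. f' x - f0 x)"
      proof
        assume "?Z (\<lambda>x. f' x - f0 x)"
        then have "?Z (\<lambda>x. f' x - (f' x - f0 x))" using Zdiff[of f' "\<lambda>x. f' x - f0 x"] True by blast
        then show False using f0(2) by simp
      qed
      then show thesis using that[of "\<lambda>x. f' x - f0 x"] lin_minus[OF f'(1) f0(1)] True f'(2) by simp
    next
      case False
      then show thesis using that[of f0] that[of f'] f0 f' by fastforce
    qed
    obtain x1 where x1: "x1 \<in> C" "x1 \<notin> Q" using fds_proper[OF fC fQ] dim by auto
    obtain x2 where x2: "x2 \<in> C" "x2 \<notin> fs.span (insert x1 Q)"
      using fds_proper[OF fC, of "fs.span (insert x1 Q)"] fds_insert_le[OF fQ, of x1] dim by auto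
    obtain y1 where y1: "lin y1" "y1 x1 = 1" "\<And>v. v \<in> Q \<Longrightarrow> y1 v = 0"
      using lin_separate[OF fds_subspace[OF fQ] x1(2)] by metis
    obtain y2 where y2: "lin y2" "y2 x2 = 1" "\<And>v. v \<in> fs.span (insert x1 Q) \<Longrightarrow> y2 v = 0"
      using lin_separate[OF fs.subspace_span x2(2)] by metis
    have y2': "y2 x1 = 0" "\<And>v. v \<in> Q \<Longrightarrow> y2 v = 0" using y2(3) fs.span_base[of _ "insert x1 Q"] by auto
    \<comment> \<open>A second hyperplane, the kernel of \<open>f1 - y\<close>, still avoiding
      \<open>q1\<close> because \<open>y\<close> vanishes on \<open>Q\<close>. If \<open>y1\<close>,
      \<open>y2\<close> and \<open>y2 - y1\<close> all failed, closure under differences would give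
      \<open>?Z f1\<close>.\<close>
    obtain y x0 where y: "lin y" "y q1 = 0" "x0 \<in> C" "y x0 \<noteq> 0" "\<not> ?Z (\<lambda>x. f1 x - y x)"
    proof -
      consider "\<not> ?Z (\<lambda>x. f1 x - y1 x)" | "\<not> ?Z (\<lambda>x. f1 x - y2 x)" | "\<not> ?Z (\<lambda>x. f1 x - (y2 x - y1 x))"
      proof -
        have "?Z f1" if "?Z (\<lambda>x. f1 x - y1 x)" "?Z (\<lambda>x. f1 x - y2 x)" "?Z (\<lambda>x. f1 x - (y2 x - y1 x))"
        proof -
          have "?Z (\<lambda>x. (f1 x - y1 x) - (f1 x - y2 x))" using Zdiff[of "\<lambda>x. f1 x - y1 x" "\<lambda>x. f1 x - y2 x"] that by blast
          moreover have "(\<lambda>x. (f1 x - y1 x) - (f1 x - y2 x)) = (\<lambda>x. y2 x - y1 x)" by auto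
          ultimately have a: "?Z (\<lambda>x. y2 x - y1 x)" by simp
          have "wedge_in S C (\<lambda>x. 0 * y1 x) g" for g
            unfolding wedge_in_def using fds_0[OF fS] by (intro bexI[of _ 0]) auto
          then have z: "?Z (\<lambda>x. 0)" by simp
          have "?Z (\<lambda>x. 0 - (y2 x - y1 x))" using Zdiff[of "\<lambda>x. 0" "\<lambda>x. y2 x - y1 x"] a z by blast
          then have "?Z (\<lambda>x. (f1 x - (y2 x - y1 x)) - (0 - (y2 x - y1 x)))"
            using Zdiff[of "\<lambda>x. f1 x - (y2 x - y1 x)" "\<lambda>x. 0 - (y2 x - y1 x)"] that(3) by blast
          then show "?Z f1" by simp
        qed
        then show thesis using that f1(2) by blast
      qed
      then show thesis
      proof cases
        case 1 then show thesis using that[of y1 x1] y1 q1(1) x1(1) by simp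
      next
        case 2 then show thesis using that[of y2 x2] y2(1,2) y2' q1(1) x2(1) by simp
      next
        case 3 then show thesis
          using that[of "\<lambda>x. y2 x - y1 x" x1] lin_minus[OF y2(1) y1(1)] y1 y2' q1(1) x1(1) by simp
      qed
    qed
    let ?f2 = "\<lambda>x. f1 x - y x"
    have f2: "lin ?f2" "?f2 q1 \<noteq> 0" using lin_minus[OF f1(1) y(1)] f1(3) y(2) by auto
    have q1C: "q1 \<in> C" using q1 QC by blast
    have step: "\<exists>h\<in>C. \<forall>N\<in>S. \<forall>v\<in>hyp C f. N (e, v) = N (h, v)" if f: "lin f" "f q1 \<noteq> 0" "\<not> ?Z f" for f
    proof -
      obtain g where g: "lin g" "\<not> wedge_in S C f g" using f(3) by blast
      have B: "fds (hyp C f)" "fs.dim (hyp C f) < fs.dim C"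
        using fds_hyp[OF fC f(1)] dim_hyp[OF fC f(1) q1C f(2)] by auto
      show ?thesis
      proof (rule range_compat_hyperplane[where e = e, OF fS aS fC fQ QC _ big f(1) q1(1) f(2) g])
        show "N (e, v) = 0" if "N \<in> S" "v \<in> C" "v \<notin> Q" "\<And>w. w \<in> C \<Longrightarrow> N (v, w) = 0" for N v
          by (rule compat[OF that])
        fix Q' e'
        assume Q': "fds Q'" "Q' \<subseteq> hyp C f" "1 \<le> fs.dim Q'"
          and c: "\<And>N v. N \<in> S \<Longrightarrow> v \<in> hyp C f \<Longrightarrow> v \<notin> Q' \<Longrightarrow> (\<And>w. w \<in> hyp C f \<Longrightarrow> N (v, w) = 0) \<Longrightarrow> N (e', v) = 0"
          and b: "(fs.dim (hyp C f) choose 2) + 3 + fs.dim Q' \<le> delta S (hyp C f \<times> hyp C f) + fs.dim (hyp C f)"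
        show "\<exists>h\<in>hyp C f. \<forall>N\<in>S. \<forall>v\<in>hyp C f. N (e', v) = N (h, v)"
        proof (rule less.hyps[OF B(2,1) Q' _ b])
          show "N (e', v) = 0" if "N \<in> S" "v \<in> hyp C f" "v \<notin> Q'" "\<And>w. w \<in> hyp C f \<Longrightarrow> N (v, w) = 0" for N v
            by (rule c[OF that])
        qed
      qed
    qed
    obtain h1 where h1: "h1 \<in> C" "\<And>N v. N \<in> S \<Longrightarrow> v \<in> hyp C f1 \<Longrightarrow> N (e, v) = N (h1, v)"
      using step[OF f1(1,3,2)] by blast
    obtain h2 where h2: "h2 \<in> C" "\<And>N v. N \<in> S \<Longrightarrow> v \<in> hyp C ?f2 \<Longrightarrow> N (e, v) = N (h2, v)"
      using step[OF f2 y(5)] by blast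
    let ?B = "hyp C f1"
    have B: "fds ?B" "fs.dim C = fs.dim ?B + 1" "?B \<subseteq> C"
      using fds_hyp[OF fC f1(1)] dim_hyp[OF fC f1(1) q1C f1(3)] hyp_subset by auto
    let ?x = "x0 - (f1 x0 / f1 q1) \<odot> q1"
    have x: "?x \<in> ?B" "y ?x \<noteq> 0"
    proof -
      have "f1 ?x = 0" using lin_diff[OF f1(1)] lin_smul[OF f1(1)] f1(3) by simp
      moreover have "?x \<in> C" using y(3) q1C fC by (intro fds_diff fds_smul)
      ultimately show "?x \<in> ?B" by (simp add: hyp_def)
      show "y ?x \<noteq> 0" using lin_diff[OF y(1)] lin_smul[OF y(1)] y(2,4) by simp
    qed
    let ?B2 = "hyp ?B y"
    have B2: "fds ?B2" "fs.dim ?B = fs.dim ?B2 + 1" "?B2 \<subseteq> ?B"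
      using fds_hyp[OF B(1) y(1)] dim_hyp[where u = y, OF B(1) y(1) x] hyp_subset[of ?B y] by blast+
    \<comment> \<open>Both vectors represent \<open>N (e, \<cdot>)\<close> on \<open>?B2\<close>, of
      codimension two. If they differed, a form would be determined on \<open>C\<close> by its
      restriction to a complement of \<open>h1 - h2\<close> and two more values, giving
      \<open>delta\<close> at most \<open>(dim ?B choose 2) + 2\<close>, one less than
      assumed.\<close>
    have "h1 - h2 = 0"
    proof (rule ccontr)
      assume n: "h1 - h2 \<noteq> 0"
      let ?h = "h1 - h2"
      have hC: "?h \<in> C" using h1(1) h2(1) fds_diff[OF fC] by blast
      have hB2: "N (?h, v) = 0" if N: "N \<in> S" and v: "v \<in> ?B2" for N v
      proof -
        have "v \<in> hyp C f1" "v \<in> hyp C ?f2" using v by (auto simp: hyp_def)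
        then have "N (h1, v) = N (h2, v)" using h1(2)[OF N, of v] h2(2)[OF N, of v] by simp
        then show ?thesis using lin_diff[OF alt_lin1[OF aS[OF N]]] by simp
      qed
      obtain z1 where z1: "z1 \<in> ?B" "z1 \<notin> ?B2" "?B = fs.span (insert z1 ?B2)"
        using hyperplane_insert[OF B2(1,3) B(1) B2(2)] .
      obtain z2 where z2: "z2 \<in> C" "z2 \<notin> ?B" "C = fs.span (insert z2 ?B)"
        using hyperplane_insert[OF B(1,3) fC B(2)] .
      obtain X where X: "finite X" "card X + 1 = fs.dim C" "fs.span (insert ?h X) = C"
        by (rule finite_spanning_rest[OF fC hC n])
      let ?G = "fs.span X"
      have G: "fds ?G" "fs.dim ?G \<le> fs.dim ?B" using fds_span[OF X(1)] fs.dim_le_card'[OF X(1)] X(2) B(2) by auto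
      have "delta S (C \<times> C) \<le> delta S (?G \<times> ?G) + card {(?h, z1), (?h, z2)}"
      proof (rule delta_le[OF fS])
        fix N assume N: "N \<in> S" "N \<in> van {(?h, z1), (?h, z2)}" "N \<in> van (?G \<times> ?G)"
        have aN: "alt N" by (rule aS[OF N(1)])
        have "N (?h, v) = 0" if v: "v \<in> ?B" for v
          by (rule alt_zero_span2[OF aN, of "insert z1 ?B2"]) (use hB2[OF N(1)] N(2) v z1(3) in \<open>auto simp: in_van\<close>)
        then have hz: "N (?h, v) = 0" if v: "v \<in> C" for v
          using alt_zero_span2[OF aN, of "insert z2 ?B" ?h v] N(2) v z2(3) by (auto simp: in_van)
        have XX: "N (a, b) = 0" if "a \<in> X" "b \<in> X" for a b
          using N(3) that fs.span_base by (auto simp: in_van)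
        have XC: "X \<subseteq> C" using X(3) fs.span_superset[of "insert ?h X"] by auto
        have Xv: "N (a, v) = 0" if "a \<in> X" "v \<in> C" for a v
        proof (rule alt_zero_span2[OF aN, of "insert ?h X"])
          show "N (a, b) = 0" if "b \<in> insert ?h X" for b
          proof (cases "b = ?h")
            case True
            have "a \<in> C" using \<open>a \<in> X\<close> XC by blast
            then show ?thesis unfolding True using hz alt_zero_swap[OF aN, of a ?h] by blast
          next
            case False then show ?thesis using XX \<open>a \<in> X\<close> that by blast
          qed
          show "v \<in> fs.span (insert ?h X)" using X(3) \<open>v \<in> C\<close> by simp
        qed
        have "N (v, w) = 0" if "v \<in> C" "w \<in> C" for v w
        proof (rule alt_zero_span1[OF aN, of "insert ?h X"])
          show "N (b, w) = 0" if "b \<in> insert ?h X" for b using that hz Xv \<open>w \<in> C\<close> by auto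
          show "v \<in> fs.span (insert ?h X)" using X(3) that by simp
        qed
        then show "N \<in> van (C \<times> C)" by (auto simp: in_van)
      qed auto
      moreover have "card {(?h, z1), (?h, z2)} \<le> 2" by (auto simp: card_insert_if)
      moreover have "delta S (?G \<times> ?G) \<le> (fs.dim ?G choose 2)" by (rule delta_square[OF fS aS G(1)])
      moreover have "(fs.dim ?G choose 2) \<le> (fs.dim ?B choose 2)" by (rule choose_two_mono[OF G(2)])
      moreover have "(fs.dim C choose 2) = (fs.dim ?B choose 2) + fs.dim ?B" using choose_two_Suc[of "fs.dim ?B"] B(2) by simp
      ultimately show False using big less.prems(4) B(2) by linarith
    qed
    then have hh: "h2 = h1" by simp
    have fx: "f1 ?x = 0" using x(1) by (simp add: hyp_def)
    have "N (e, v) = N (h1, v)" if N: "N \<in> S" and v: "v \<in> C" for N v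
    proof -
      \<comment> \<open>In the second hyperplane but not in the first, so that the two together span
        \<open>C\<close>.\<close>
      obtain b where b: "b \<in> hyp C ?f2" "f1 b \<noteq> 0"
      proof -
        let ?b' = "q1 + (f1 q1 / y ?x) \<odot> ?x"
        have "?b' \<in> C" using q1C x(1) B(3) fC by (auto intro!: fds_add fds_smul)
        moreover have "f1 ?b' = f1 q1" using fx lin_add[OF f1(1), of q1] lin_smul[OF f1(1)] by simp
        moreover have "y ?b' = f1 q1" using x(2) y(2) lin_add[OF y(1), of q1] lin_smul[OF y(1), of _ ?x] by simp
        ultimately show thesis using that[of ?b'] f1(3) by (simp add: hyp_def)
      qed
      let ?v = "v - (f1 v / f1 b) \<odot> b"
      have "?v \<in> ?B" using v b fC f1(1) by (auto simp: hyp_def fds_closed lin_simps)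
      then have "N (e, ?v) = N (h1, ?v)" using h1(2)[OF N] by blast
      moreover have "N (e, b) = N (h1, b)" using h2(2)[OF N b(1)] hh by simp
      ultimately show ?thesis using lin_diff[OF alt_lin2[OF aS[OF N]]] lin_smul[OF alt_lin2[OF aS[OF N]]] by simp
    qed
    then show ?thesis using h1(1) by blast
  qed
qed

text \<open>As \<open>wd\<close> is 0, \<open>S\<close> on \<open>E\<close> is determined by a
  complement \<open>C\<close> of \<open>R\<close> in \<open>H\<close>, of dimension
  \<open>2 * s + 1\<close>. The rank bound makes \<open>N \<mapsto> N (e, \<cdot>)\<close>
  range-compatible, so it is given by one \<open>h\<close> in \<open>C\<close>, and
  \<open>e - h\<close> joins the radical.\<close>

lemma radical_lift:
  assumes fS: "fds S" and aS: "\<And>N. N \<in> S \<Longrightarrow> alt N" and fE: "fds E"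
    and rank: "\<And>N F. N \<in> S \<Longrightarrow> fds F \<Longrightarrow> F \<subseteq> E \<Longrightarrow> fs.dim F = 2 * s + 2 \<Longrightarrow> \<not> nondeg N F"
    and u: "lin u" "e \<in> E" "u e = 1" and R: "fds R" "R \<subseteq> hyp E u"
    and rad: "\<And>N x y. N \<in> S \<Longrightarrow> x \<in> R \<Longrightarrow> y \<in> hyp E u \<Longrightarrow> N (x, y) = 0"
    and dim: "fs.dim R + 2 * s + 2 = fs.dim E" and s: "1 \<le> s" and wd: "wd S E u = 0"
    and big: "((2 * s - 1) choose 2) + (fs.dim E - 1) < delta S (E \<times> E)"
  obtains R' where "fds R'" "R' \<subseteq> E" "fs.dim R' = fs.dim R + 1" "\<And>N x y. N \<in> S \<Longrightarrow> x \<in> R' \<Longrightarrow> y \<in> E \<Longrightarrow> N (x, y) = 0"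
proof -
  let ?H = "hyp E u"
  have H: "fds ?H" by (rule fds_hyp[OF fE u(1)])
  have HE: "?H \<subseteq> E" by (rule hyp_subset)
  have dH: "fs.dim E = fs.dim ?H + 1" using dim_hyp[OF fE u(1,2)] u(3) by simp
  obtain C where C: "fds C" "C \<subseteq> ?H" "fs.dim R + fs.dim C = fs.dim ?H" "R \<inter> C = {0}"
    "\<forall>v\<in>?H. \<exists>w\<in>R. \<exists>c\<in>C. v = w + c" by (rule fds_complement[OF H fds_subspace[OF R(1)] R(2)])
  have dC: "fs.dim C = 2 * s + 1" using C(3) dim dH by simp
  have CH: "N (v, y) = 0" if N: "N \<in> S" and v: "v \<in> ?H" "\<And>c. c \<in> C \<Longrightarrow> N (v, c) = 0" and y: "y \<in> ?H" for N v y
  proof -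
    obtain w c where wc: "w \<in> R" "c \<in> C" "y = w + c" using C(5) y by blast
    have "N (v, w) = 0" using rad[OF N wc(1) v(1)] alt_zero_swap[OF aS[OF N], of v w] by blast
    then show ?thesis unfolding wc(3) using v(2)[OF wc(2)] lin_add[OF alt_lin2[OF aS[OF N]]] by simp
  qed
  have dEC: "delta S (E \<times> E) \<le> delta S (C \<times> C)"
  proof -
    have "delta S (E \<times> E) = delta S (?H \<times> ?H)" using wd_delta[OF fS, of E u] wd by simp
    also have "\<dots> \<le> delta S (C \<times> C)"
    proof (rule delta_mono[OF fS])
      fix N assume N: "N \<in> S" "N \<in> van (C \<times> C)"
      have CC: "N (c, y) = 0" if "c \<in> C" "y \<in> ?H" for c y
        by (rule CH[OF N(1)]) (use that C(2) N(2) in \<open>auto simp: in_van\<close>)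
      have "N (x, y) = 0" if "x \<in> ?H" "y \<in> ?H" for x y
      proof (rule CH[OF N(1) that(1) _ that(2)])
        show "N (x, c) = 0" if "c \<in> C" for c
          using CC[OF that \<open>x \<in> ?H\<close>] alt_zero_swap[OF aS[OF N(1)], of x c] by blast
      qed
      then show "N \<in> van (?H \<times> ?H)" by (auto simp: in_van)
    qed
    finally show ?thesis .
  qed
  have ch: "(2 * s choose 2) = ((2 * s - 1) choose 2) + (2 * s - 1)" "((2 * s + 1) choose 2) = (2 * s choose 2) + 2 * s"
    using choose_two_Suc[of "2 * s - 1"] choose_two_Suc[of "2 * s"] s by simp_all
  have compat: "N (e, v) = 0" if N: "N \<in> S" and v: "v \<in> ?H" and Hv: "\<And>w. w \<in> ?H \<Longrightarrow> N (v, w) = 0" for N v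
  proof (rule ccontr)
    assume n: "N (e, v) \<noteq> 0"
    \<comment> \<open>The \<open>C\<close>-component of \<open>v\<close>, or any nonzero vector of
      \<open>C\<close> if \<open>v\<close> lies in \<open>R\<close>. In both cases a form of
      \<open>S\<close> with \<open>c1\<close> orthogonal to \<open>C'\<close> has \<open>v\<close>
      orthogonal to \<open>C'\<close> too.\<close>
    obtain c1 where c1: "c1 \<in> C" "c1 \<noteq> 0" "v \<in> R \<or> v - c1 \<in> R"
    proof (cases "v \<in> R")
      case True
      have "C \<noteq> {0}" using dC fds_dim_0[OF C(1)] by auto
      then show thesis using that True fds_0[OF C(1)] by blast
    next
      case False
      obtain w c where wc: "w \<in> R" "c \<in> C" "v = w + c" using C(5) v by blast
      then show thesis using that[of c] False by (cases "c = 0") auto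
    qed
    have spv: "fs.span {c1} \<subseteq> C" using fs.span_minimal[of "{c1}" C] c1(1) fds_subspace[OF C(1)] by auto
    obtain C' where C': "fds C'" "C' \<subseteq> C" "fs.dim (fs.span {c1}) + fs.dim C' = fs.dim C" "fs.span {c1} \<inter> C' = {0}"
      "\<forall>x\<in>C. \<exists>w\<in>fs.span {c1}. \<exists>c\<in>C'. x = w + c" by (rule fds_complement[OF C(1) fs.subspace_span spv])
    have dC': "fs.dim C' = 2 * s"
      using C'(3) dC fs.dim_span_eq_card_independent[of "{c1}"] c1(2) by simp
    obtain X where X: "finite X" "\<not> fs.dependent X" "fs.span X = C'" "card X = fs.dim C'"
      using fds_basis[OF C'(1)] by metis
    let ?P = "insert (e, v) (Pair c1 ` X)"
    let ?D = "S \<inter> van ?P"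
    have fD: "fds ?D" by (rule fds_van(1)[OF fS])
    have aD: "\<And>N. N \<in> ?D \<Longrightarrow> alt N" using aS by blast
    have Dc: "N (c1, c) = 0" if "N \<in> ?D" "c \<in> C'" for N c
      by (rule alt_zero_span2[OF aD[OF that(1)], of X]) (use that X in \<open>auto simp: in_van\<close>)
    have "delta S (C \<times> C) \<le> delta ?D (C \<times> C) + card ?P"
      by (rule delta_restrict[OF fS _ _ _ fD]) (use X in auto)
    moreover have "card ?P \<le> 2 * s + 1"
      using card_insert_le_m1[of "2 * s + 1" "Pair c1 ` X" "(e, v)"] card_image_le[OF X(1), of "Pair c1"] X(4) dC' by simp
    moreover have "delta ?D (C \<times> C) \<le> delta ?D (C' \<times> C')"
    proof (rule delta_mono[OF fD])
      fix N assume N: "N \<in> ?D" "N \<in> van (C' \<times> C')"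
      have a: "alt N" by (rule aD[OF N(1)])
      have "N (x, y) = 0" if "x \<in> C" "y \<in> C" for x y
      proof -
        obtain w c where wc: "w \<in> fs.span {c1}" "c \<in> C'" "x = w + c" using C'(5) \<open>x \<in> C\<close> by blast
        obtain w' c' where wc': "w' \<in> fs.span {c1}" "c' \<in> C'" "y = w' + c'" using C'(5) \<open>y \<in> C\<close> by blast
        obtain k where k: "w = k \<odot> c1" using wc(1) fs.span_singleton[of c1] by auto
        obtain k' where k': "w' = k' \<odot> c1" using wc'(1) fs.span_singleton[of c1] by auto
        have "N (c1, c') = 0" "N (c1, c) = 0" "N (c, c') = 0" using Dc[OF N(1)] wc wc' N(2) by (auto simp: in_van)
        then show ?thesis unfolding wc(3) wc'(3) k k' using a alt_swap[OF a, of c c1] by (simp add: alt_simps)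
      qed
      then show "N \<in> van (C \<times> C)" by (auto simp: in_van)
    qed
    ultimately have "delta S (E \<times> E) \<le> delta ?D (C' \<times> C') + (2 * s + 1)" using dEC by linarith
    \<comment> \<open>Since \<open>dim E >= 2 * s + 2\<close>, the first bound minus the
      \<open>2 * s + 1\<close> conditions just meets the codimension \<open>2 * s - 2\<close>
      allowed by \<open>affine_nondeg\<close>.\<close>
    then have "(2 * s choose 2) \<le> delta ?D (C' \<times> C') + 2 * s - 2" using big dim ch(1) s by linarith
    then obtain L where L: "L \<in> ?D" "nondeg (N + L) C'"
      using affine_nondeg[OF fD aD aS[OF N] C'(1) dC'] by blast
    let ?N = "N + L"
    have NS: "?N \<in> S" using N L fds_add[OF fS] by blast
    have aN: "alt ?N" by (rule aS[OF NS])
    have C'H: "C' \<subseteq> ?H" and C'E: "C' \<subseteq> E" using C'(2) C(2) HE by blast+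
    have vC: "?N (v, x) = 0" if x: "x \<in> C'" for x
    proof -
      have LS: "L \<in> S" using L by blast
      have "L (v, x) = 0"
      proof (cases "v \<in> R")
        case True then show ?thesis using rad[OF LS] x C'H by blast
      next
        case False
        then have "L (v - c1, x) = 0" using c1(3) rad[OF LS] x C'H by blast
        then show ?thesis using Dc[OF L(1) x] lin_diff[OF alt_lin1[OF aS[OF LS]]] by simp
      qed
      then show ?thesis using Hv x C'H by auto
    qed
    obtain a where a: "a \<in> C'" "\<And>x. x \<in> C' \<Longrightarrow> ?N (e - a, x) = 0"
      using nondeg_project[OF aN C'(1) L(2)] by metis
    have "?N (e - a, v) = ?N (e, v) - ?N (a, v)" by (rule lin_diff[OF alt_lin1[OF aN]])
    moreover have "?N (a, v) = 0" using vC[OF a(1)] alt_zero_swap[OF aN, of a v] by blast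
    moreover have "?N (e, v) \<noteq> 0" using n L(1) by (simp add: in_van)
    ultimately have pv: "?N (e - a, v) \<noteq> 0" by simp
    have "e - a \<in> E" "v \<in> E" using u(2) a(1) C'E v HE fds_diff[OF fE] by auto
    then obtain G where "fds G" "G \<subseteq> E" "fs.dim G = fs.dim C' + 2" "nondeg ?N G"
      using nondeg_extend[OF aN C'(1) L(2) fE C'E _ _ a(2) vC pv] by metis
    then show False using rank[OF NS] dC' by simp
  qed
  have "C \<noteq> {0}" using dC fds_dim_0[OF C(1)] by auto
  \<comment> \<open>There are no exceptional vectors here, but \<open>range_compat_local\<close>
    asks for a nonzero exceptional subspace; an arbitrary line is supplied, and the bound has just
    enough room for it.\<close>
  then obtain c0 where c0: "c0 \<in> C" "c0 \<noteq> 0" using fds_0[OF C(1)] by blast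
  have d1: "fs.dim (fs.span {c0}) = 1" using fs.dim_span_eq_card_independent[of "{c0}"] c0(2) by simp
  have "\<exists>h\<in>C. \<forall>N\<in>S. \<forall>v\<in>C. N (e, v) = N (h, v)"
  proof (rule range_compat_local[OF fS aS C(1)])
    show "fds (fs.span {c0})" by (rule fds_span) simp
    show "fs.span {c0} \<subseteq> C" using fs.span_minimal[of "{c0}" C] c0(1) fds_subspace[OF C(1)] by auto
    show "1 \<le> fs.dim (fs.span {c0})" using d1 by simp
    show "N (e, v) = 0" if "N \<in> S" "v \<in> C" "\<And>w. w \<in> C \<Longrightarrow> N (v, w) = 0" for N v
      using compat[OF that(1)] CH[OF that(1)] that(2,3) C(2) by blast
    show "(fs.dim C choose 2) + 3 + fs.dim (fs.span {c0}) \<le> delta S (C \<times> C) + fs.dim C"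
      unfolding dC d1 using big dEC ch s dim by linarith
  qed
  then obtain h where h: "h \<in> C" "\<And>N v. N \<in> S \<Longrightarrow> v \<in> C \<Longrightarrow> N (e, v) = N (h, v)" by blast
  have hH: "h \<in> ?H" using h(1) C(2) by blast
  have RE: "N (r, x) = 0" if N: "N \<in> S" and r: "r \<in> R" and x: "x \<in> E" for N r x
  proof -
    have aN: "alt N" by (rule aS[OF N])
    have "N (e, r) = 0" by (rule compat[OF N]) (use r R(2) rad[OF N] in auto)
    then have "N (r, e) = 0" using alt_zero_swap[OF aN, of r e] by blast
    moreover have "N (r, x - u x \<odot> e) = 0" by (rule rad[OF N r hyp_decompose[OF fE u x]])
    ultimately show ?thesis using lin_diff[OF alt_lin2[OF aN]] lin_smul[OF alt_lin2[OF aN]] by simp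
  qed
  have ehE: "N (e - h, x) = 0" if N: "N \<in> S" and x: "x \<in> E" for N x
  proof -
    have aN: "alt N" by (rule aS[OF N])
    have eH: "N (e - h, y) = 0" if y: "y \<in> ?H" for y
    proof -
      obtain w c where wc: "w \<in> R" "c \<in> C" "y = w + c" using C(5) y by blast
      have "e - h \<in> E" using u(2) hH HE fds_diff[OF fE] by blast
      then have "N (e - h, w) = 0" using RE[OF N wc(1)] alt_zero_swap[OF aN, of "e - h" w] by blast
      moreover have "N (e - h, c) = 0" using h(2)[OF N wc(2)] lin_diff[OF alt_lin1[OF aN]] by simp
      ultimately show ?thesis unfolding wc(3) using lin_add[OF alt_lin2[OF aN]] by simp
    qed
    have "N (e - h, e - h) = 0" by (rule alt_self[OF aN])
    then have "N (e - h, e) = 0" using eH[OF hH] lin_diff[OF alt_lin2[OF aN], of "e - h" e h] by simp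
    moreover have "N (e - h, x - u x \<odot> e) = 0" by (rule eH[OF hyp_decompose[OF fE u x]])
    ultimately show ?thesis using lin_diff[OF alt_lin2[OF aN]] lin_smul[OF alt_lin2[OF aN]] by simp
  qed
  have "u (e - h) = 1" using u hH by (simp add: lin_simps hyp_def)
  then have eR: "e - h \<notin> R" using R(2) by (auto simp: hyp_def)
  show thesis
  proof (rule that[of "fs.span (insert (e - h) R)"])
    show "fds (fs.span (insert (e - h) R))" "fs.dim (fs.span (insert (e - h) R)) = fs.dim R + 1"
      using fds_insert[OF R(1) eR] by auto
    have "insert (e - h) R \<subseteq> E" using u(2) hH HE R(2) fds_diff[OF fE] by blast
    then show "fs.span (insert (e - h) R) \<subseteq> E" using fs.span_minimal fds_subspace[OF fE] by blast
    fix N x y assume "N \<in> S" "x \<in> fs.span (insert (e - h) R)" "y \<in> E"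
    then show "N (x, y) = 0"
      using alt_zero_span1[OF aS, of N "insert (e - h) R" y x] ehE RE by blast
  qed
qed

section \<open>Large wedge spaces forced by a radical vector\<close>

lemma delta_ge:
  assumes "fds S" "finite B" "\<And>b. b \<in> B \<Longrightarrow> p b \<in> X"
    "\<And>b. b \<in> B \<Longrightarrow> \<exists>N\<in>S. N (p b) \<noteq> 0 \<and> (\<forall>c\<in>B - {b}. N (p c) = 0)"
  shows "card B \<le> delta S X"
proof -
  have "fs.dim S = fs.dim (S \<inter> van (p ` P)) + card P" if P: "P \<subseteq> B" for P
    using finite_subset[OF P assms(2)] P
  proof (induction P rule: finite_induct)
    case empty then show ?case by (simp add: van_def)
  next
    case (insert b P)
    obtain N where N: "N \<in> S" "N (p b) \<noteq> 0" "\<forall>c\<in>B - {b}. N (p c) = 0" using assms(4) insert by blast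
    have "N \<in> S \<inter> van (p ` P)" using N insert by (auto simp: in_van)
    then have "fs.dim (S \<inter> van (p ` P)) = fs.dim (S \<inter> van (p ` P) \<inter> {N. N (p b) = 0}) + 1"
      by (rule fds_kernel(3)[OF fds_van(1)[OF assms(1)] lin_eval]) (rule N(2))
    moreover have "S \<inter> van (p ` P) \<inter> {N. N (p b) = 0} = S \<inter> van (p ` insert b P)" by (auto simp: van_def)
    ultimately show ?case using insert by simp
  qed
  from this[of B] have "fs.dim S = fs.dim (S \<inter> van (p ` B)) + card B" by simp
  moreover have "fs.dim (S \<inter> van X) \<le> fs.dim (S \<inter> van (p ` B))"
  proof (rule fds_dim_mono[OF fds_van(1)[OF assms(1)] fds_van(1)[OF assms(1)]])
    have "p ` B \<subseteq> X" using assms(3) by blast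
    then show "S \<inter> van X \<subseteq> S \<inter> van (p ` B)" using van_antimono by blast
  qed
  ultimately show ?thesis using delta_dim[OF assms(1), of X] by simp
qed

text \<open>A common radical vector \<open>x\<close> of \<open>G\<close>, with \<open>G\<close> of codimension at most the minimal value \<open>d\<close> of \<open>wd\<close>,
  forces \<open>u \<and> u0 \<in> S\<close> for all \<open>u\<close>, so that \<open>wd S E u0\<close> is as large as possible.\<close>

lemma radical_vector_forces_wedges:
  assumes fS: "fds S" and aS: "\<And>N. N \<in> S \<Longrightarrow> alt N" and fE: "fds E"
    and u0: "lin u0" "e0 \<in> E" "u0 e0 = 1" and G: "fds G" "G \<subseteq> hyp E u0" and x: "x \<in> G" "x \<noteq> 0"
    and rad: "\<And>N g. N \<in> S \<Longrightarrow> g \<in> G \<Longrightarrow> N (x, g) = 0" and dG: "fs.dim E \<le> fs.dim G + d"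
    and large: "\<And>u e. lin u \<Longrightarrow> e \<in> E \<Longrightarrow> u e = 1 \<Longrightarrow> d \<le> wd S E u"
  shows "fs.dim E \<le> wd S E u0 + 1"
proof -
  have GE: "G \<subseteq> E" using G(2) hyp_subset by blast
  have xE: "x \<in> E" using x GE by blast
  have u0G: "u0 g = 0" if "g \<in> G" for g using that G(2) by (auto simp: hyp_def)
  obtain Y where Y: "fds Y" "Y \<subseteq> E" "fs.dim G + fs.dim Y = fs.dim E" "G \<inter> Y = {0}"
    "\<forall>v\<in>E. \<exists>w\<in>G. \<exists>c\<in>Y. v = w + c" by (rule fds_complement[OF fE fds_subspace[OF G(1)] GE])
  obtain B where B: "finite B" "\<not> fs.dependent B" "fs.span B = Y" "card B = fs.dim Y"
    using fds_basis[OF Y(1)] by metis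
  \<comment> \<open>Forms of \<open>S\<close> of type \<open>u \<and> N (x, \<cdot>)\<close> have
    \<open>N (x, \<cdot>)\<close> zero on \<open>G\<close>. They span at least
    \<open>d >= dim Y\<close> dimensions, so \<open>N (x, \<cdot>)\<close> is arbitrary on
    \<open>Y\<close> and can be \<open>u0\<close>, which also vanishes on \<open>G\<close>.\<close>
  have unit: "wedge_in S E u u0" if u: "lin u" "u x = 1" for u
  proof -
    let ?S = "S \<inter> van (hyp E u \<times> hyp E u)"
    have fSu: "fds ?S" by (rule fds_van(1)[OF fS])
    have aSu: "\<And>N. N \<in> ?S \<Longrightarrow> alt N" using aS by blast
    have form: "N (p, q) = u p * N (x, q) - u q * N (x, p)" if "N \<in> ?S" "p \<in> E" "q \<in> E" for N p q
      using van_hyp_eq[OF aSu[OF that(1)] u(1) fE xE u(2) _ that(2,3)] that(1) by blast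
    have inj: "v = 0" if v: "v \<in> fs.span B" "\<And>N. N \<in> ?S \<Longrightarrow> N (x, v) = 0" for v
    proof (rule ccontr)
      assume n: "v \<noteq> 0"
      have vY: "v \<in> Y" using v B by simp
      obtain X where X: "finite X" "card X + 1 = fs.dim Y" "fs.span (insert v X) = Y"
        by (rule finite_spanning_rest[OF Y(1) vY n])
      have "delta ?S (E \<times> E) \<le> card (Pair x ` X)"
      proof (rule delta_le_card[OF fSu])
        fix N assume N: "N \<in> ?S" "N \<in> van (Pair x ` X)"
        have aN: "alt N" by (rule aSu[OF N(1)])
        have xY: "N (x, y) = 0" if "y \<in> Y" for y
          by (rule alt_zero_span2[OF aN, of "insert v X"]) (use N(2) v(2)[OF N(1)] that X(3) in \<open>auto simp: in_van\<close>)
        have xE: "N (x, y) = 0" if y: "y \<in> E" for y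
        proof -
          obtain w c where wc: "w \<in> G" "c \<in> Y" "y = w + c" using Y(5) y by blast
          have "N (x, w) = 0" using rad wc(1) N(1) by blast
          then show ?thesis unfolding wc(3) using xY[OF wc(2)] lin_add[OF alt_lin2[OF aN]] by simp
        qed
        show "N \<in> van (E \<times> E)" using form[OF N(1)] xE by (auto simp: in_van)
      qed (use X in auto)
      then have "wd S E u + 1 \<le> fs.dim Y" unfolding wd_def using card_image_le[OF X(1), of "Pair x"] X(2) by simp
      then show False using large[OF u(1) xE u(2)] Y(3) dG by simp
    qed
    obtain N where N: "N \<in> ?S" "\<forall>v\<in>fs.span B. N (x, v) = u0 v"
      by (rule dual_forms_exist[OF fSu B(1,2) inj aSu u0(1)])
    have ev: "N (x, y) = u0 y" if y: "y \<in> E" for y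
    proof -
      obtain w c where wc: "w \<in> G" "c \<in> Y" "y = w + c" using Y(5) y by blast
      have "N (x, w) = 0" "u0 w = 0" using rad wc(1) N(1) u0G by auto
      then show ?thesis unfolding wc(3) using N(2) wc(2) B(3) lin_add[OF alt_lin2[OF aSu[OF N(1)]]] lin_add[OF u0(1)] by simp
    qed
    have "N (p, q) = u p * u0 q - u q * u0 p" if "p \<in> E" "q \<in> E" for p q
      using form[OF N(1) that] ev that by simp
    then show ?thesis using N(1) unfolding wedge_in_def by blast
  qed
  obtain z where z: "lin z" "z x = 1"
  proof -
    have "x \<notin> {0}" using x by simp
    then show thesis using lin_separate[OF fds_subspace[OF dim_0(1)]] that by metis
  qed
  \<comment> \<open>\<open>w + (1 - w x) z\<close> has value 1 at \<open>x\<close>; the multiple of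
    \<open>z\<close> is then subtracted.\<close>
  have all: "wedge_in S E w u0" if w: "lin w" for w
  proof -
    have "wedge_in S E (\<lambda>y. w y + (1 - w x) * z y) u0"
      by (rule unit) (use lin_plus[OF w lin_times[OF z(1), of "1 - w x"]] z(2) in auto)
    moreover have "wedge_in S E (\<lambda>y. (1 - w x) * z y) u0"
    proof -
      obtain N where N: "N \<in> S" "\<forall>p\<in>E. \<forall>q\<in>E. N (p, q) = z p * u0 q - z q * u0 p"
        using unit[OF z] by (auto simp: wedge_in_def)
      have "((1 - w x) \<odot> N) (p, q) = (1 - w x) * z p * u0 q - (1 - w x) * z q * u0 p" if "p \<in> E" "q \<in> E" for p q
        using N(2) that by (simp add: smul_apply right_diff_distrib mult.assoc)
      then show ?thesis using fds_smul[OF fS N(1)] unfolding wedge_in_def by blast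
    qed
    ultimately have "wedge_in S E (\<lambda>y. (w y + (1 - w x) * z y) - (1 - w x) * z y) u0" by (rule wedge_in_diff[OF fS])
    then show ?thesis by simp
  qed
  let ?H = "hyp E u0"
  have H: "fds ?H" by (rule fds_hyp[OF fE u0(1)])
  obtain X where X: "finite X" "\<not> fs.dependent X" "fs.span X = ?H" "card X = fs.dim ?H"
    using fds_basis[OF H] by metis
  have XH: "X \<subseteq> ?H" using fs.span_superset[of X] X(3) by simp
  \<comment> \<open>The wedges of \<open>u0\<close> with functionals dual to the basis
    \<open>X\<close> of \<open>?H\<close> are told apart by their values at
    \<open>(e0, b)\<close>.\<close>
  have "card X \<le> delta (S \<inter> van (?H \<times> ?H)) (E \<times> E)"
  proof (rule delta_ge[OF fds_van(1)[OF fS] X(1), where p = "Pair e0"])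
    show "(e0, b) \<in> E \<times> E" if "b \<in> X" for b using that u0(2) XH hyp_subset by blast
    fix b assume b: "b \<in> X"
    obtain w where w: "lin w" "\<And>c. c \<in> X \<Longrightarrow> w c = (if c = b then 1 else 0)"
      using lin_extend[OF X(2), of "\<lambda>c. if c = b then 1 else 0"] by metis
    obtain N where N: "N \<in> S" "\<forall>p\<in>E. \<forall>q\<in>E. N (p, q) = w p * u0 q - w q * u0 p"
      using all[OF w(1)] by (auto simp: wedge_in_def)
    have "N (e0, c) = - w c" if "c \<in> X" for c
    proof -
      have "c \<in> E" "u0 c = 0" using that XH by (auto simp: hyp_def)
      then show ?thesis using N(2) u0(2,3) by simp
    qed
    moreover have "N \<in> van (?H \<times> ?H)" using N(2) by (auto simp: in_van hyp_def)
    ultimately show "\<exists>N\<in>S \<inter> van (?H \<times> ?H). N (e0, b) \<noteq> 0 \<and> (\<forall>c\<in>X - {b}. N (e0, c) = 0)"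
      using N(1) w(2) b by (intro bexI[of _ N]) auto
  qed
  then show ?thesis unfolding wd_def using X(4) dim_hyp[OF fE u0(1,2)] u0(3) by simp
qed

section \<open>The main induction\<close>

lemma two_times_choose_two: "2 * (Suc n choose 2) = Suc n * n"
  by (induction n) (simp_all add: choose_two_Suc)

text \<open>Arithmetic of the step to \<open>G\<close>, with \<open>s = t + 2\<close> and
  \<open>dim E = 2 * t + 6 + j\<close>. The second bound drops by \<open>3 * t + 5 + j\<close>,
  exactly the largest loss \<open>(dim E - 2) + d\<close>. The first drops by
  \<open>4 * t + 5\<close>, which covers the loss if \<open>j <= t\<close>; for larger
  \<open>j\<close> the second bound implies the first.\<close>

lemma bounds_descend:
  fixes t j d \<delta> \<delta>' :: nat
  assumes "d \<le> t + 1" "2 \<le> d \<or> j = 0"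
    and "((2 * t + 3) choose 2) + (2 * t + 5 + j) < \<delta>"
    and "((t + 1) choose 2) + 3 + (t + 1) * (t + 5 + j) < \<delta>"
    and "\<delta> \<le> \<delta>' + (2 * t + 4 + j) + d"
  shows "((2 * t + 1) choose 2) + (2 * t + 3 + j) < \<delta>'"
    and "(t choose 2) + 3 + t * (t + 4 + j) < \<delta>'"
proof -
  have c1: "((2 * t + 3) choose 2) = ((2 * t + 1) choose 2) + (2 * t + 1) + (2 * t + 2)"
    using choose_two_Suc[of "2 * t + 1"] choose_two_Suc[of "2 * t + 2"] by (simp add: numeral_3_eq_3)
  have c2: "((t + 1) choose 2) = (t choose 2) + t" using choose_two_Suc[of t] by simp
  have e: "(t + 1) * (t + 5 + j) = t * (t + 4 + j) + t + (t + 5 + j)" by (simp add: algebra_simps)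
  show A2: "(t choose 2) + 3 + t * (t + 4 + j) < \<delta>'" using assms(1,4,5) c2 e by linarith
  show "((2 * t + 1) choose 2) + (2 * t + 3 + j) < \<delta>'"
  proof (cases "j \<le> t")
    case True
    then show ?thesis using assms(1,3,5) c1 by linarith
  next
    case False
    then have "2 \<le> d" using assms(2) by linarith
    then obtain k where k: "t = Suc k" using assms(1) by (cases t) auto
    obtain l where l: "j = t + 1 + l" using False less_iff_Suc_add[of t j] by auto
    have q1: "2 * ((2 * t + 1) choose 2) = (2 * t + 1) * (2 * t)" using two_times_choose_two[of "2 * t"] by simp
    have q2: "2 * (t choose 2) = t * k" using two_times_choose_two[of k] k by simp
    have q3: "(2 * t + 1) * (2 * t) + 2 * (2 * t + 3 + j) \<le> t * k + 6 + 2 * (t * (t + 4 + j))"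
      unfolding l k by (simp add: algebra_simps)
    have "((2 * t + 1) choose 2) + (2 * t + 3 + j) \<le> (t choose 2) + 3 + t * (t + 4 + j)"
    proof -
      have "a + x \<le> b + 3 + y" if "2 * a + 2 * x \<le> 2 * b + 6 + 2 * y" for a b x y :: nat using that by linarith
      then show ?thesis using q3[folded q1 q2] .
    qed
    then show ?thesis using A2 by linarith
  qed
qed

text \<open>The size of \<open>S\<close> is measured by \<open>delta\<close> on \<open>E\<close>, so
  that \<open>S\<close> stays fixed while \<open>E\<close> and \<open>s\<close> shrink. The rank
  bound reads \<open>2 * s + 1\<close> because nondegenerate alternating spaces have even dimension:
  it expresses rank at most \<open>2 * s\<close> without proving that parity.\<close>

theorem alternating_forms_bounded_rank:
  assumes fS: "fds S" and aS: "\<And>N. N \<in> S \<Longrightarrow> alt N"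
  shows "fds E \<Longrightarrow> 1 \<le> s \<Longrightarrow> 2 * s + 1 \<le> fs.dim E \<Longrightarrow>
    (\<And>N F. N \<in> S \<Longrightarrow> fds F \<Longrightarrow> F \<subseteq> E \<Longrightarrow> nondeg N F \<Longrightarrow> fs.dim F \<le> 2 * s + 1) \<Longrightarrow>
    ((2 * s - 1) choose 2) + (fs.dim E - 1) < delta S (E \<times> E) \<Longrightarrow>
    ((s - 1) choose 2) + 3 + (s - 1) * (fs.dim E - s + 1) < delta S (E \<times> E) \<Longrightarrow>
    (\<exists>R. fds R \<and> R \<subseteq> E \<and> fs.dim R + 2 * s + 1 = fs.dim E \<and> (\<forall>N\<in>S. \<forall>x\<in>R. \<forall>y\<in>E. N (x, y) = 0)) \<or>
    (\<exists>F. fds F \<and> F \<subseteq> E \<and> fs.dim F + s = fs.dim E \<and> (\<forall>N\<in>S. \<forall>x\<in>F. \<forall>y\<in>F. N (x, y) = 0))"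
proof (induction "fs.dim E" arbitrary: E s rule: less_induct)
  case less
  note fE = less.prems(1) and s1 = less.prems(2) and rank = less.prems(4) and A1 = less.prems(5) and A2 = less.prems(6)
  let ?n = "fs.dim E"
  let ?rad = "\<exists>R. fds R \<and> R \<subseteq> E \<and> fs.dim R + 2 * s + 1 = ?n \<and> (\<forall>N\<in>S. \<forall>x\<in>R. \<forall>y\<in>E. N (x, y) = 0)"
  let ?iso = "\<exists>F. fds F \<and> F \<subseteq> E \<and> fs.dim F + s = ?n \<and> (\<forall>N\<in>S. \<forall>x\<in>F. \<forall>y\<in>F. N (x, y) = 0)"
  show ?case
  proof (cases "?n = 2 * s + 1")
    case True
    have "\<forall>N\<in>S. \<forall>x\<in>{0}. \<forall>y\<in>E. N (x, y) = 0" using lin_zero[OF alt_lin1[OF aS]] by blast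
    moreover have "{0} \<subseteq> E" using fds_0[OF fE] by blast
    moreover have "fs.dim {0 :: 'a \<Rightarrow> 'b} + 2 * s + 1 = ?n" using dim_0(2) True by simp
    ultimately have ?rad using dim_0(1) by blast
    then show ?thesis by blast
  next
    case False
    then have n: "2 * s + 2 \<le> ?n" using less.prems(3) by simp
    have rank': "\<not> nondeg N F" if "N \<in> S" "fds F" "F \<subseteq> E" "fs.dim F = 2 * s + 2" for N F
      using rank[OF that(1-3)] that(4) by auto
    have a0: "alt (0 :: ('a \<Rightarrow> 'b) \<times> ('a \<Rightarrow> 'b) \<Rightarrow> 'b)" by (simp add: alt_def lin_def)
    obtain L m where L: "L \<in> S" "2 * m \<le> ?n" "max_form S (0 + L) E (2 * m)"
      by (rule max_form_exists[OF fS aS a0 fE])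
    interpret max_form S "0 + L" E "2 * m" by (rule L(3))
    obtain F0 where F0: "fds F0" "F0 \<subseteq> E" "fs.dim F0 = 2 * m" "nondeg (0 + L) F0" using ex by blast
    have "nondeg L F0" using F0(4) by simp
    then have "2 * m \<le> 2 * s + 1" using rank[OF L(1) F0(1,2)] F0(3) by simp
    then have ms: "m \<le> s" by simp
    let ?U = "\<lambda>d. \<exists>u e. lin u \<and> e \<in> E \<and> u e = 1 \<and> wd S E u = d"
    have "2 * m + 2 \<le> ?n" using n ms by simp
    then obtain u' e' where u': "lin u'" "e' \<in> E" "u' e' = 1" "2 * wd S E u' \<le> 2 * m" by (rule small_functional)
    define d where "d = (LEAST d. ?U d)"
    have "?U (wd S E u')" using u' by blast
    then have "?U d" and min: "\<And>k. ?U k \<Longrightarrow> d \<le> k" unfolding d_def by (rule LeastI) (rule Least_le)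
    then obtain u e where u: "lin u" "e \<in> E" "u e = 1" "wd S E u = d" by blast
    have large: "d \<le> wd S E w" if "lin w" "f \<in> E" "w f = 1" for w f using min that by blast
    have dm: "d \<le> m" using large[OF u'(1-3)] u'(4) by simp
    show ?thesis
    proof (cases "s \<le> d")
      case True
      then have "m = s" using dm ms by simp
      then have r: "2 * m = 2 * s" by simp
      have ?iso
      proof (rule all_functionals_large[OF r])
        show "2 * m + 2 \<le> ?n" by fact
        show "s \<le> wd S E w" if "lin w" "f \<in> E" "w f = 1" for w f using large[OF that] True by simp
        show "\<not> nondeg N F" if "N \<in> S" "fds F" "F \<subseteq> E" "fs.dim F = 2 * m + 2" for N F
          using rank'[OF that(1-3)] that(4) r by simp
        fix F
        assume "fds F" "F \<subseteq> E" "fs.dim F + s = ?n" "\<And>N x y. N \<in> S \<Longrightarrow> x \<in> F \<Longrightarrow> y \<in> F \<Longrightarrow> N (x, y) = 0"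
        then show ?iso by blast
      qed
      then show ?thesis by blast
    next
      case False
      then have ds: "d + 1 \<le> s" by simp
      let ?H = "hyp E u"
      have H: "fds ?H" by (rule fds_hyp[OF fE u(1)])
      have HE: "?H \<subseteq> E" by (rule hyp_subset)
      have dH: "?n = fs.dim ?H + 1" using dim_hyp[OF fE u(1,2)] u(3) by simp
      have dE: "delta S (E \<times> E) = delta S (?H \<times> ?H) + d" using wd_delta[OF fS, of E u] u(4) by simp
      have lift: ?iso if F1: "fds F1" "F1 \<subseteq> ?H" "fs.dim F1 + s + 1 = ?n"
        and iso: "\<forall>N\<in>S. \<forall>x\<in>F1. \<forall>y\<in>F1. N (x, y) = 0" for F1
      proof -
        have big: "((s - 1) choose 2) + 3 + (s - 1) * (fs.dim F1 + 2) < delta S (E \<times> E)"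
          using A2 F1(3) by (simp flip: F1(3))
        show ?iso
        proof (rule isotropic_lift[OF fS aS fE rank' u(1-3) F1(1,2) refl _ _ s1 _ _ big])
          show "N (x, y) = 0" if "N \<in> S" "x \<in> F1" "y \<in> F1" for N x y using iso that by blast
          show "?n = fs.dim F1 + s + 1" "s + 1 \<le> fs.dim F1" "wd S E u \<le> s - 1" using F1(3) n u(4) ds by auto
          fix F
          assume "fds F" "F \<subseteq> E" "fs.dim F = fs.dim F1 + 1" "\<And>N x y. N \<in> S \<Longrightarrow> x \<in> F \<Longrightarrow> y \<in> F \<Longrightarrow> N (x, y) = 0"
          then show ?iso using F1(3) by (intro exI[of _ F]) auto
        qed
      qed
      \<comment> \<open>A common radical vector of a \<open>G\<close> of codimension at most
        \<open>d\<close> would give \<open>wd S E u >= dim E - 1\<close>, but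
        \<open>wd S E u = d < s\<close>.\<close>
      have forced: False if G: "fds G" "G \<subseteq> ?H" "?n \<le> fs.dim G + d"
        and R: "fds R" "R \<subseteq> G" "1 \<le> fs.dim R" "\<forall>N\<in>S. \<forall>x\<in>R. \<forall>y\<in>G. N (x, y) = 0" for G R
      proof -
        have "R \<noteq> {0}" using R(3) fds_dim_0[OF R(1)] by auto
        then obtain x where x: "x \<in> R" "x \<noteq> 0" using fds_0[OF R(1)] by blast
        have xG: "x \<in> G" using x(1) R(2) by blast
        have "?n \<le> wd S E u + 1"
        proof (rule radical_vector_forces_wedges[OF fS aS fE u(1-3) G(1,2) xG x(2) _ G(3)])
          show "N (x, g) = 0" if "N \<in> S" "g \<in> G" for N g using R(4) that x(1) by blast
          show "d \<le> wd S E w" if "lin w" "f \<in> E" "w f = 1" for w f by (rule large[OF that])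
        qed
        then show False using u(4) ds n by simp
      qed
      show ?thesis
      \<comment> \<open>In the hyperplane step the first bound decreases by one only, so it
        tolerates \<open>d <= 1\<close>. If \<open>d = 1\<close> and
        \<open>dim E = 2 * s + 2\<close>, the hyperplane has dimension \<open>2 * s + 1\<close>,
        where the radical alternative holds trivially with the zero space; this case must go to
        \<open>G\<close>.\<close>
      proof (cases "d = 0 \<or> d = 1 \<and> 2 * s + 3 \<le> ?n")
        case True
        have "(\<exists>R. fds R \<and> R \<subseteq> ?H \<and> fs.dim R + 2 * s + 1 = fs.dim ?H \<and> (\<forall>N\<in>S. \<forall>x\<in>R. \<forall>y\<in>?H. N (x, y) = 0)) \<or>
          (\<exists>F. fds F \<and> F \<subseteq> ?H \<and> fs.dim F + s = fs.dim ?H \<and> (\<forall>N\<in>S. \<forall>x\<in>F. \<forall>y\<in>F. N (x, y) = 0))"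
        proof (rule less.hyps[OF _ H s1])
          show "fs.dim ?H < ?n" "2 * s + 1 \<le> fs.dim ?H" using dH n by auto
          show "fs.dim F \<le> 2 * s + 1" if "N \<in> S" "fds F" "F \<subseteq> ?H" "nondeg N F" for N F
            using rank[OF that(1,2) _ that(4)] that(3) HE by blast
          show "((2 * s - 1) choose 2) + (fs.dim ?H - 1) < delta S (?H \<times> ?H)"
            using A1 dE dH n True by linarith
          show "((s - 1) choose 2) + 3 + (s - 1) * (fs.dim ?H - s + 1) < delta S (?H \<times> ?H)"
          proof -
            have "?n - s + 1 = (fs.dim ?H - s + 1) + 1" using dH n by simp
            then have "(s - 1) * (?n - s + 1) = (s - 1) * (fs.dim ?H - s + 1) + (s - 1)" by simp
            then show ?thesis using A2 dE ds by linarith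
          qed
        qed
        then show ?thesis
        proof
          assume "\<exists>R. fds R \<and> R \<subseteq> ?H \<and> fs.dim R + 2 * s + 1 = fs.dim ?H \<and> (\<forall>N\<in>S. \<forall>x\<in>R. \<forall>y\<in>?H. N (x, y) = 0)"
          then obtain R where R: "fds R" "R \<subseteq> ?H" "fs.dim R + 2 * s + 1 = fs.dim ?H"
            "\<forall>N\<in>S. \<forall>x\<in>R. \<forall>y\<in>?H. N (x, y) = 0" by blast
          show ?thesis
          proof (cases "d = 0")
            case True
            have dR: "fs.dim R + 2 * s + 2 = ?n" using R(3) dH by simp
            have wd0: "wd S E u = 0" using u(4) True by simp
            have ?rad
            proof (rule radical_lift[OF fS aS fE rank' u(1-3) R(1,2) _ dR s1 wd0 A1])
              show "N (x, y) = 0" if "N \<in> S" "x \<in> R" "y \<in> ?H" for N x y using R(4) that by blast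
              fix R'
              assume "fds R'" "R' \<subseteq> E" "fs.dim R' = fs.dim R + 1" "\<And>N x y. N \<in> S \<Longrightarrow> x \<in> R' \<Longrightarrow> y \<in> E \<Longrightarrow> N (x, y) = 0"
              then show ?rad using dR by (intro exI[of _ R']) auto
            qed
            then show ?thesis by blast
          next
            case nd: False
            then have "1 \<le> fs.dim R" "?n \<le> fs.dim ?H + d" using True R(3) dH by auto
            then have False using forced[OF H _ _ R(1,2) _ R(4)] by blast
            then show ?thesis ..
          qed
        next
          assume "\<exists>F. fds F \<and> F \<subseteq> ?H \<and> fs.dim F + s = fs.dim ?H \<and> (\<forall>N\<in>S. \<forall>x\<in>F. \<forall>y\<in>F. N (x, y) = 0)"
          then obtain F where F: "fds F" "F \<subseteq> ?H" "fs.dim F + s = fs.dim ?H" "\<forall>N\<in>S. \<forall>x\<in>F. \<forall>y\<in>F. N (x, y) = 0" by blast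
          have ?iso by (rule lift[OF F(1,2) _ F(4)]) (use F(3) dH in simp)
          then show ?thesis by blast
        qed
      next
        case c: False
        then have d1: "1 \<le> d" and dn: "2 \<le> d \<or> ?n = 2 * s + 2" using n by auto
        have s2: "2 \<le> s" using d1 ds by simp
        have "0 < delta (S \<inter> van (?H \<times> ?H)) (E \<times> E)" using u(4) d1 unfolding wd_def by simp
        then obtain M0 where M0: "M0 \<in> S \<inter> van (?H \<times> ?H)" "M0 \<notin> van (E \<times> E)"
          using delta_pos[OF fds_van(1)[OF fS]] by blast
        have aM0: "alt M0" using M0 aS by simp
        obtain G p q where G: "fds G" "G \<subseteq> ?H" "fs.dim ?H = fs.dim G + 1"
          "\<And>x y. x \<in> G \<Longrightarrow> y \<in> E \<Longrightarrow> M0 (x, y) = 0" "p \<in> E" "q \<in> E" "M0 (p, q) \<noteq> 0"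
          using rank_two_radical[OF aM0 fE u(1-3) _ M0(2)] M0(1) by blast
        have GE: "G \<subseteq> E" using G(2) HE by blast
        have nG: "?n = fs.dim G + 2" using G(3) dH by simp
        have dHG: "delta S (?H \<times> ?H) \<le> delta S (G \<times> G) + fs.dim G"
          by (rule delta_hyperplane[OF fS aS G(1,2) H G(3)])
        obtain t where t: "s = t + 2" using le_Suc_ex[OF s2] by auto
        \<comment> \<open>\<open>j\<close> is the excess of \<open>dim E\<close> over
          \<open>2 * s + 2\<close>; with \<open>t\<close> and \<open>j\<close> the bounds are free
          of subtraction.\<close>
        obtain j where j: "fs.dim G = 2 * t + 4 + j" using le_Suc_ex[of "2 * t + 4" "fs.dim G"] n nG t by auto
        have B: "((2 * t + 1) choose 2) + (2 * t + 3 + j) < delta S (G \<times> G)"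
          "(t choose 2) + 3 + t * (t + 4 + j) < delta S (G \<times> G)"
        proof (atomize (full), intro conjI)
          have h: "d \<le> t + 1" "2 \<le> d \<or> j = 0" using ds t dn nG j by auto
          have b1: "((2 * t + 3) choose 2) + (2 * t + 5 + j) < delta S (E \<times> E)"
            using A1 t nG j by (simp add: numeral_eq_Suc)
          have b2: "((t + 1) choose 2) + 3 + (t + 1) * (t + 5 + j) < delta S (E \<times> E)"
          proof -
            have e: "?n - s + 1 = t + 5 + j" "s - 1 = t + 1" using t nG j by auto
            show ?thesis using A2 unfolding e .
          qed
          have b3: "delta S (E \<times> E) \<le> delta S (G \<times> G) + (2 * t + 4 + j) + d" using dE dHG j by simp
          show "((2 * t + 1) choose 2) + (2 * t + 3 + j) < delta S (G \<times> G)"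
            "(t choose 2) + 3 + t * (t + 4 + j) < delta S (G \<times> G)"
            using bounds_descend[OF h b1 b2 b3] by auto
        qed
        have "(\<exists>R. fds R \<and> R \<subseteq> G \<and> fs.dim R + 2 * (t + 1) + 1 = fs.dim G \<and> (\<forall>N\<in>S. \<forall>x\<in>R. \<forall>y\<in>G. N (x, y) = 0)) \<or>
          (\<exists>F. fds F \<and> F \<subseteq> G \<and> fs.dim F + (t + 1) = fs.dim G \<and> (\<forall>N\<in>S. \<forall>x\<in>F. \<forall>y\<in>F. N (x, y) = 0))"
        proof (rule less.hyps[OF _ G(1)])
          show "fs.dim G < ?n" "1 \<le> t + 1" "2 * (t + 1) + 1 \<le> fs.dim G" using nG j by auto
          show "fs.dim F \<le> 2 * (t + 1) + 1" if F: "N \<in> S" "fds F" "F \<subseteq> G" "nondeg N F" for N F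
          proof -
            have FE: "F \<subseteq> E" using F(3) GE by blast
            have MF: "M0 (x, y) = 0" if "x \<in> F" "y \<in> E" for x y using G(4) F(3) that by blast
            obtain G' where G': "fds G'" "G' \<subseteq> E" "fs.dim G' = fs.dim F + 2" "nondeg N G' \<or> nondeg (N + M0) G'"
              by (rule rank_two_update[OF aS[OF F(1)] aM0 F(2,4) fE FE G(5,6) MF G(7)])
            have "N + M0 \<in> S" using F(1) M0(1) fds_add[OF fS] by blast
            then have "fs.dim G' \<le> 2 * s + 1" using rank[OF _ G'(1,2)] F(1) G'(4) by blast
            then show ?thesis using G'(3) t by simp
          qed
          have e: "2 * (t + 1) - 1 = 2 * t + 1" "fs.dim G - 1 = 2 * t + 3 + j" "t + 1 - 1 = t"
            "fs.dim G - (t + 1) + 1 = t + 4 + j" using j by auto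
          show "((2 * (t + 1) - 1) choose 2) + (fs.dim G - 1) < delta S (G \<times> G)"
            "((t + 1 - 1) choose 2) + 3 + (t + 1 - 1) * (fs.dim G - (t + 1) + 1) < delta S (G \<times> G)"
            unfolding e by (rule B)+
        qed
        then show ?thesis
        proof
          assume "\<exists>F. fds F \<and> F \<subseteq> G \<and> fs.dim F + (t + 1) = fs.dim G \<and> (\<forall>N\<in>S. \<forall>x\<in>F. \<forall>y\<in>F. N (x, y) = 0)"
          then obtain F where F: "fds F" "F \<subseteq> G" "fs.dim F + (t + 1) = fs.dim G" "\<forall>N\<in>S. \<forall>x\<in>F. \<forall>y\<in>F. N (x, y) = 0" by blast
          have ?iso by (rule lift[OF F(1) _ _ F(4)]) (use F(2,3) G(2) nG t in auto)
          then show ?thesis by blast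
        next
          assume "\<exists>R. fds R \<and> R \<subseteq> G \<and> fs.dim R + 2 * (t + 1) + 1 = fs.dim G \<and> (\<forall>N\<in>S. \<forall>x\<in>R. \<forall>y\<in>G. N (x, y) = 0)"
          then obtain R where R: "fds R" "R \<subseteq> G" "fs.dim R + 2 * (t + 1) + 1 = fs.dim G"
            "\<forall>N\<in>S. \<forall>x\<in>R. \<forall>y\<in>G. N (x, y) = 0" by blast
          have False
          proof (cases "2 \<le> d")
            case True
            then show False using forced[OF G(1,2) _ R(1,2) _ R(4)] R(3) nG j by auto
          next
            case False
            \<comment> \<open>Here \<open>R\<close> is a line, so the forms on \<open>G\<close> live
              on a complement of dimension \<open>2 * s - 1\<close>. Adding \<open>dim G\<close> and
              \<open>d = 1\<close> gives at most
              \<open>((2 * s - 1) choose 2) + (dim E - 1)\<close>, which is exactly what the first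
              bound excludes.\<close>
            then have d: "d = 1" "j = 0" using d1 dn nG j t by auto
            obtain C where C: "fds C" "C \<subseteq> G" "fs.dim R + fs.dim C = fs.dim G" "R \<inter> C = {0}"
              "\<forall>v\<in>G. \<exists>w\<in>R. \<exists>c\<in>C. v = w + c" by (rule fds_complement[OF G(1) fds_subspace[OF R(1)] R(2)])
            have "delta S (G \<times> G) \<le> delta S (C \<times> C)"
            proof (rule delta_mono[OF fS])
              fix N assume N: "N \<in> S" "N \<in> van (C \<times> C)"
              have aN: "alt N" by (rule aS[OF N(1)])
              have "N (x, y) = 0" if "x \<in> G" "y \<in> G" for x y
              proof -
                obtain w c where wc: "w \<in> R" "c \<in> C" "x = w + c" using C(5) \<open>x \<in> G\<close> by blast
                obtain w' c' where wc': "w' \<in> R" "c' \<in> C" "y = w' + c'" using C(5) \<open>y \<in> G\<close> by blast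
                have "N (w, w') = 0" "N (w, c') = 0" "N (w', c) = 0" "N (c, c') = 0"
                  using R(2,4) C(2) N wc wc' by (auto simp: in_van)
                then show ?thesis unfolding wc(3) wc'(3)
                  using aN alt_zero_swap[OF aN, of c w'] by (simp add: alt_simps)
              qed
              then show "N \<in> van (G \<times> G)" by (auto simp: in_van)
            qed
            also have "\<dots> \<le> fs.dim C choose 2" by (rule delta_square[OF fS aS C(1)])
            also have "fs.dim C = 2 * s - 1" using C(3) R(3) t by simp
            finally show False using A1 dE dHG d nG j by linarith
          qed
          then show ?thesis ..
        qed
      qed
    qed
  qed
qed

section \<open>Matrices as forms\<close>

text \<open>Defined on all sequences, of which only the first \<open>n\<close> entries enter, so the
  type of the vectors does not depend on \<open>n\<close>.\<close>

definition form_of :: "nat \<Rightarrow> 'a::field mat \<Rightarrow> (nat \<Rightarrow> 'a) \<times> (nat \<Rightarrow> 'a) \<Rightarrow> 'a" where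
  "form_of n M p = (\<Sum>i<n. \<Sum>j<n. fst p i * M $$ (i, j) * snd p j)"

text \<open>The copy of the coordinate space of dimension \<open>n\<close> inside the sequences; it
  plays the role of \<open>E\<close> at the start of the induction.\<close>

definition coords :: "nat \<Rightarrow> (nat \<Rightarrow> 'a::field) set" where
  "coords n = {x. \<forall>i\<ge>n. x i = 0}"

definition unit :: "nat \<Rightarrow> nat \<Rightarrow> 'a::field" where
  "unit i = (\<lambda>k. if k = i then 1 else 0)"

lemma unit_in_coords: "i < n \<Longrightarrow> unit i \<in> coords n"
  by (simp add: unit_def coords_def)

lemma sum_unit: "i < n \<Longrightarrow> (\<Sum>k<n. unit i k * f k) = f i"
proof -
  assume i: "i < n"
  have "(\<Sum>k<n. unit i k * f k) = (\<Sum>k<n. if k = i then f k else 0)"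
    by (rule sum.cong) (auto simp: unit_def)
  then show ?thesis using i by simp
qed

lemma form_of_unit:
  assumes "i < n" "j < n" shows "form_of n M (unit i, unit j) = M $$ (i, j)"
proof -
  have "form_of n M (unit i, unit j) = (\<Sum>k<n. unit i k * (\<Sum>l<n. unit j l * M $$ (k, l)))"
    unfolding form_of_def fst_conv snd_conv sum_distrib_left by (intro sum.cong refl) (simp add: mult.commute mult.left_commute)
  then show ?thesis by (simp add: sum_unit assms)
qed

lemma fun_expansion: "x \<in> coords n \<Longrightarrow> x = (\<Sum>i<n. x i \<odot> unit i)"
proof
  fix k assume x: "x \<in> coords n"
  have ev: "(\<Sum>i<n. x i \<odot> unit i) k = (\<Sum>i<n. (x i \<odot> unit i) k)"
    by (rule lin_sum[OF lin_eval])
  show "x k = (\<Sum>i<n. x i \<odot> unit i) k"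
    unfolding ev using x by (auto simp: unit_def smul_apply coords_def if_distrib cong: if_cong)
qed

lemma coords_span: "(coords n :: (nat \<Rightarrow> 'a::field) set) = fs.span (unit ` {..<n})" (is "?L = ?R")
proof
  show "?L \<subseteq> ?R"
  proof
    fix x :: "nat \<Rightarrow> 'a" assume x: "x \<in> coords n"
    have "(\<Sum>i<n. x i \<odot> unit i) \<in> fs.span (unit ` {..<n})"
      by (intro fs.span_sum fs.span_scale fs.span_base) auto
    then show "x \<in> fs.span (unit ` {..<n})" using fun_expansion[OF x] by simp
  qed
  have "fs.subspace ?L" by (auto simp: fs.subspace_def coords_def smul_apply)
  then show "?R \<subseteq> ?L" by (intro fs.span_minimal) (auto intro: unit_in_coords)
qed

lemma coords_dim: "fds (coords n :: (nat \<Rightarrow> 'a::field) set)" "fs.dim (coords n :: (nat \<Rightarrow> 'a::field) set) = n"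
proof -
  show "fds (coords n :: (nat \<Rightarrow> 'a) set)" unfolding coords_span by (rule fds_span) simp
  have inj: "inj_on (unit :: nat \<Rightarrow> nat \<Rightarrow> 'a) {..<n}"
    by (auto simp: inj_on_def unit_def fun_eq_iff split: if_splits)
  have ind: "\<not> fs.dependent ((unit :: nat \<Rightarrow> nat \<Rightarrow> 'a) ` {..<n})"
  proof
    assume "fs.dependent ((unit :: nat \<Rightarrow> nat \<Rightarrow> 'a) ` {..<n})"
    then obtain i where i: "i < n" "(unit i :: nat \<Rightarrow> 'a) \<in> fs.span (unit ` {..<n} - {unit i})"
      unfolding fs.dependent_def by blast
    have l: "lin (\<lambda>x :: nat \<Rightarrow> 'a. x i)" by (rule lin_eval)
    have "(unit i :: nat \<Rightarrow> 'a) i = 0"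
    proof (rule lin_zero_on_span[OF l _ i(2)])
      fix b :: "nat \<Rightarrow> 'a" assume "b \<in> unit ` {..<n} - {unit i}"
      then obtain j where "b = unit j" "j \<noteq> i" by auto
      then show "b i = 0" by (simp add: unit_def)
    qed
    then show False by (simp add: unit_def)
  qed
  show "fs.dim (coords n :: (nat \<Rightarrow> 'a) set) = n"
    unfolding coords_span fs.dim_span_eq_card_independent[OF ind] using card_image[OF inj] by simp
qed

text \<open>The last row cancels against the last column. The diagonal is assumed zero separately,
  since in characteristic two antisymmetry says nothing about it.\<close>

lemma sum_antisymmetric:
  fixes f :: "nat \<Rightarrow> nat \<Rightarrow> 'a::field"
  assumes "\<And>i j. i < n \<Longrightarrow> j < n \<Longrightarrow> f i j = - f j i" "\<And>i. i < n \<Longrightarrow> f i i = 0"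
  shows "(\<Sum>i<n. \<Sum>j<n. f i j) = 0"
  using assms
proof (induction n)
  case (Suc n)
  have "(\<Sum>i<n. f i n) = (\<Sum>i<n. - f n i)"
  proof (rule sum.cong)
    show "f i n = - f n i" if "i \<in> {..<n}" for i by (rule Suc.prems(1)) (use that in auto)
  qed simp
  then have "(\<Sum>i<n. f i n) + (\<Sum>j<n. f n j) = 0" by (simp add: sum_negf)
  moreover have "(\<Sum>i<n. \<Sum>j<n. f i j) = 0"
  proof (rule Suc.IH)
    show "f i j = - f j i" if "i < n" "j < n" for i j by (rule Suc.prems(1)) (use that in auto)
  qed (use Suc.prems(2) in simp)
  moreover have "f n n = 0" using Suc.prems(2) by simp
  ultimately show ?case by (simp add: sum.distrib add.commute)
qed simp

lemma alt_form_of: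
  assumes "M \<in> alt_mats n" shows "alt (form_of n M)"
  unfolding alt_def
proof (intro conjI allI)
  fix x
  have "form_of n M (x, x) = (\<Sum>i<n. \<Sum>j<n. x i * M $$ (i, j) * x j)" by (simp add: form_of_def)
  also have "\<dots> = 0"
  proof (rule sum_antisymmetric)
    fix i j assume "i < n" "j < n"
    then have m: "M $$ (i, j) = - M $$ (j, i)" using assms unfolding alt_mats_def by blast
    show "x i * M $$ (i, j) * x j = - (x j * M $$ (j, i) * x i)"
      unfolding m by (simp add: mult.commute mult.left_commute)
  next
    fix i assume "i < n"
    then have "M $$ (i, i) = 0" using assms unfolding alt_mats_def by blast
    then show "x i * M $$ (i, i) * x i = 0" by simp
  qed
  finally show "form_of n M (x, x) = 0" .
next
  show "lin (\<lambda>x. form_of n M (x, y))" for y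
    unfolding lin_def form_of_def fst_conv snd_conv plus_fun_apply smul_apply sum_distrib_left
    by (simp add: distrib_right sum.distrib mult.assoc)
  show "lin (\<lambda>y. form_of n M (x, y))" for x
    unfolding lin_def form_of_def fst_conv snd_conv plus_fun_apply smul_apply sum_distrib_left
    by (simp add: distrib_left sum.distrib mult.left_commute)
qed

lemma form_of_add:
  assumes "A \<in> carrier_mat n n" "B \<in> carrier_mat n n"
  shows "form_of n (A + B) = form_of n A + form_of n B"
proof
  fix p
  have "form_of n (A + B) p = (\<Sum>i<n. \<Sum>j<n. fst p i * A $$ (i, j) * snd p j + fst p i * B $$ (i, j) * snd p j)"
    unfolding form_of_def by (intro sum.cong refl) (use assms in \<open>simp add: distrib_left distrib_right\<close>)
  then show "form_of n (A + B) p = (form_of n A + form_of n B) p"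
    by (simp add: form_of_def sum.distrib)
qed

lemma form_of_smult: "A \<in> carrier_mat n n \<Longrightarrow> form_of n (c \<cdot>\<^sub>m A) = c \<odot> form_of n A"
  by (auto simp: form_of_def fun_eq_iff smul_apply sum_distrib_left intro!: sum.cong)

lemma form_of_zero: "form_of n (0\<^sub>m n n) = 0"
  by (auto simp: form_of_def fun_eq_iff)

lemma form_of_inject:
  assumes "A \<in> carrier_mat n n" "B \<in> carrier_mat n n"
    "\<And>x y. x \<in> coords n \<Longrightarrow> y \<in> coords n \<Longrightarrow> form_of n A (x, y) = form_of n B (x, y)"
  shows "A = B"
proof (rule eq_matI)
  fix i j assume "i < dim_row B" "j < dim_col B"
  then have ij: "i < n" "j < n" using assms(2) by auto
  show "A $$ (i, j) = B $$ (i, j)"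
    using assms(3)[OF unit_in_coords[OF ij(1)] unit_in_coords[OF ij(2)]] ij by (simp add: form_of_unit)
qed (use assms in auto)

lemma mat_subspaceD:
  fixes S :: "'a::field mat set"
  assumes "is_mat_subspace n S"
  shows "S \<subseteq> carrier_mat n n" "0\<^sub>m n n \<in> S" "A \<in> S \<Longrightarrow> B \<in> S \<Longrightarrow> A + B \<in> S" "A \<in> S \<Longrightarrow> c \<cdot>\<^sub>m A \<in> S"
proof -
  interpret submodule class_ring S "module_mat TYPE('a) n n"
    using assms by (simp add: is_mat_subspace_def VectorSpace.subspace_def)
  show "S \<subseteq> carrier_mat n n" using subset by (simp add: module_mat_simps)
  show "0\<^sub>m n n \<in> S" using zero_closed by (simp add: module_mat_simps)
  show "A \<in> S \<Longrightarrow> B \<in> S \<Longrightarrow> A + B \<in> S" using m_closed[of A B] by (simp add: module_mat_simps)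
  show "A \<in> S \<Longrightarrow> c \<cdot>\<^sub>m A \<in> S" using smult_closed[of c A] by (simp add: module_mat_simps class_ring_simps)
qed

lemma mat_subspaceI:
  fixes S :: "'a::field mat set"
  assumes "S \<subseteq> carrier_mat n n" "0\<^sub>m n n \<in> S" "\<And>A B. A \<in> S \<Longrightarrow> B \<in> S \<Longrightarrow> A + B \<in> S"
    "\<And>c A. A \<in> S \<Longrightarrow> c \<cdot>\<^sub>m A \<in> S"
  shows "is_mat_subspace n S"
proof -
  interpret V: vectorspace "class_ring :: 'a ring" "module_mat TYPE('a) n n" by (rule matrix_vs)
  show ?thesis unfolding is_mat_subspace_def VectorSpace.subspace_def submodule_def
    using assms matrix_vs V.module_axioms by (auto simp: module_mat_simps class_ring_simps)
qed

lemma span_image_coefficients: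
  assumes "finite A" "x \<in> fs.span (f ` A)"
  shows "\<exists>c. x = (\<Sum>a\<in>A. c a \<odot> f a)"
  using assms
proof (induction A arbitrary: x rule: finite_induct)
  case empty then show ?case by simp
next
  case (insert a A)
  have "x \<in> fs.span (insert (f a) (f ` A))" using insert.prems by simp
  then obtain k where "x - k \<odot> f a \<in> fs.span (f ` A)" using fs.span_insert[of "f a" "f ` A"] by auto
  then obtain c where c: "x - k \<odot> f a = (\<Sum>a\<in>A. c a \<odot> f a)" using insert.IH by blast
  have "(\<Sum>b\<in>insert a A. (c(a := k)) b \<odot> f b) = k \<odot> f a + (\<Sum>b\<in>A. (c(a := k)) b \<odot> f b)"
    using insert.hyps by simp
  also have "(\<Sum>b\<in>A. (c(a := k)) b \<odot> f b) = (\<Sum>b\<in>A. c b \<odot> f b)"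
    by (rule sum.cong) (use insert.hyps in auto)
  finally have "x = (\<Sum>b\<in>insert a A. (c(a := k)) b \<odot> f b)" unfolding c[symmetric] by simp
  then show ?case by blast
qed

lemma forms_fds:
  assumes "is_mat_subspace n S"
  shows "fds (form_of n ` S)"
proof -
  note S = mat_subspaceD[OF assms]
  have sub: "fs.subspace (form_of n ` S)"
    unfolding fs.subspace_def
  proof (intro conjI ballI allI)
    show "0 \<in> form_of n ` S" using S(2) form_of_zero[of n] by (metis imageI)
    fix x assume x: "x \<in> form_of n ` S"
    then obtain A where A: "A \<in> S" "x = form_of n A" by blast
    show "c \<odot> x \<in> form_of n ` S" for c using S(4)[OF A(1)] form_of_smult[of A n c] A S(1) by (metis imageI subsetD)
    fix y assume "y \<in> form_of n ` S"
    then obtain B where B: "B \<in> S" "y = form_of n B" by blast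
    show "x + y \<in> form_of n ` S" using S(3)[OF A(1) B(1)] form_of_add[of A n B] A B S(1) by (metis imageI subsetD)
  qed
  \<comment> \<open>The elementary bilinear forms, a finite spanning set for all forms of
    matrices.\<close>
  let ?e = "\<lambda>p q. fst q (fst p) * snd q (snd p)"
  let ?P = "{..<n} \<times> {..<n}"
  have "form_of n M \<in> fs.span (?e ` ?P)" for M :: "'a mat"
  proof -
    have "form_of n M q = (\<Sum>p\<in>?P. M $$ p \<odot> ?e p) q" for q :: "(nat \<Rightarrow> 'a) \<times> (nat \<Rightarrow> 'a)"
    proof -
      have "(\<Sum>p\<in>?P. M $$ p \<odot> ?e p) q = (\<Sum>p\<in>?P. (M $$ p \<odot> ?e p) q)" by (rule lin_sum[OF lin_eval])
      also have "\<dots> = (\<Sum>i<n. \<Sum>j<n. M $$ (i, j) * (fst q i * snd q j))"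
        by (simp add: sum.cartesian_product smul_apply case_prod_beta)
      also have "\<dots> = form_of n M q" by (simp add: form_of_def algebra_simps)
      finally show ?thesis ..
    qed
    then have "form_of n M = (\<Sum>p\<in>?P. M $$ p \<odot> ?e p)" by (rule ext)
    moreover have "(\<Sum>p\<in>?P. M $$ p \<odot> ?e p) \<in> fs.span (?e ` ?P)"
      by (intro fs.span_sum fs.span_scale fs.span_base) auto
    ultimately show ?thesis by metis
  qed
  then have "form_of n ` S \<subseteq> fs.span (?e ` ?P)" by blast
  moreover have "finite (?e ` ?P)" by simp
  ultimately show ?thesis using sub unfolding fds_def by blast
qed

text \<open>Preimages in \<open>S\<close> of a basis of the forms generate \<open>S\<close>, because
  \<open>form_of n\<close> is linear and injective on \<open>S\<close>. This direction is what
  transfers a lower bound on the dimension of matrices to forms.\<close>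

lemma mat_subspace_dim_le:
  fixes S :: "'a::field mat set"
  assumes "is_mat_subspace n S"
  shows "mat_subspace_dim n S \<le> fs.dim (form_of n ` S)"
proof -
  note S = mat_subspaceD[OF assms]
  interpret V: vectorspace "class_ring :: 'a ring" "module_mat TYPE('a) n n" by (rule matrix_vs)
  interpret W: vectorspace "class_ring :: 'a ring" "(module_mat TYPE('a) n n)\<lparr>carrier := S\<rparr>"
    by (rule V.subspace_is_vs) (use assms in \<open>simp add: is_mat_subspace_def\<close>)
  have inj: "inj_on (form_of n) S"
  proof (rule inj_onI)
    fix A B assume "A \<in> S" "B \<in> S" "form_of n A = form_of n B"
    then show "A = B" using form_of_inject[of A n B] S(1) by auto
  qed
  obtain B where B: "finite B" "\<not> fs.dependent B" "fs.span B = form_of n ` S" "card B = fs.dim (form_of n ` S)" "B \<subseteq> form_of n ` S"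
    using fds_basis[OF forms_fds[OF assms]] by metis
  obtain A where A: "A \<subseteq> S" "form_of n ` A = B" using B(5) by (metis subset_imageE)
  have injA: "inj_on (form_of n) A" using inj A(1) inj_on_subset by blast
  have fA: "finite A" using A(2) B(1) injA finite_image_iff by blast
  have cA: "card A = fs.dim (form_of n ` S)" using card_image[OF injA] A(2) B(4) by simp
  have Ac: "A \<subseteq> carrier ((module_mat TYPE('a) n n)\<lparr>carrier := S\<rparr>)" using A(1) by simp
  let ?sp = "W.span A"
  have spS: "?sp \<subseteq> S" using W.span_is_subset2[OF Ac] by simp
  interpret sp: submodule class_ring ?sp "(module_mat TYPE('a) n n)\<lparr>carrier := S\<rparr>"
    by (rule W.span_is_submodule[OF Ac])
  have z: "0\<^sub>m n n \<in> ?sp" using sp.zero_closed by (simp add: module_mat_simps)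
  have p: "X + Y \<in> ?sp" if "X \<in> ?sp" "Y \<in> ?sp" for X Y
    using sp.m_closed[OF that] by (simp add: module_mat_simps)
  have m: "c \<cdot>\<^sub>m X \<in> ?sp" if "X \<in> ?sp" for X c
    using sp.smult_closed[of c X] that by (simp add: module_mat_simps class_ring_simps)
  have "fs.subspace (form_of n ` ?sp)"
    unfolding fs.subspace_def
  proof (intro conjI ballI allI)
    show "0 \<in> form_of n ` ?sp" using z form_of_zero[of n] by (metis imageI)
    fix x assume "x \<in> form_of n ` ?sp"
    then obtain X where X: "X \<in> ?sp" "x = form_of n X" by blast
    have Xc: "X \<in> carrier_mat n n" using X(1) spS S(1) by blast
    show "c \<odot> x \<in> form_of n ` ?sp" for c using m[OF X(1), of c] form_of_smult[OF Xc, of c] X(2) by (metis imageI)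
    fix y assume "y \<in> form_of n ` ?sp"
    then obtain Y where Y: "Y \<in> ?sp" "y = form_of n Y" by blast
    have Yc: "Y \<in> carrier_mat n n" using Y(1) spS S(1) by blast
    show "x + y \<in> form_of n ` ?sp" using p[OF X(1) Y(1)] form_of_add[OF Xc Yc] X(2) Y(2) by (metis imageI)
  qed
  moreover have "B \<subseteq> form_of n ` ?sp" using A(2) W.in_own_span[OF Ac] by blast
  ultimately have "form_of n ` S \<subseteq> form_of n ` ?sp" using fs.span_minimal B(3) by metis
  then have "S \<subseteq> ?sp" using inj spS by (auto simp: inj_on_def subset_iff image_iff)
  then have "?sp = carrier ((module_mat TYPE('a) n n)\<lparr>carrier := S\<rparr>)" using spS by simp
  then have "W.dim \<le> card A" using W.gen_ge_dim[OF fA Ac] by simp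
  then show ?thesis using cA by (simp add: mat_subspace_dim_def)
qed

text \<open>If \<open>dim F\<close> exceeded the rank, some nonzero \<open>x\<close> in
  \<open>F\<close> would be orthogonal to a maximal independent set of columns, hence to all
  columns, and would lie in the radical of the form.\<close>

lemma nondeg_dim_le_rank:
  fixes M :: "'a::field mat"
  assumes M: "M \<in> carrier_mat n n" and r: "vec_space.rank n M \<le> r"
    and F: "fds F" "F \<subseteq> coords n" "nondeg (form_of n M) F"
  shows "fs.dim F \<le> r"
proof (rule ccontr)
  assume "\<not> fs.dim F \<le> r"
  interpret vec_space "TYPE('a)" n .
  have cc: "set (cols M) \<subseteq> carrier_vec n" using M cols_dim by blast
  obtain U where U: "maximal U (\<lambda>T. T \<subseteq> set (cols M) \<and> lin_indpt T)"
    using maximal_exists[of "(\<lambda>T. T \<subseteq> set (cols M) \<and> lin_indpt T)" "card (set (cols M))" "{}"]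
    by (meson List.finite_set card_mono empty_iff empty_subsetI finite_lin_indpt2 rev_finite_subset)
  have Ui: "lin_indpt U" "U \<subseteq> set (cols M)" using U by (auto simp: maximal_def)
  have fU: "finite U" using Ui(2) finite_subset by blast
  have Uc: "U \<subseteq> carrier_vec n" using Ui(2) cc by blast
  have cU: "card U < fs.dim F" using rank_card_indpt[OF M U] r \<open>\<not> fs.dim F \<le> r\<close> by simp
  have span: "c \<in> span U" if c: "c \<in> set (cols M)" for c
  proof (rule ccontr)
    assume n: "c \<notin> span U"
    have "c \<notin> U" using n in_own_span[of U] Uc by auto
    then have "lin_indpt (U \<union> {c})" using lin_dep_iff_in_span[of U c] Uc Ui(1) cc c n by auto
    then have "U \<union> {c} = U" using U c Ui(2) unfolding maximal_def by blast
    then show False using \<open>c \<notin> U\<close> by blast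
  qed
  let ?g = "\<lambda>u x. \<Sum>i<n. x i * u $ i"
  have lg: "lin (?g u)" for u :: "'a vec"
    by (simp add: lin_def smul_apply algebra_simps sum.distrib sum_distrib_left)
  obtain x where x: "x \<in> F" "x \<noteq> 0" "\<And>u. u \<in> U \<Longrightarrow> ?g u x = 0"
    by (rule fds_common_zero[OF F(1) fU, of ?g]) (use lg cU in auto)
  let ?v = "vec n x"
  have g: "?g c x = ?v \<bullet> c" if "c \<in> carrier_vec n" for c
    using that by (auto simp: scalar_prod_def lessThan_atLeast0 intro!: sum.cong)
  let ?Z = "{c \<in> carrier_vec n. ?v \<bullet> c = 0}"
  have "submodule class_ring ?Z (module_vec TYPE('a) n)"
    unfolding submodule_def using vec_module
    by (auto simp: module_vec_simps class_ring_simps scalar_prod_add_distrib[of _ n] scalar_prod_smult_right)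
  moreover have "U \<subseteq> ?Z"
  proof
    fix u assume u: "u \<in> U"
    then have "u \<in> carrier_vec n" using Uc by blast
    then show "u \<in> ?Z" using g[of u] x(3)[OF u] by simp
  qed
  ultimately have "span U \<subseteq> ?Z" by (rule span_is_subset[rotated])
  then have zero: "?v \<bullet> c = 0" if "c \<in> span U" for c using that by blast
  have "form_of n M (x, y) = 0" for y
  proof -
    have "form_of n M (x, y) = (\<Sum>j<n. \<Sum>i<n. x i * M $$ (i, j) * y j)"
      unfolding form_of_def fst_conv snd_conv by (rule sum.swap)
    also have "\<dots> = (\<Sum>j<n. (?v \<bullet> col M j) * y j)"
      using M by (intro sum.cong) (auto simp: scalar_prod_def sum_distrib_right lessThan_atLeast0 intro!: sum.cong)
    also have "\<dots> = 0"
    proof (rule sum.neutral, rule ballI)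
      fix j assume "j \<in> {..<n}"
      then have "col M j \<in> set (cols M)" using M by (auto simp: cols_def)
      then show "(?v \<bullet> col M j) * y j = 0" using zero span by simp
    qed
    finally show ?thesis .
  qed
  then show False using nondegD[OF F(3) x(1)] x(2) by blast
qed

text \<open>The vectors of \<open>R\<close> come last, as the zero blocks in \<open>WA\<close>
  concern the large indices.\<close>

lemma adapted_basis:
  fixes E :: "('i \<Rightarrow> 'a::field) set"
  assumes "fds E" "fds R" "R \<subseteq> E" "fs.dim R + k = fs.dim E"
  obtains q :: "nat \<Rightarrow> 'i \<Rightarrow> 'a" where "\<And>i. i < fs.dim E \<Longrightarrow> q i \<in> E" "\<And>i. k \<le> i \<Longrightarrow> i < fs.dim E \<Longrightarrow> q i \<in> R"
    "fs.span (q ` {..<fs.dim E}) = E"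
proof -
  obtain C where C: "fds C" "C \<subseteq> E" "fs.dim R + fs.dim C = fs.dim E" "R \<inter> C = {0}"
    "\<forall>v\<in>E. \<exists>w\<in>R. \<exists>c\<in>C. v = w + c" by (rule fds_complement[OF assms(1) fds_subspace[OF assms(2)] assms(3)])
  obtain X where X: "finite X" "\<not> fs.dependent X" "fs.span X = C" "card X = fs.dim C" "X \<subseteq> C"
    using fds_basis[OF C(1)] by metis
  obtain Y where Y: "finite Y" "\<not> fs.dependent Y" "fs.span Y = R" "card Y = fs.dim R" "Y \<subseteq> R"
    using fds_basis[OF assms(2)] by metis
  have cX: "card X = k" using X(4) C(3) assms(4) by simp
  obtain f where f: "f ` {0..<k} = X" using ex_bij_betw_nat_finite[OF X(1)] cX by (auto simp: bij_betw_def)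
  obtain g where g: "g ` {0..<fs.dim R} = Y" using ex_bij_betw_nat_finite[OF Y(1)] Y(4) by (auto simp: bij_betw_def)
  define q where "q i = (if i < k then f i else g (i - k))" for i
  have qX: "q i \<in> X" if "i < k" for i using that f by (auto simp: q_def)
  have qY: "q i \<in> Y" if "k \<le> i" "i < fs.dim E" for i
  proof -
    have "i - k \<in> {0..<fs.dim R}" using that assms(4) by auto
    then show ?thesis using that(1) g by (auto simp: q_def)
  qed
  have "X \<union> Y \<subseteq> q ` {..<fs.dim E}"
  proof
    fix x assume "x \<in> X \<union> Y"
    then show "x \<in> q ` {..<fs.dim E}"
    proof
      assume "x \<in> X"
      then obtain i where "i < k" "x = f i" using f by auto
      then show ?thesis using assms(4) by (intro image_eqI[of _ _ i]) (auto simp: q_def)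
    next
      assume "x \<in> Y"
      then obtain i where "i < fs.dim R" "x = g i" using g by auto
      then show ?thesis using assms(4) by (intro image_eqI[of _ _ "i + k"]) (auto simp: q_def)
    qed
  qed
  moreover have qE: "q i \<in> E" if "i < fs.dim E" for i
    using qX[of i] qY[of i] that X(5) Y(5) C(2) assms(3) by (cases "i < k") auto
  moreover have "E \<subseteq> fs.span (X \<union> Y)"
  proof
    fix v assume "v \<in> E"
    then obtain w c where "w \<in> R" "c \<in> C" "v = w + c" using C(5) by blast
    then show "v \<in> fs.span (X \<union> Y)"
      using fs.span_mono[of X "X \<union> Y"] fs.span_mono[of Y "X \<union> Y"] X(3) Y(3) fs.span_add by blast
  qed
  ultimately have "fs.span (q ` {..<fs.dim E}) = E"
    using fs.span_mono[of "X \<union> Y" "q ` {..<fs.dim E}"] fs.span_minimal[of "q ` {..<fs.dim E}" E] fds_subspace[OF assms(1)] by auto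
  then show thesis using that[of q] qE qY Y(5) by blast
qed

text \<open>With the \<open>q i\<close> as rows of \<open>Q\<close>, the matrix
  \<open>Q * M * transpose_mat Q\<close> is the Gram matrix of the form in the new basis.
  \<open>P\<close> is the inverse of \<open>Q\<close>, obtained by expanding the unit vectors, and
  carries these matrices back to \<open>S\<close>.\<close>

lemma congruence_from_basis:
  fixes S :: "'a::field mat set"
  assumes S: "is_mat_subspace n S" "S \<subseteq> alt_mats n"
    and q: "\<And>i. i < n \<Longrightarrow> q i \<in> coords n" "fs.span (q ` {..<n}) = coords n"
  obtains T where "is_mat_subspace n T" "T \<subseteq> alt_mats n" "congruent_sets n S T"
    "\<And>N. N \<in> T \<Longrightarrow> \<exists>M\<in>S. \<forall>i<n. \<forall>j<n. N $$ (i, j) = form_of n M (q i, q j)"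
proof -
  note S' = mat_subspaceD[OF S(1)]
  have "\<exists>c. (unit i :: nat \<Rightarrow> 'a) = (\<Sum>j<n. c j \<odot> q j)" if "i < n" for i
    by (rule span_image_coefficients) (use q(2) unit_in_coords[OF that] in auto)
  then obtain c where c: "\<And>i. i < n \<Longrightarrow> (unit i :: nat \<Rightarrow> 'a) = (\<Sum>j<n. c i j \<odot> q j)" by metis
  define Q where "Q = mat n n (\<lambda>(i, j). q i j)"
  define P where "P = mat n n (\<lambda>(i, j). c i j)"
  have QP: "Q \<in> carrier_mat n n" "P \<in> carrier_mat n n" by (auto simp: Q_def P_def)
  have PQ1: "P * Q = 1\<^sub>m n"
  proof (rule eq_matI)
    fix i k assume "i < dim_row (1\<^sub>m n :: 'a mat)" "k < dim_col (1\<^sub>m n :: 'a mat)"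
    then have ik: "i < n" "k < n" by auto
    have "(P * Q) $$ (i, k) = (\<Sum>j<n. c i j * q j k)"
      using ik by (simp add: P_def Q_def scalar_prod_def lessThan_atLeast0)
    also have "\<dots> = (\<Sum>j<n. c i j \<odot> q j) k"
      using lin_sum[OF lin_eval[of k], of "\<lambda>j. c i j \<odot> q j" "{..<n}"] by (simp add: smul_apply)
    also have "\<dots> = 1\<^sub>m n $$ (i, k)" using ik c[OF ik(1), symmetric] by (auto simp: unit_def)
    finally show "(P * Q) $$ (i, k) = 1\<^sub>m n $$ (i, k)" .
  qed (use QP in auto)
  have QP1: "Q * P = 1\<^sub>m n" by (rule mat_mult_left_right_inverse[OF QP(2,1) PQ1])
  have invP: "invertible_mat P"
    unfolding invertible_mat_def inverts_mat_def using QP PQ1 QP1 by (intro conjI exI[of _ Q]) auto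
  let ?f = "\<lambda>M. Q * M * transpose_mat Q"
  let ?T = "?f ` S"
  have entry: "?f M $$ (i, j) = form_of n M (q i, q j)" if M: "M \<in> carrier_mat n n" and ij: "i < n" "j < n" for M i j
  proof -
    have "?f M $$ (i, j) = (\<Sum>l<n. (\<Sum>k<n. q i k * M $$ (k, l)) * q j l)"
      using M ij QP by (simp add: Q_def scalar_prod_def lessThan_atLeast0)
    also have "\<dots> = (\<Sum>l<n. \<Sum>k<n. q i k * M $$ (k, l) * q j l)" by (simp add: sum_distrib_right)
    also have "\<dots> = form_of n M (q i, q j)" unfolding form_of_def fst_conv snd_conv by (rule sum.swap)
    finally show ?thesis .
  qed
  have Tc: "?f M \<in> carrier_mat n n" if "M \<in> carrier_mat n n" for M using QP that by auto
  show thesis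
  proof (rule that[of ?T])
    show "is_mat_subspace n ?T"
    proof (rule mat_subspaceI)
      show "?T \<subseteq> carrier_mat n n" using Tc S'(1) by blast
      have "?f (0\<^sub>m n n) = 0\<^sub>m n n" using QP by simp
      then show "0\<^sub>m n n \<in> ?T" using S'(2) by (metis imageI)
      fix A assume "A \<in> ?T"
      then obtain X where X: "X \<in> S" "A = ?f X" by blast
      have Xc: "X \<in> carrier_mat n n" using X(1) S'(1) by blast
      have "?f (k \<cdot>\<^sub>m X) = k \<cdot>\<^sub>m A" for k
        unfolding X(2) using QP Xc by (simp add: mult_smult_distrib[of _ n n] mult_smult_assoc_mat[of _ n n])
      then show "k \<cdot>\<^sub>m A \<in> ?T" for k using S'(4)[OF X(1), of k] by (metis imageI)
      fix B assume "B \<in> ?T"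
      then obtain Y where Y: "Y \<in> S" "B = ?f Y" by blast
      have Yc: "Y \<in> carrier_mat n n" using Y(1) S'(1) by blast
      have "?f (X + Y) = A + B" unfolding X(2) Y(2)
        using QP Xc Yc by (simp add: mult_add_distrib_mat[of _ n n] add_mult_distrib_mat[of _ n n])
      then show "A + B \<in> ?T" using S'(3)[OF X(1) Y(1)] by (metis imageI)
    qed
    show "?T \<subseteq> alt_mats n"
    proof
      fix A assume "A \<in> ?T"
      then obtain X where X: "X \<in> S" "A = ?f X" by blast
      have Xc: "X \<in> carrier_mat n n" using X(1) S'(1) by blast
      have aX: "alt (form_of n X)" using alt_form_of X(1) S(2) by blast
      show "A \<in> alt_mats n"
        unfolding alt_mats_def X(2)
      proof (intro CollectI conjI allI impI)
        show "?f X \<in> carrier_mat n n" by (rule Tc[OF Xc])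
        show "?f X $$ (i, j) = - ?f X $$ (j, i)" if "i < n" "j < n" for i j
          unfolding entry[OF Xc that] entry[OF Xc that(2,1)] by (rule alt_swap[OF aX])
        show "?f X $$ (i, i) = 0" if "i < n" for i
          unfolding entry[OF Xc that that] by (rule alt_self[OF aX])
      qed
    qed
    show "congruent_sets n S ?T" unfolding congruent_sets_def
    proof (intro bexI[of _ P] conjI invP QP(2))
      have "P * ?f M * transpose_mat P = M" if M: "M \<in> carrier_mat n n" for M
      proof -
        have QtPt: "transpose_mat Q * transpose_mat P = 1\<^sub>m n"
          using transpose_mult[OF QP(2,1)] PQ1 by simp
        have tc: "transpose_mat Q \<in> carrier_mat n n" "transpose_mat P \<in> carrier_mat n n" using QP by auto
        have "P * ?f M * transpose_mat P = P * (Q * M) * (transpose_mat Q * transpose_mat P)"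
          using QP M tc by (simp add: assoc_mult_mat[of _ n n _ n _ n])
        also have "\<dots> = (P * Q) * M" using QP M QtPt by (simp add: assoc_mult_mat[of _ n n _ n _ n])
        also have "\<dots> = M" using PQ1 M by simp
        finally show ?thesis .
      qed
      then have "(\<lambda>M. P * ?f M * transpose_mat P) ` S = (\<lambda>M. M) ` S" using S'(1) by (intro image_cong) auto
      then show "S = (\<lambda>M. P * M * transpose_mat P) ` ?T" unfolding image_image by simp
    qed
    show "\<exists>M\<in>S. \<forall>i<n. \<forall>j<n. N $$ (i, j) = form_of n M (q i, q j)" if "N \<in> ?T" for N
      using that entry S'(1) by blast
  qed
qed

theorem theorem1p4:
  fixes S :: "'a::field mat set" and n r s :: nat
  assumes "0 < n" and "r = 2 * s" and "0 < r" and "r < n"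
    and "is_mat_subspace n S" and "S \<subseteq> alt_mats n"
    and "mat_subspace_dim n S > max (a_nst n 1 (r - 1)) (a_nst n (s - 1) 3)"
    and "urk_le n S r"
  shows "(\<exists>T. is_mat_subspace n T \<and> T \<subseteq> WA n 0 (r + 1) \<and> congruent_sets n S T)
       \<or> (\<exists>T. is_mat_subspace n T \<and> T \<subseteq> WA n s 1 \<and> congruent_sets n S T)"
proof -
  let ?E = "coords n :: (nat \<Rightarrow> 'a) set"
  let ?S = "form_of n ` S"
  note S = mat_subspaceD[OF assms(5)]
  have fS: "fds ?S" by (rule forms_fds[OF assms(5)])
  have aS: "alt N" if "N \<in> ?S" for N using that alt_form_of assms(6) by blast
  have fE: "fds ?E" "fs.dim ?E = n" by (rule coords_dim)+
  have sn: "1 \<le> s" "2 * s + 1 \<le> n" using assms(2-4) by auto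
  have rank: "fs.dim F \<le> 2 * s + 1" if N: "N \<in> ?S" and F: "fds F" "F \<subseteq> ?E" "nondeg N F" for N F
  proof -
    obtain M where M: "M \<in> S" "N = form_of n M" using N by blast
    have "vec_space.rank n M \<le> r" using assms(8) M(1) by (simp add: urk_le_def)
    moreover have "M \<in> carrier_mat n n" using M(1) S(1) by blast
    ultimately have "fs.dim F \<le> r" using nondeg_dim_le_rank F M(2) by blast
    then show ?thesis using assms(2) by simp
  qed
  \<comment> \<open>A matrix is determined by its form on the coordinate space, so there
    \<open>delta\<close> is the full dimension.\<close>
  have "?S \<inter> van (?E \<times> ?E) = {0}"
  proof
    show "?S \<inter> van (?E \<times> ?E) \<subseteq> {0}"
    proof
      fix N assume N: "N \<in> ?S \<inter> van (?E \<times> ?E)"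
      then obtain M where M: "M \<in> S" "N = form_of n M" by blast
      have "M = 0\<^sub>m n n"
      proof (rule form_of_inject)
        show "form_of n M (x, y) = form_of n (0\<^sub>m n n) (x, y)" if "x \<in> ?E" "y \<in> ?E" for x y
          using N that M(2) by (simp add: form_of_zero in_van)
      qed (use M(1) S(1) in auto)
      then show "N \<in> {0}" using M(2) form_of_zero by simp
    qed
    show "{0} \<subseteq> ?S \<inter> van (?E \<times> ?E)" using fds_0[OF fS] by (simp add: in_van)
  qed
  then have "delta ?S (?E \<times> ?E) = fs.dim ?S" using delta_dim[OF fS, of "?E \<times> ?E"] by (simp add: dim_0)
  then have big: "max (a_nst n 1 (r - 1)) (a_nst n (s - 1) 3) < delta ?S (?E \<times> ?E)"
    using mat_subspace_dim_le[OF assms(5)] assms(7) by linarith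
  \<comment> \<open>The two terms of the maximum become the two numerical hypotheses:
    \<open>1 choose 2\<close> is 0 in the first, and \<open>3 choose 2\<close> is the summand 3 in
    the second.\<close>
  have "a_nst n 1 (r - 1) = ((2 * s - 1) choose 2) + (n - 1)" using assms(2) by (simp add: a_nst_def)
  then have A1: "((2 * s - 1) choose 2) + (fs.dim ?E - 1) < delta ?S (?E \<times> ?E)" using big fE(2) by simp
  have "n - (s - 1) = n - s + 1" using sn by simp
  then have "a_nst n (s - 1) 3 = ((s - 1) choose 2) + 3 + (s - 1) * (n - s + 1)"
    by (simp add: a_nst_def numeral_eq_Suc)
  then have A2: "((s - 1) choose 2) + 3 + (s - 1) * (fs.dim ?E - s + 1) < delta ?S (?E \<times> ?E)" using big fE(2) by simp
  have "(\<exists>R. fds R \<and> R \<subseteq> ?E \<and> fs.dim R + 2 * s + 1 = fs.dim ?E \<and> (\<forall>N\<in>?S. \<forall>x\<in>R. \<forall>y\<in>?E. N (x, y) = 0)) \<or>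
    (\<exists>F. fds F \<and> F \<subseteq> ?E \<and> fs.dim F + s = fs.dim ?E \<and> (\<forall>N\<in>?S. \<forall>x\<in>F. \<forall>y\<in>F. N (x, y) = 0))"
    by (rule alternating_forms_bounded_rank[OF fS aS fE(1) sn(1) _ rank A1 A2]) (use sn fE(2) in simp_all)
  then show ?thesis
  proof
    assume "\<exists>R. fds R \<and> R \<subseteq> ?E \<and> fs.dim R + 2 * s + 1 = fs.dim ?E \<and> (\<forall>N\<in>?S. \<forall>x\<in>R. \<forall>y\<in>?E. N (x, y) = 0)"
    then obtain R where R: "fds R" "R \<subseteq> ?E" "fs.dim R + (2 * s + 1) = fs.dim ?E" "\<forall>N\<in>?S. \<forall>x\<in>R. \<forall>y\<in>?E. N (x, y) = 0" by auto
    obtain q where q: "\<And>i. i < n \<Longrightarrow> q i \<in> ?E" "\<And>i. 2 * s + 1 \<le> i \<Longrightarrow> i < n \<Longrightarrow> q i \<in> R" "fs.span (q ` {..<n}) = ?E"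
      using adapted_basis[OF fE(1) R(1-3)] unfolding fE(2) by metis
    obtain T where T: "is_mat_subspace n T" "T \<subseteq> alt_mats n" "congruent_sets n S T"
      "\<And>N. N \<in> T \<Longrightarrow> \<exists>M\<in>S. \<forall>i<n. \<forall>j<n. N $$ (i, j) = form_of n M (q i, q j)"
      using congruence_from_basis[OF assms(5,6) q(1,3)] by metis
    have "N $$ (i, j) = 0" if N: "N \<in> T" and ij: "i < n" "j < n" "r + 1 \<le> max i j" for N i j
    proof -
      obtain M where M: "M \<in> S" "N $$ (i, j) = form_of n M (q i, q j)" using T(4)[OF N] ij by blast
      have aM: "alt (form_of n M)" using aS M(1) by blast
      \<comment> \<open>For the first parameter 0 of \<open>WA\<close> the larger index alone
        decides, so one radical vector of the pair must suffice.\<close>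
      have "q i \<in> R \<or> q j \<in> R" using q(2) ij assms(2) by (auto simp: max_def split: if_splits)
      then show ?thesis
        using R(4) M q(1) ij alt_zero_swap[OF aM, of "q i" "q j"] by auto
    qed
    then have "T \<subseteq> WA n 0 (r + 1)" using T(2) unfolding WA_def by auto
    then show ?thesis using T by blast
  next
    assume "\<exists>F. fds F \<and> F \<subseteq> ?E \<and> fs.dim F + s = fs.dim ?E \<and> (\<forall>N\<in>?S. \<forall>x\<in>F. \<forall>y\<in>F. N (x, y) = 0)"
    then obtain F where F: "fds F" "F \<subseteq> ?E" "fs.dim F + s = fs.dim ?E" "\<forall>N\<in>?S. \<forall>x\<in>F. \<forall>y\<in>F. N (x, y) = 0" by auto
    obtain q where q: "\<And>i. i < n \<Longrightarrow> q i \<in> ?E" "\<And>i. s \<le> i \<Longrightarrow> i < n \<Longrightarrow> q i \<in> F" "fs.span (q ` {..<n}) = ?E"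
      using adapted_basis[OF fE(1) F(1-3)] unfolding fE(2) by metis
    obtain T where T: "is_mat_subspace n T" "T \<subseteq> alt_mats n" "congruent_sets n S T"
      "\<And>N. N \<in> T \<Longrightarrow> \<exists>M\<in>S. \<forall>i<n. \<forall>j<n. N $$ (i, j) = form_of n M (q i, q j)"
      using congruence_from_basis[OF assms(5,6) q(1,3)] by metis
    have "N $$ (i, j) = 0" if N: "N \<in> T" and ij: "i < n" "j < n" "s \<le> i" "s \<le> j" for N i j
    proof -
      obtain M where M: "M \<in> S" "N $$ (i, j) = form_of n M (q i, q j)" using T(4)[OF N] ij by blast
      then show ?thesis using F(4) q(2) ij by auto
    qed
    then have "T \<subseteq> WA n s 1" using T(2) unfolding WA_def by auto
    then show ?thesis using T by blast
  qed
qed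

end
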